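(* Let $M_n=m_n(X^n)$ be a maximally invariant statistic for the action of $G$ on $\mathcal{X}^n$. Assume that there exists a pair of probability distributions $\mathbf{\Pi}_0^\star,\mathbf{\Pi}_1^\star$ on $\Delta_0$ and $\Delta_1$, respectively, that satisfy $$\mathrm{KL}\left(\mathbf{\Pi}_1^{\star\delta}\mathbf{Q}_\delta^{M_n},\mathbf{\Pi}_0^{\star\delta}\mathbf{P}_\delta^{M_n}\right)=\min_{\mathbf{\Pi}_0,\mathbf{\Pi}_1}\mathrm{KL}\left(\mathbf{\Pi}_1^{\delta}\mathbf{Q}_\delta^{M_n},\mathbf{\Pi}_0^{\delta}\mathbf{P}_\delta^{M_n}\right),$$ the minimum being over pairs of probability distributions on $\Delta_0$ and $\Delta_1$. For each $g\in G$, define the probability distributions $\mathbf{P}_g^\star=\mathbf{\Pi}_0^{\star\delta}\mathbf{P}_{g,\delta}$ and $\mathbf{Q}_g^\star=\mathbf{\Pi}_1^{\star\delta}\mathbf{Q}_{g,\delta}$ on $\mathcal{X}^n$. Suppose that $G$ is amenable and that: (1) as topological spaces, $G$ and $\mathcal{X}^n$ are Polish and locally compact; (2) the action of $G$ on $\mathcal{X}^n$ is free, continuous and proper; (3) the models $\{\mathbf{P}^\star_g\}_{g\in G}$ and $\{\mathbf{Q}^\star_g\}_{g\in G}$ are invariant and have densities $p^\star_g,q^\star_g$ with respect to a common measure $\mu$ on $\mathcal{X}^n$ that is relatively left invariant with some multiplier $\chi$, and all densities have a single common support; (4) there is $\varepsilon>0$ such that $$\mathbf{E}_{X^n\sim\mathbf{Q}^\star_1}\left[\left|\ln\frac{q^\star_1(X^n)}{p^\star_1(X^n)}\right|^{1+\varepsilon}\right]<\infty\quad\text{and}\quad\mathbf{E}_{X^n\sim\mathbf{Q}^\star_1}\left[\left|\ln\frac{q^{\star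 M_n}(M_n)}{p^{\star M_n}(M_n)}\right|^{1+\varepsilon}\right]<\infty,$$ where the subindex $1$ refers to the unit element of $G$ and $p^{\star M_n},q^{\star M_n}$ are the densities of $M_n$ under $\mathbf{P}^\star_g$ and $\mathbf{Q}^\star_g$ (which do not depend on $g$). Then $$\inf_{\mathbf{\Pi}_0,\mathbf{\Pi}_1}\mathrm{KL}\left(\mathbf{\Pi}_1^{g,\delta}\mathbf{Q}_{g,\delta},\mathbf{\Pi}_0^{g,\delta}\mathbf{P}_{g,\delta}\right)=\min_{\mathbf{\Pi}_0,\mathbf{\Pi}_1}\mathrm{KL}\left(\mathbf{\Pi}_1^{\delta}\mathbf{Q}_\delta^{M_n},\mathbf{\Pi}_0^{\delta}\mathbf{P}_\delta^{M_n}\right),$$ where on the left the infimum is over pairs of probability distributions $\mathbf{\Pi}_0$ on $G\times\Delta_0$ and $\mathbf{\Pi}_1$ on $G\times\Delta_1$, and on the right the minimum is over pairs of probability distributions on $\Delta_0$ and $\Delta_1$.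
   Context: $G$ is a topological group acting on the observation space $\mathcal{X}$, on $\mathcal{X}^n$ componentwise, and freely on a parameter space $\Theta$; $G$ and $\mathcal{X}^n$ carry their Borel $\sigma$-algebras. $X^n$ is the data, with values in $\mathcal{X}^n$. $\{\mathbf{P}_\theta\}_{\theta\in\Theta}$ is an invariant model: $\mathbf{P}_\theta\{X^n\in B\}=\mathbf{P}_{g\theta}\{X^n\in gB\}$. The parameter of interest $\delta=\delta(\theta)$ is maximally invariant: $\delta(\theta)=\delta(\theta')$ iff $\theta=g\theta'$ for some $g\in G$. For each value $\delta$ one fixes an element $\theta_\delta$ with $\delta(\theta_\delta)=\delta$; for $\delta\in\Delta_0$ set $\mathbf{P}_{g,\delta}=\mathbf{P}_{g\theta_\delta}$, and for $\delta\in\Delta_1$ set $\mathbf{Q}_{g,\delta}=\mathbf{P}_{g\theta_\delta}$, where $\Delta_0,\Delta_1$ are two sets of values of $\delta$. Thus for each fixed $\delta$ the families $\{\mathbf{P}_{g,\delta}\}_{g}$ and $\{\mathbf{Q}_{g,\delta}\}_g$ are invariant, where a family $\{\mathbf{P}_g\}_{g\in G}$ is invariant if $\mathbf{P}_{hg}\{X^n\in hB\}=\mathbf{P}_g\{X^n\in B\}$ for all $g,h\in G$ and measurable $B\subseteq\mathcal X^n$. The distributions are assumed to depend measurably on $(g,\delta)$ so that mixtures are defined. Statistics are measurable functions of the data with values in a standard Borel space. $M_n=m_n(X^n)$ is maximally invariant if $m_n(x)=m_n(x')$ iff $x=gx'$ for some $g\in G$. Its distribution under $\mathbf{P}_{g,\delta}$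 (resp. $\mathbf{Q}_{g,\delta}$) does not depend on $g$ and is denoted $\mathbf{P}_\delta^{M_n}$ (resp. $\mathbf{Q}_\delta^{M_n}$). Mixtures: $\mathbf{\Pi}^{\delta}\mathbf{P}_{\delta}$ denotes $B\mapsto\int\mathbf{P}_\delta\{B\}\,\mathrm{d}\mathbf{\Pi}(\delta)$; $\mathbf{\Pi}^{g,\delta}\mathbf{P}_{g,\delta}$ denotes $B\mapsto\int\mathbf{P}_{g,\delta}\{B\}\,\mathrm{d}\mathbf{\Pi}(g,\delta)$. $\mathrm{KL}(\mathbf{Q},\mathbf{P})=\mathbf{E}^{\mathbf{Q}}[\ln(\mathrm{d}\mathbf{Q}/\mathrm{d}\mathbf{P})]$. Relatively left invariant with multiplier $\chi$: $\mu\{gB\}=\chi(g)\mu\{B\}$ for measurable $B\subseteq\mathcal{X}^n$, $g\in G$. Single common support: the densities are positive on one and the same set. Free action: $gx=x$ for some $x$ implies $g$ is the identity. Proper action: $(g,x)\mapsto(gx,x)$ has compact preimages of compact sets. Amenability: there is a sequence $\mathbf{\Pi}_1,\mathbf{\Pi}_2,\dots$ of probability distributions on $G$ such that $\lim_{k\to\infty}|\mathbf{\Pi}_k\{B\}-\mathbf{\Pi}_k\{Bg\}|=0$ for every measurable $B\subseteq G$ and $g\in G$. *)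

theory Defs
  imports "HOL-Probability.Probability"
begin

text \<open>
  Topological groups are types of class \<^class>\<open>topological_group_add\<close>. The group operation is
  therefore written \<open>+\<close>, with unit \<open>0\<close>, but it is not assumed to be commutative: the product
  \<open>g h\<close> of the usual multiplicative notation is \<open>g + h\<close>.
\<close>

definition left_action :: "('g::group_add \<Rightarrow> 'a \<Rightarrow> 'a) \<Rightarrow> bool" where
  "left_action act \<longleftrightarrow>
     (\<forall>x. act 0 x = x) \<and> (\<forall>g h x. act (g + h) x = act g (act h x))"

definition free_action :: "('g::group_add \<Rightarrow> 'a \<Rightarrow> 'a) \<Rightarrow> bool" where
  "free_action act \<longleftrightarrow> (\<forall>g x. act g x = x \<longrightarrow> g = 0)"

definition continuous_action ::
    "('g::topological_space \<Rightarrow> 'a::topological_space \<Rightarrow> 'a) \<Rightarrow> bool" where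
  "continuous_action act \<longleftrightarrow> continuous_on UNIV (\<lambda>(g, x). act g x)"

definition proper_action ::
    "('g::topological_space \<Rightarrow> 'a::topological_space \<Rightarrow> 'a) \<Rightarrow> bool" where
  "proper_action act \<longleftrightarrow>
     (\<forall>K. compact K \<longrightarrow> compact ((\<lambda>(g, x). (act g x, x)) -` K))"

text \<open>
  Points of the \<open>n\<close>-fold product of the observation space are functions from a finite index type
  \<open>'n\<close>; the class instances of the function type provide the product topology and, over a
  \<^class>\<open>polish_space\<close>, the fact that the product is again Polish.
\<close>

definition componentwise :: "('g \<Rightarrow> 'x \<Rightarrow> 'x) \<Rightarrow> 'g \<Rightarrow> ('n \<Rightarrow> 'x) \<Rightarrow> ('n \<Rightarrow> 'x)" where
  "componentwise act g x = (\<lambda>i. act g (x i))"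

definition maximal_invariant :: "('g \<Rightarrow> 'a \<Rightarrow> 'a) \<Rightarrow> ('a \<Rightarrow> 'b) \<Rightarrow> bool" where
  "maximal_invariant act m \<longleftrightarrow> (\<forall>x x'. m x = m x' \<longleftrightarrow> (\<exists>g. x = act g x'))"

definition invariant_family ::
    "('g::group_add \<Rightarrow> 'a::topological_space \<Rightarrow> 'a) \<Rightarrow> ('g \<Rightarrow> 'a measure) \<Rightarrow> bool" where
  "invariant_family act P \<longleftrightarrow>
     (\<forall>g h. \<forall>B \<in> sets borel. measure (P (h + g)) (act h ` B) = measure (P g) B)"

definition relatively_left_invariant ::
    "('g \<Rightarrow> 'a::topological_space \<Rightarrow> 'a) \<Rightarrow> ('g \<Rightarrow> real) \<Rightarrow> 'a measure \<Rightarrow> bool" where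
  "relatively_left_invariant act c \<mu> \<longleftrightarrow>
     (\<forall>g. 0 < c g) \<and>
     (\<forall>g. \<forall>B \<in> sets borel. emeasure \<mu> (act g ` B) = ennreal (c g) * emeasure \<mu> B)"

abbreviation prob_on :: "'a measure \<Rightarrow> 'a measure set" where
  "prob_on M \<equiv> space (prob_algebra M)"

definition amenable :: "'g::topological_group_add itself \<Rightarrow> bool" where
  "amenable _ \<longleftrightarrow>
     (\<exists>R :: nat \<Rightarrow> 'g measure. (\<forall>k. R k \<in> prob_on borel) \<and>
        (\<forall>B \<in> sets borel. \<forall>g.
           (\<lambda>k. \<bar>measure (R k) B - measure (R k) ((\<lambda>b. b + g) ` B)\<bar>) \<longlonglongrightarrow> 0))"

text \<open>
  Kullback-Leibler divergence of probability measures, with values in the extended reals. The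
  library's \<^const>\<open>KL_divergence\<close> is real-valued and takes its arguments in the opposite order.
  The divergence is infinite if \<open>Q\<close> is not absolutely continuous with respect to \<open>P\<close>. If it is,
  then the negative part of \<open>ln (dQ/dP)\<close> is always \<open>Q\<close>-integrable, so that failure of
  integrability means that the expectation is \<open>+\<infinity>\<close>.
\<close>

definition KL :: "'a measure \<Rightarrow> 'a measure \<Rightarrow> ereal" where
  "KL Q P =
     (if absolutely_continuous P Q \<and> integrable Q (entropy_density (exp 1) P Q)
      then ereal (KL_divergence (exp 1) P Q) else \<infinity>)"

text \<open>
  The law of an invariant statistic is the same under all members of an invariant family, so that
  it may be computed at the unit element.
\<close>

lemma distr_invariant_statistic:
  assumes act: "left_action act" and inv: "invariant_family act P"
    and P: "\<And>g. P g \<in> prob_on borel"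
    and m: "m \<in> borel_measurable borel" "maximal_invariant act m"
  shows "distr (P g) borel m = distr (P 0) borel m"
proof (rule measure_eqI)
  fix A assume "A \<in> sets (distr (P g) borel m)"
  then have A: "A \<in> sets borel" by simp
  have sets: "sets (P h) = sets borel" and prob: "prob_space (P h)" for h
    using P[of h] by (auto simp: space_prob_algebra)
  have mP: "m \<in> borel_measurable (P h)" for h
    using m(1) measurable_cong_sets[OF sets refl] by blast
  have B: "m -` A \<in> sets borel" using measurable_sets[OF m(1) A] by simp
  have mact: "m (act h x) = m x" for h x
    using m(2) unfolding maximal_invariant_def by blast
  have "x \<in> act g ` (m -` A)" if "m x \<in> A" for x
  proof
    have "act (g + - g) x = act g (act (- g) x)" "act 0 x = x"
      using act unfolding left_action_def by blast+
    then show "x = act g (act (- g) x)" by simp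
    show "act (- g) x \<in> m -` A" using that by (simp add: mact)
  qed
  then have im: "act g ` (m -` A) = m -` A" by (auto simp: mact)
  have "measure (P (g + 0)) (act g ` (m -` A)) = measure (P 0) (m -` A)"
    using inv B unfolding invariant_family_def by blast
  then have "measure (P g) (m -` A) = measure (P 0) (m -` A)" by (simp add: im)
  then have "emeasure (P g) (m -` A) = emeasure (P 0) (m -` A)"
    using prob by (simp add: finite_measure.emeasure_eq_measure prob_space_def)
  moreover have "space (P h) = UNIV" for h
    using sets_eq_imp_space_eq[OF sets] by simp
  ultimately show "emeasure (distr (P g) borel m) A = emeasure (distr (P 0) borel m) A"
    using A mP by (simp add: emeasure_distr)
qed simp

end

theory Submission
  imports Defs
begin

text \<open>
  One inequality is data processing. The law of the maximal invariant \<open>m\<close> under a mixture over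
  \<open>(g, \<delta>)\<close> depends on the mixing measure only through its marginal for \<open>\<delta>\<close>
  (\<open>distr_bind_invariant_kernel\<close>), and the divergence does not increase when both measures are
  transported by \<open>m\<close> (\<open>KL_pushforward_le\<close>).

  For the other inequality, let \<open>P\<close> and \<open>Q\<close> be the mixtures over \<open>\<delta>\<close> with the minimising pair, at the
  unit element of the group, and mix their translates with a common probability measure \<open>S\<close> on the
  group. The claim is that the divergence of these mixtures comes arbitrarily close to the
  divergence of the laws of \<open>m\<close>. After the laws of \<open>m\<close> have been made equal by an invariant
  reweighting of \<open>P\<close> (\<open>amenable_mixture_KL_le\<close>), it has to be shown that the divergence of the
  mixtures can be made arbitrarily small.

  Amenability enters through averages of a bounded function over orbits, with respect to the measures
  \<open>R k\<close> that amenability provides: these averages become invariant in the limit, and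
  an invariant function has the same integral under two measures that give \<open>m\<close> the same law
  (\<open>integral_invariant_function_eq\<close>). Since the averages need not converge, one passes to convex
  combinations that converge almost everywhere (\<open>orbit_averages_merge\<close>). Thus no bounded function
  separates the mixtures of the two measures, and by a separation theorem for \<open>L\<^sup>1\<close>
  (\<open>L1_separation\<close>) some mixtures are close in total variation
  (\<open>translates_merge_in_total_variation\<close>). Closeness in total variation implies closeness in
  divergence here, because the integrability of the log-density of the unmixed measures is inherited
  uniformly by all mixtures (\<open>log_density_pushforward\<close>, \<open>translates_merge_in_KL\<close>).
\<close>

section \<open>Densities and Kullback-Leibler divergence\<close>

lemma KL_density_eq:
  fixes s :: "'a \<Rightarrow> real"
  assumes P: "prob_space P" and s[measurable]: "s \<in> borel_measurable P" and s0: "\<And>x. 0 \<le> s x"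
  shows "KL (density P s) P
    = (if integrable (density P s) (\<lambda>x. ln (s x)) then ereal (\<integral>x. ln (s x) \<partial>density P s) else \<infinity>)"
proof -
  interpret P: prob_space P by fact
  have ac: "absolutely_continuous P (density P s)"
    by (rule absolutely_continuousI_density) simp
  have "AE x in P. ennreal (s x) = RN_deriv P (density P s) x"
    by (rule P.RN_deriv_unique) auto
  then have "AE x in P. entropy_density (exp 1) P (density P s) x = ln (s x)"
  proof eventually_elim
    case (elim x)
    then show ?case
      using s0 by (simp add: entropy_density_def log_def flip: elim)
  qed
  then have *: "AE x in density P s. entropy_density (exp 1) P (density P s) x = ln (s x)"
    by (subst AE_density) (auto elim: eventually_mono)
  have [measurable]: "entropy_density (exp 1) P (density P s) \<in> borel_measurable P"
    by (rule measurable_entropy_density)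
  have "integrable (density P s) (entropy_density (exp 1) P (density P s))
      \<longleftrightarrow> integrable (density P s) (\<lambda>x. ln (s x))"
    by (rule integrable_cong_AE) (use * in auto)
  moreover have "integral\<^sup>L (density P s) (entropy_density (exp 1) P (density P s))
      = (\<integral>x. ln (s x) \<partial>density P s)"
    by (rule integral_cong_AE) (use * in auto)
  ultimately show ?thesis
    using ac by (simp add: KL_def KL_divergence_def)
qed

lemma absolutely_continuous_real_density:
  assumes P: "prob_space P" and Q: "prob_space Q"
    and ac: "absolutely_continuous P Q" "sets Q = sets P"
  obtains s :: "'a \<Rightarrow> real" where "s \<in> borel_measurable P" "\<And>x. 0 \<le> s x" "Q = density P s"
proof -
  interpret P: prob_space P by fact
  interpret Q: prob_space Q by fact
  obtain s :: "'a \<Rightarrow> real"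
    where s: "s \<in> borel_measurable P" "AE x in P. RN_deriv P Q x = ennreal (s x)" "\<And>x. 0 \<le> s x"
    using P.real_RN_deriv[OF Q.finite_measure_axioms ac] by metis
  have "Q = density P (RN_deriv P Q)"
    using P.density_RN_deriv[OF ac] by simp
  also have "\<dots> = density P s"
    using s by (intro density_cong) auto
  finally show thesis
    using s that by blast
qed

text \<open>
  A localised data processing inequality: on any event that depends on \<open>T\<close> only, the expected
  log-density of the image measures is at most that of the original ones. The reason is the
  inequality \<open>ln y \<le> y - 1\<close> at the quotient \<open>s (T x) / r x\<close>, whose integral over the event is
  at most the probability of the event. Taking the whole space gives monotonicity of
  the divergence; events on which \<open>s\<close> is large will give uniform integrability of the
  log-densities of mixtures.
\<close>

lemma log_density_pushforward:
  fixes r :: "'a \<Rightarrow> real" and s :: "'b \<Rightarrow> real"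
  assumes N: "prob_space N" and Q: "prob_space (density N r)"
    and r[measurable]: "r \<in> borel_measurable N" and r0: "\<And>x. 0 \<le> r x"
    and T[measurable]: "T \<in> N \<rightarrow>\<^sub>M M"
    and s[measurable]: "s \<in> borel_measurable M" and s0: "\<And>y. 0 \<le> s y"
    and dens: "distr (density N r) M T = density (distr N M T) s"
    and int: "integrable (density N r) (\<lambda>x. ln (r x))"
  shows "integrable (density N r) (\<lambda>x. ln (s (T x)))"
    and "A \<in> sets M \<Longrightarrow> (\<integral>x. ln (s (T x)) * indicator A (T x) \<partial>density N r)
           \<le> (\<integral>x. ln (r x) * indicator A (T x) \<partial>density N r)"
proof -
  let ?Q = "density N r"
  interpret N: prob_space N by fact
  interpret Q: prob_space ?Q by fact
  have rpos: "AE x in ?Q. 0 < r x"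
    using r0 by (auto simp: AE_density less_le)
  have "AE y in distr ?Q M T. 0 < s y"
    unfolding dens using s0 by (auto simp: AE_density less_le)
  then have spos: "AE x in ?Q. 0 < s (T x)"
    by (subst (asm) AE_distr_iff) auto
  have push: "(\<integral>\<^sup>+x. f (T x) \<partial>?Q) = (\<integral>\<^sup>+x. s (T x) * f (T x) \<partial>N)"
    if [measurable]: "f \<in> borel_measurable M" for f :: "'b \<Rightarrow> ennreal"
  proof -
    have "(\<integral>\<^sup>+x. f (T x) \<partial>?Q) = (\<integral>\<^sup>+y. f y \<partial>distr ?Q M T)"
      by (subst nn_integral_distr) auto
    also have "\<dots> = (\<integral>\<^sup>+y. s y * f y \<partial>distr N M T)"
      unfolding dens by (subst nn_integral_density) auto
    finally show ?thesis
      by (simp add: nn_integral_distr)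
  qed
  define h where "h = (\<lambda>x. s (T x) / r x)"
  have [measurable]: "h \<in> borel_measurable N"
    unfolding h_def by measurable
  have h0: "0 \<le> h x" for x
    using r0 s0 by (simp add: h_def)
  have h_le: "(\<integral>\<^sup>+x. ennreal (h x * indicator A (T x)) \<partial>?Q) \<le> emeasure ?Q (T -` A \<inter> space N)"
    if [measurable]: "A \<in> sets M" for A
  proof -
    have "(\<integral>\<^sup>+x. ennreal (h x * indicator A (T x)) \<partial>?Q)
        = (\<integral>\<^sup>+x. ennreal (r x) * ennreal (h x * indicator A (T x)) \<partial>N)"
      by (subst nn_integral_density) auto
    also have "\<dots> \<le> (\<integral>\<^sup>+x. ennreal (s (T x)) * indicator A (T x) \<partial>N)"
      using r0 s0 h0
      by (intro nn_integral_mono)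
         (auto simp: h_def indicator_def simp flip: ennreal_mult intro!: ennreal_leI)
    also have "\<dots> = (\<integral>\<^sup>+x. indicator A (T x) \<partial>?Q)"
      by (rule push[symmetric]) auto
    also have "\<dots> = (\<integral>\<^sup>+x. indicator (T -` A \<inter> space N) x \<partial>?Q)"
      by (intro nn_integral_cong) (auto simp: indicator_def)
    finally show ?thesis
      by simp
  qed
  have int_h: "integrable ?Q h"
  proof (rule integrableI_nonneg)
    have "(\<integral>\<^sup>+x. ennreal (h x) \<partial>?Q) = (\<integral>\<^sup>+x. ennreal (h x * indicator (space M) (T x)) \<partial>?Q)"
      using measurable_space[OF T] by (intro nn_integral_cong) auto
    also have "\<dots> \<le> emeasure ?Q (T -` space M \<inter> space N)"
      by (rule h_le) simp
    also have "\<dots> < \<infinity>"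
      using Q.emeasure_finite by (simp add: less_top[symmetric])
    finally show "(\<integral>\<^sup>+x. ennreal (h x) \<partial>?Q) < \<infinity>" .
  qed (use h0 in auto)
  have int_inv: "integrable ?Q (\<lambda>x. 1 / s (T x))"
  proof (rule integrableI_nonneg)
    have "(\<integral>\<^sup>+x. ennreal (1 / s (T x)) \<partial>?Q) = (\<integral>\<^sup>+x. ennreal (s (T x)) * ennreal (1 / s (T x)) \<partial>N)"
      by (rule push) auto
    also have "\<dots> \<le> (\<integral>\<^sup>+x. 1 \<partial>N)"
      using s0 by (intro nn_integral_mono) (auto simp flip: ennreal_mult)
    finally show "(\<integral>\<^sup>+x. ennreal (1 / s (T x)) \<partial>?Q) < \<infinity>"
      by (simp add: N.emeasure_space_1 order_le_less_trans)
  qed (use s0 in auto)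
  have upper: "AE x in ?Q. ln (s (T x)) \<le> ln (r x) + h x - 1"
    using rpos spos
  proof eventually_elim
    case (elim x)
    then have "ln (s (T x)) = ln (r x) + ln (h x)"
      by (simp add: h_def ln_div)
    then show ?case
      using elim ln_le_minus_one[of "h x"] by (simp add: h_def)
  qed
  have lower: "AE x in ?Q. - ln (s (T x)) \<le> 1 / s (T x)"
    using spos
  proof eventually_elim
    case (elim x)
    then show ?case
      using ln_le_minus_one[of "1 / s (T x)"] by (simp add: ln_div)
  qed
  show int_s: "integrable ?Q (\<lambda>x. ln (s (T x)))"
  proof (rule Bochner_Integration.integrable_bound)
    show "integrable ?Q (\<lambda>x. \<bar>ln (r x)\<bar> + h x + 1 / s (T x))"
      using int int_h int_inv by auto
    show "AE x in ?Q. norm (ln (s (T x))) \<le> norm (\<bar>ln (r x)\<bar> + h x + 1 / s (T x))"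
      using upper lower
    proof eventually_elim
      case (elim x)
      moreover have "0 \<le> 1 / s (T x)" using s0 by simp
      ultimately show ?case using h0[of x] unfolding real_norm_def by linarith
    qed
  qed simp
  assume A[measurable]: "A \<in> sets M"
  have iA: "integrable ?Q (\<lambda>x. f x * indicator A (T x))" if "integrable ?Q f" for f :: "'a \<Rightarrow> real"
  proof (rule Bochner_Integration.integrable_bound[OF that])
    show "(\<lambda>x. f x * indicator A (T x)) \<in> borel_measurable ?Q"
      using borel_measurable_integrable[OF that] by measurable
  qed (auto simp: indicator_def)
  have "(\<integral>x. ln (s (T x)) * indicator A (T x) \<partial>?Q)
      \<le> (\<integral>x. ln (r x) * indicator A (T x) + (h x * indicator A (T x) - 1 * indicator A (T x)) \<partial>?Q)"
    using upper by (intro integral_mono_AE iA int_s Bochner_Integration.integrable_add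
        Bochner_Integration.integrable_diff int int_h) (auto simp: indicator_def)
  also have "\<dots> = (\<integral>x. ln (r x) * indicator A (T x) \<partial>?Q)
      + ((\<integral>x. h x * indicator A (T x) \<partial>?Q) - (\<integral>x. 1 * indicator A (T x) \<partial>?Q))"
    using iA[OF int] iA[OF int_h] iA[of "\<lambda>_. 1"] by simp
  also have "(\<integral>x. h x * indicator A (T x) \<partial>?Q) \<le> (\<integral>x. 1 * indicator A (T x) \<partial>?Q)"
  proof -
    have "ennreal (\<integral>x. h x * indicator A (T x) \<partial>?Q) = (\<integral>\<^sup>+x. ennreal (h x * indicator A (T x)) \<partial>?Q)"
      using h0 by (intro nn_integral_eq_integral[symmetric] iA int_h) auto
    also have "\<dots> \<le> emeasure ?Q (T -` A \<inter> space N)"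
      by (rule h_le) fact
    also have "\<dots> = ennreal (\<integral>x. (indicator (T -` A \<inter> space N) x :: real) \<partial>?Q)"
      by (simp add: Q.emeasure_eq_measure)
    also have "(\<integral>x. (indicator (T -` A \<inter> space N) x :: real) \<partial>?Q) = (\<integral>x. 1 * indicator A (T x) \<partial>?Q)"
      by (intro Bochner_Integration.integral_cong) (auto simp: indicator_def)
    finally show ?thesis
      by (simp add: ennreal_le_iff)
  qed
  finally show "(\<integral>x. ln (s (T x)) * indicator A (T x) \<partial>?Q)
           \<le> (\<integral>x. ln (r x) * indicator A (T x) \<partial>?Q)"
    by simp
qed

lemma absolutely_continuous_distr:
  assumes ac: "absolutely_continuous P Q" and sets: "sets Q = sets P" and T: "T \<in> P \<rightarrow>\<^sub>M M"
  shows "absolutely_continuous (distr P M T) (distr Q M T)"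
proof -
  have TQ: "T \<in> Q \<rightarrow>\<^sub>M M" using T measurable_cong_sets[OF sets refl] by blast
  have sp: "space Q = space P" using sets by (rule sets_eq_imp_space_eq)
  show ?thesis
    unfolding absolutely_continuous_def
  proof
    fix A assume "A \<in> null_sets (distr P M T)"
    then have "A \<in> sets M" "T -` A \<inter> space P \<in> null_sets P"
      using null_sets_distr_iff[OF T] by auto
    then show "A \<in> null_sets (distr Q M T)"
      using ac sp null_sets_distr_iff[OF TQ] by (auto simp: absolutely_continuous_def)
  qed
qed

lemma KL_pushforward_le:
  assumes P: "prob_space P" and Q: "prob_space Q" and sets: "sets Q = sets P" and T: "T \<in> P \<rightarrow>\<^sub>M M"
  shows "KL (distr Q M T) (distr P M T) \<le> KL Q P"
proof (cases "KL Q P = \<infinity>")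
  case False
  then have ac: "absolutely_continuous P Q"
    by (auto simp: KL_def split: if_splits)
  obtain r :: "'a \<Rightarrow> real"
    where r[measurable]: "r \<in> borel_measurable P" and r0: "\<And>x. 0 \<le> r x" and Qr: "Q = density P r"
    using absolutely_continuous_real_density[OF P Q ac sets] by blast
  have TQ: "T \<in> Q \<rightarrow>\<^sub>M M" using T measurable_cong_sets[OF sets refl] by blast
  obtain s :: "'b \<Rightarrow> real"
    where s: "s \<in> borel_measurable (distr P M T)" and s0: "\<And>x. 0 \<le> s x"
      and Qs: "distr Q M T = density (distr P M T) s"
    using absolutely_continuous_real_density[OF prob_space.prob_space_distr[OF P T]
        prob_space.prob_space_distr[OF Q TQ] absolutely_continuous_distr[OF ac sets T]] by auto
  have sM[measurable]: "s \<in> borel_measurable M" using s by simp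
  have fin: "integrable (density P r) (\<lambda>x. ln (r x))" and KL: "KL Q P = ereal (\<integral>x. ln (r x) \<partial>density P r)"
    using KL_density_eq[OF P r r0] False unfolding Qr by (auto split: if_splits)
  note dp = log_density_pushforward[OF P Q[unfolded Qr] r r0 T sM s0 Qs[unfolded Qr] fin]
  have eq: "(\<integral>x. f x * indicator (space M) (T x) \<partial>density P r) = integral\<^sup>L (density P r) f"
    for f :: "'a \<Rightarrow> real"
    using measurable_space[OF T] by (intro Bochner_Integration.integral_cong) auto
  have "(\<integral>x. ln (s (T x)) \<partial>density P r) \<le> (\<integral>x. ln (r x) \<partial>density P r)"
    using dp(2)[of "space M"] by (simp add: eq)
  moreover have "integrable (distr Q M T) (\<lambda>y. ln (s y))"
    using dp(1) TQ by (subst integrable_distr_eq) (auto simp: Qr)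
  moreover have "(\<integral>y. ln (s y) \<partial>distr Q M T) = (\<integral>x. ln (s (T x)) \<partial>density P r)"
    using TQ by (subst integral_distr) (auto simp: Qr)
  ultimately show ?thesis
    using KL_density_eq[OF prob_space.prob_space_distr[OF P T] s s0] unfolding KL Qs by simp
qed simp

section \<open>Minimising sequences in convex sets of square-integrable functions\<close>

text \<open>
  The convex hull, as a closure under binary mixtures, so that every property that passes to
  mixtures extends to it by induction.
\<close>

inductive_set convex_mixtures :: "('a \<Rightarrow> real) set \<Rightarrow> ('a \<Rightarrow> real) set" for V where
  base: "v \<in> V \<Longrightarrow> v \<in> convex_mixtures V"
| mix: "\<lbrakk>f \<in> convex_mixtures V; g \<in> convex_mixtures V; 0 \<le> t; t \<le> 1\<rbrakk>
    \<Longrightarrow> (\<lambda>x. (1 - t) * f x + t * g x) \<in> convex_mixtures V"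

lemma convex_mixtures_mono: "V \<subseteq> V' \<Longrightarrow> convex_mixtures V \<subseteq> convex_mixtures V'"
proof
  fix f assume "V \<subseteq> V'" and "f \<in> convex_mixtures V"
  from this(2) show "f \<in> convex_mixtures V'"
    by induct (use \<open>V \<subseteq> V'\<close> in \<open>auto intro: convex_mixtures.intros\<close>)
qed

definition square_integrable :: "'a measure \<Rightarrow> ('a \<Rightarrow> real) \<Rightarrow> bool" where
  "square_integrable M f \<longleftrightarrow> f \<in> borel_measurable M \<and> integrable M (\<lambda>x. (f x)\<^sup>2)"

lemma square_integrable_measurable[measurable_dest]:
  "square_integrable M f \<Longrightarrow> f \<in> borel_measurable M"
  by (simp add: square_integrable_def)

lemma square_integrable_mult:
  assumes "square_integrable M f" "square_integrable M g"
  shows "integrable M (\<lambda>x. f x * g x)"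
proof (rule Bochner_Integration.integrable_bound)
  show "integrable M (\<lambda>x. (f x)\<^sup>2 + (g x)\<^sup>2)"
    using assms by (auto simp: square_integrable_def)
  have "\<bar>a * b\<bar> \<le> a\<^sup>2 + b\<^sup>2" for a b :: real
    using sum_squares_bound[of "\<bar>a\<bar>" "\<bar>b\<bar>"] mult_nonneg_nonneg[of "\<bar>a\<bar>" "\<bar>b\<bar>"]
    unfolding abs_mult power2_abs by linarith
  then show "AE x in M. norm (f x * g x) \<le> norm ((f x)\<^sup>2 + (g x)\<^sup>2)"
    by simp
qed (use assms in \<open>auto simp: square_integrable_def\<close>)

lemma square_integrable_combination:
  assumes "square_integrable M f" "square_integrable M g"
  shows "square_integrable M (\<lambda>x. a * f x + b * g x)"
proof -
  have "integrable M (\<lambda>x. a\<^sup>2 * (f x)\<^sup>2 + 2 * a * b * (f x * g x) + b\<^sup>2 * (g x)\<^sup>2)"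
    using assms square_integrable_mult[OF assms] by (auto simp: square_integrable_def)
  then have "integrable M (\<lambda>x. (a * f x + b * g x)\<^sup>2)"
    by (rule Bochner_Integration.integrable_cong[THEN iffD1, rotated -1])
       (auto simp: power2_eq_square algebra_simps)
  then show ?thesis
    using assms by (auto simp: square_integrable_def)
qed

lemma square_integrable_add:
  "square_integrable M f \<Longrightarrow> square_integrable M g \<Longrightarrow> square_integrable M (\<lambda>x. f x + g x)"
  using square_integrable_combination[of M f g 1 1] by simp

lemma square_integrable_diff:
  "square_integrable M f \<Longrightarrow> square_integrable M g \<Longrightarrow> square_integrable M (\<lambda>x. f x - g x)"
  using square_integrable_combination[of M f g 1 "-1"] by simp

lemma integral_square_combination:
  assumes "square_integrable M f" "square_integrable M g"
  shows "(\<integral>x. (a * f x + b * g x)\<^sup>2 \<partial>M)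
    = a\<^sup>2 * (\<integral>x. (f x)\<^sup>2 \<partial>M) + 2 * a * b * (\<integral>x. f x * g x \<partial>M) + b\<^sup>2 * (\<integral>x. (g x)\<^sup>2 \<partial>M)"
proof -
  have "(\<integral>x. (a * f x + b * g x)\<^sup>2 \<partial>M)
      = (\<integral>x. a\<^sup>2 * (f x)\<^sup>2 + 2 * a * b * (f x * g x) + b\<^sup>2 * (g x)\<^sup>2 \<partial>M)"
    by (intro Bochner_Integration.integral_cong) (auto simp: power2_eq_square algebra_simps)
  also have "\<dots> = a\<^sup>2 * (\<integral>x. (f x)\<^sup>2 \<partial>M) + 2 * a * b * (\<integral>x. f x * g x \<partial>M) + b\<^sup>2 * (\<integral>x. (g x)\<^sup>2 \<partial>M)"
    using assms square_integrable_mult[OF assms]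
    by (simp add: square_integrable_def)
  finally show ?thesis .
qed

text \<open>
  The Cauchy-Schwarz inequality in the form with a free parameter, which avoids square roots.
\<close>

lemma abs_integral_mult_le:
  assumes "square_integrable M f" "square_integrable M g" "0 < e"
  shows "\<bar>\<integral>x. f x * g x \<partial>M\<bar> \<le> (\<integral>x. (f x)\<^sup>2 \<partial>M) / e + e * (\<integral>x. (g x)\<^sup>2 \<partial>M)"
proof -
  have le: "\<bar>a * b\<bar> \<le> a\<^sup>2 / e + e * b\<^sup>2" for a b :: real
  proof -
    have "0 \<le> (\<bar>a\<bar> - e * \<bar>b\<bar>)\<^sup>2 + \<bar>a\<bar> * (e * \<bar>b\<bar>)"
      using assms(3) by (intro add_nonneg_nonneg) auto
    then have "e * \<bar>a * b\<bar> \<le> a\<^sup>2 + e\<^sup>2 * b\<^sup>2"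
      by (simp add: abs_mult power2_eq_square algebra_simps)
    then show ?thesis
      using assms(3) by (simp add: field_simps power2_eq_square)
  qed
  have "\<bar>\<integral>x. f x * g x \<partial>M\<bar> \<le> (\<integral>x. \<bar>f x * g x\<bar> \<partial>M)"
    by (rule integral_abs_bound)
  also have "\<dots> \<le> (\<integral>x. (f x)\<^sup>2 / e + e * (g x)\<^sup>2 \<partial>M)"
    using assms square_integrable_mult[OF assms(1,2)] le
    by (intro integral_mono) (auto simp: square_integrable_def)
  also have "\<dots> = (\<integral>x. (f x)\<^sup>2 \<partial>M) / e + e * (\<integral>x. (g x)\<^sup>2 \<partial>M)"
    using assms by (simp add: square_integrable_def)
  finally show ?thesis .
qed

lemma (in finite_measure) square_integrable_bounded:
  "f \<in> borel_measurable M \<Longrightarrow> AE x in M. \<bar>f x\<bar> \<le> B \<Longrightarrow> square_integrable M f"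
  unfolding square_integrable_def
  by (intro conjI integrable_const_bound[where B="B\<^sup>2"])
     (auto elim!: eventually_mono simp: abs_le_square_iff abs_square_le_1 power2_abs
       intro: power2_le_imp_le dest: power_mono[where n=2, OF _ abs_ge_zero])

lemma (in finite_measure) square_integrable_integral_abs:
  assumes f: "square_integrable M f" and e: "0 < e"
  shows "integrable M f"
    and "(\<integral>x. \<bar>f x\<bar> \<partial>M) \<le> (\<integral>x. (f x)\<^sup>2 \<partial>M) / e + e * measure M (space M)"
proof -
  have "square_integrable M (\<lambda>_. 1)"
    by (rule square_integrable_bounded[where B=1]) auto
  from square_integrable_mult[OF f this] show int: "integrable M f"
    by simp
  have "square_integrable M (\<lambda>x. \<bar>f x\<bar>)"
    using f by (auto simp: square_integrable_def)
  from abs_integral_mult_le[OF this \<open>square_integrable M (\<lambda>_. 1)\<close> e]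
  show "(\<integral>x. \<bar>f x\<bar> \<partial>M) \<le> (\<integral>x. (f x)\<^sup>2 \<partial>M) / e + e * measure M (space M)"
    by simp
qed

text \<open>
  The projection of zero onto a closed convex set, for a whole decreasing family of sets at once.
  By the parallelogram law near-minimisers of the norm form a Cauchy sequence, provided that the
  minimal norms of the sets \<open>C j\<close>, which increase with \<open>j\<close>, stay bounded. For a constant family the
  limit is the point of the closure that is closest to zero; for the mixtures of the tails of a
  bounded sequence of functions this produces mixtures that converge almost everywhere.
\<close>

lemma (in finite_measure) convex_L2_minimising_sequence:
  fixes C :: "nat \<Rightarrow> ('a \<Rightarrow> real) set"
  assumes dec: "\<And>i j. i \<le> j \<Longrightarrow> C j \<subseteq> C i"
    and convex: "\<And>j f g t. f \<in> C j \<Longrightarrow> g \<in> C j \<Longrightarrow> 0 \<le> t \<Longrightarrow> t \<le> 1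
       \<Longrightarrow> (\<lambda>x. (1 - t) * f x + t * g x) \<in> C j"
    and L2: "\<And>j f. f \<in> C j \<Longrightarrow> square_integrable M f"
    and bounded: "\<And>j. \<exists>f\<in>C j. (\<integral>x. (f x)\<^sup>2 \<partial>M) \<le> K"
  obtains f g where "\<And>j. f j \<in> C j"
    and "\<And>j v. (\<And>i. v \<in> C i) \<Longrightarrow> (\<integral>x. (f j x)\<^sup>2 \<partial>M) \<le> (\<integral>x. (v x)\<^sup>2 \<partial>M) + 1 / Suc j"
    and "square_integrable M g" "AE x in M. (\<lambda>j. f j x) \<longlonglongrightarrow> g x"
    and "(\<lambda>j. \<integral>x. (f j x - g x)\<^sup>2 \<partial>M) \<longlonglongrightarrow> 0"
proof -
  define N where "N f = (\<integral>x. (f x)\<^sup>2 \<partial>M)" for f :: "'a \<Rightarrow> real"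
  have N0: "0 \<le> N f" for f by (simp add: N_def)
  define d where "d j = Inf (N ` C j)" for j
  have bdd: "bdd_below (N ` C j)" for j
    by (rule bdd_belowI[of _ 0]) (use N0 in auto)
  have d_le: "f \<in> C j \<Longrightarrow> d j \<le> N f" for f j
    unfolding d_def by (rule cInf_lower) (use bdd in auto)
  have ne: "C j \<noteq> {}" for j
    using bounded[of j] by auto
  have "\<exists>f. f \<in> C j \<and> N f \<le> d j + 1 / Suc j" for j
  proof -
    have "Inf (N ` C j) < d j + 1 / Suc j"
      by (simp add: d_def)
    from cInf_lessD[OF _ this] show ?thesis
      using ne by (auto intro: less_imp_le)
  qed
  then obtain F where F: "\<And>j. F j \<in> C j" and NF: "\<And>j. N (F j) \<le> d j + 1 / Suc j"
    by metis
  have "d i \<le> d j" if "i \<le> j" for i j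
    unfolding d_def using dec[OF that] ne bdd by (intro cInf_superset_mono) auto
  then have "incseq d" by (simp add: mono_def)
  have "d j \<le> K" for j
    using bounded[of j] d_le[of _ j] unfolding N_def by fastforce
  then obtain L where L: "d \<longlonglongrightarrow> L" and dL: "\<And>j. d j \<le> L"
    using incseq_convergent[OF \<open>incseq d\<close>, of K] by auto
  \<comment> \<open>what the parallelogram law leaves of the squared distance of \<open>F i\<close> to later members\<close>
  define b where "b i = 2 * (L - d i) + 4 * (1 / Suc i)" for i
  have b: "b \<longlonglongrightarrow> 0"
  proof -
    have "b \<longlonglongrightarrow> 2 * (L - L) + 4 * 0"
      unfolding b_def by (intro tendsto_intros L LIMSEQ_Suc[OF lim_1_over_n])
    then show ?thesis by simp
  qed
  have F2: "square_integrable M (F j)" for j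
    using L2 F by blast
  define e where "e i = 1 / real (Suc i)" for i
  have cauchy: "N (\<lambda>x. F i x - F j x) \<le> b i" if "i \<le> j" for i j
  proof -
    have "F j \<in> C i" using dec[OF that] F by auto
    from convex[OF F this, of "1/2"] have "d i \<le> N (\<lambda>x. (1/2) * F i x + (1/2) * F j x)"
      using d_le by auto
    also have "\<dots> = N (F i) / 4 + (\<integral>x. F i x * F j x \<partial>M) / 2 + N (F j) / 4"
      unfolding N_def integral_square_combination[OF F2 F2] by (simp add: power2_eq_square)
    finally have "4 * d i \<le> N (F i) + 2 * (\<integral>x. F i x * F j x \<partial>M) + N (F j)"
      by simp
    moreover have "N (\<lambda>x. F i x - F j x) = N (F i) - 2 * (\<integral>x. F i x * F j x \<partial>M) + N (F j)"
      using integral_square_combination[OF F2 F2, of 1 i "-1" j] by (simp add: N_def)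
    moreover have "N (F i) \<le> d i + e i" "N (F j) \<le> d j + e j" "e j \<le> e i" "b i = 2 * (L - d i) + 4 * e i"
      using NF that by (auto simp: e_def b_def frac_le)
    ultimately show ?thesis
      using dL[of j] by argo
  qed
  have FF2: "square_integrable M (\<lambda>x. F i x - F j x)" for i j
    by (rule square_integrable_diff[OF F2 F2])
  have "\<exists>n. \<forall>i\<ge>n. \<forall>j\<ge>n. (\<integral>x. norm (F i x - F j x) \<partial>M) < e" if e: "0 < e" for e :: real
  proof -
    define \<eta> where "\<eta> = e / (4 * (measure M (space M) + 1))"
    have \<eta>: "0 < \<eta>" using e by (auto simp: \<eta>_def intro!: divide_pos_pos mult_pos_pos add_nonneg_pos)
    have \<eta>': "\<eta> * measure M (space M) \<le> e / 4"
    proof -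
      have "\<eta> * measure M (space M) \<le> \<eta> * (measure M (space M) + 1)" using \<eta> by simp
      also have "\<dots> = e / 4"
      proof -
        have "e / (4 * k) * k = e / 4" if "0 < k" for k :: real using that by simp
        from this[of "measure M (space M) + 1"] show ?thesis unfolding \<eta>_def by (simp only: add_nonneg_pos measure_nonneg zero_less_one)
      qed
      finally show ?thesis .
    qed
    obtain n where n: "\<And>i. n \<le> i \<Longrightarrow> b i < \<eta> * (e / 4)"
      using order_tendstoD(2)[OF b, of "\<eta> * (e / 4)"] \<eta> e by (auto simp: eventually_sequentially)
    have *: "(\<integral>x. \<bar>F i x - F j x\<bar> \<partial>M) < e" if ij: "n \<le> i" "i \<le> j" for i j
    proof -
      have "N (\<lambda>x. F i x - F j x) / \<eta> \<le> b i / \<eta>"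
        using cauchy[OF ij(2)] \<eta> by (simp add: divide_right_mono)
      also have "\<dots> < e / 4"
        using n[OF ij(1)] \<eta> by (simp add: field_simps)
      finally show ?thesis
        using square_integrable_integral_abs(2)[OF FF2[of i j] \<eta>] \<eta>' e unfolding N_def by linarith
    qed
    have "(\<integral>x. norm (F i x - F j x) \<partial>M) < e" if "n \<le> i" "n \<le> j" for i j
    proof (cases "i \<le> j")
      case False
      then show ?thesis using *[of j i] that by (simp add: abs_minus_commute)
    qed (use * that in simp)
    then show ?thesis by blast
  qed
  from cauchy_L1_AE_cauchy_subseq[of M F, OF square_integrable_integral_abs(1)[OF F2 zero_less_one] this]
  obtain r where r: "strict_mono r" and AEc: "AE x in M. Cauchy (\<lambda>i. F (r i) x)"
    by blast
  have rj: "j \<le> r j" for j using seq_suble[OF r] .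
  define g where "g x = lim (\<lambda>i. F (r i) x)" for x
  have [measurable]: "F i \<in> borel_measurable M" for i using F2 by (rule square_integrable_measurable)
  have g[measurable]: "g \<in> borel_measurable M"
    unfolding g_def by measurable
  have AE: "AE x in M. (\<lambda>j. F (r j) x) \<longlonglongrightarrow> g x"
    using AEc by eventually_elim (simp add: g_def Cauchy_convergent convergent_LIMSEQ_iff[symmetric])
  have b0: "0 \<le> b i" for i using dL[of i] by (simp add: b_def)
  have fatou: "(\<integral>\<^sup>+x. ennreal ((F (r i) x - g x)\<^sup>2) \<partial>M) \<le> ennreal (b (r i))" for i
  proof -
    have "(\<integral>\<^sup>+x. ennreal ((F (r i) x - g x)\<^sup>2) \<partial>M)
        = (\<integral>\<^sup>+x. liminf (\<lambda>j. ennreal ((F (r i) x - F (r j) x)\<^sup>2)) \<partial>M)"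
    proof (rule nn_integral_cong_AE, use AE in eventually_elim)
      case (elim x)
      then have "(\<lambda>j. ennreal ((F (r i) x - F (r j) x)\<^sup>2)) \<longlonglongrightarrow> ennreal ((F (r i) x - g x)\<^sup>2)"
        by (intro tendsto_intros)
      then show ?case by (rule lim_imp_Liminf[OF sequentially_bot, symmetric])
    qed
    also have "\<dots> \<le> liminf (\<lambda>j. \<integral>\<^sup>+x. ennreal ((F (r i) x - F (r j) x)\<^sup>2) \<partial>M)"
      by (rule nn_integral_liminf) measurable
    also have "\<dots> \<le> ennreal (b (r i))"
    proof (rule order_trans[OF Liminf_le_Limsup[OF sequentially_bot] Limsup_bounded])
      show "eventually (\<lambda>j. (\<integral>\<^sup>+x. ennreal ((F (r i) x - F (r j) x)\<^sup>2) \<partial>M) \<le> ennreal (b (r i))) sequentially"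
        using eventually_ge_at_top[of i]
      proof eventually_elim
        case (elim j)
        then have "r i \<le> r j" using r by (simp add: strict_mono_less_eq)
        from cauchy[OF this] show ?case
          using FF2[of "r i" "r j"] unfolding N_def square_integrable_def
          by (subst nn_integral_eq_integral) (auto intro: ennreal_leI)
      qed
    qed
    finally show ?thesis .
  qed
  have int: "integrable M (\<lambda>x. (F (r i) x - g x)\<^sup>2)" for i
    by (rule integrableI_nonneg) (use order_le_less_trans[OF fatou] in auto)
  have Nle: "N (\<lambda>x. F (r i) x - g x) \<le> b (r i)" for i
    using fatou[of i] int[of i] b0[of "r i"] unfolding N_def
    by (subst (asm) nn_integral_eq_integral) (auto simp: ennreal_le_iff)
  have g2: "square_integrable M g"
  proof -
    have "square_integrable M (\<lambda>x. F (r 0) x - (F (r 0) x - g x))"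
      by (rule square_integrable_diff[OF F2]) (use int in \<open>auto simp: square_integrable_def\<close>)
    then show ?thesis by simp
  qed
  show thesis
  proof (rule that[of "\<lambda>j. F (r j)" g])
    show "F (r j) \<in> C j" for j
      using F[of "r j"] dec[OF rj[of j]] by auto
    show "(\<integral>x. (F (r j) x)\<^sup>2 \<partial>M) \<le> (\<integral>x. (v x)\<^sup>2 \<partial>M) + 1 / Suc j" if "\<And>i. v \<in> C i" for j v
    proof -
      have "1 / Suc (r j) \<le> 1 / Suc j"
        using rj[of j] by (simp add: frac_le)
      then show ?thesis
        using NF[of "r j"] d_le[OF that[of "r j"]] unfolding N_def by linarith
    qed
    have "(\<lambda>j. b (r j)) \<longlonglongrightarrow> 0"
      using LIMSEQ_subseq_LIMSEQ[OF b r] by (simp add: comp_def)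
    then show "(\<lambda>j. \<integral>x. (F (r j) x - g x)\<^sup>2 \<partial>M) \<longlonglongrightarrow> 0"
      by (rule tendsto_sandwich[OF _ _ tendsto_const, rotated -1])
         (use Nle N0 in \<open>auto simp: N_def\<close>)
  qed (use g2 AE in auto)
qed

section \<open>Separating a convex set from zero in the space of integrable functions\<close>

text \<open>
  A Hahn-Banach separation in which the separating functional is a bounded function. The convex set
  is enlarged by the square-integrable functions of \<open>L\<^sup>1\<close>-norm at most \<open>c / 2\<close>. The enlarged set still
  keeps a positive \<open>L\<^sup>2\<close>-distance from zero, since on a finite measure space the \<open>L\<^sup>2\<close>-norm controls
  the \<open>L\<^sup>1\<close>-norm. The point \<open>g\<close> of its closure nearest to zero separates, and \<open>g\<close> is bounded: a
  functional that is bounded below on an \<open>L\<^sup>1\<close>-ball is given by an essentially bounded function.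
\<close>

lemma (in finite_measure) L2_separation:
  fixes v :: "nat \<Rightarrow> 'a \<Rightarrow> real"
  assumes v: "\<And>k. square_integrable M (v k)" and c: "0 < c"
    and far: "\<And>u. u \<in> convex_mixtures (range v) \<Longrightarrow> c \<le> (\<integral>x. \<bar>u x\<bar> \<partial>M)"
  obtains f B d where "f \<in> borel_measurable M" "\<And>x. \<bar>f x\<bar> \<le> B" "0 < d" "\<And>k. d \<le> (\<integral>x. f x * v k x \<partial>M)"
proof -
  define \<mu> where "\<mu> = measure M (space M)"
  have \<mu>0: "0 \<le> \<mu>" by (simp add: \<mu>_def)
  define C where "C = {(\<lambda>x. u x + b x) |u b. u \<in> convex_mixtures (range v)
      \<and> square_integrable M b \<and> (\<integral>x. \<bar>b x\<bar> \<partial>M) \<le> c / 2}"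
  have hull2: "square_integrable M u" if "u \<in> convex_mixtures (range v)" for u
    using that by induct (auto intro: v square_integrable_combination)
  have C2: "square_integrable M h" if "h \<in> C" for h
    using that hull2 by (auto simp: C_def intro: square_integrable_add)
  have convex: "(\<lambda>x. (1 - t) * f x + t * g x) \<in> C"
    if "f \<in> C" "g \<in> C" and t: "0 \<le> t" "t \<le> 1" for f g t
  proof -
    obtain u b u' b' where u: "u \<in> convex_mixtures (range v)" "u' \<in> convex_mixtures (range v)"
      and b: "square_integrable M b" "(\<integral>x. \<bar>b x\<bar> \<partial>M) \<le> c / 2"
      and b': "square_integrable M b'" "(\<integral>x. \<bar>b' x\<bar> \<partial>M) \<le> c / 2"
      and fg: "f = (\<lambda>x. u x + b x)" "g = (\<lambda>x. u' x + b' x)"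
      using \<open>f \<in> C\<close> \<open>g \<in> C\<close> unfolding C_def by blast
    have int: "integrable M b" "integrable M b'"
      using b b' square_integrable_integral_abs(1) zero_less_one by blast+
    have "(\<integral>x. \<bar>(1 - t) * b x + t * b' x\<bar> \<partial>M) \<le> (\<integral>x. (1 - t) * \<bar>b x\<bar> + t * \<bar>b' x\<bar> \<partial>M)"
      using int t
      by (intro integral_mono) (auto intro!: abs_triangle_ineq[THEN order_trans] simp: abs_mult)
    also have "\<dots> = (1 - t) * (\<integral>x. \<bar>b x\<bar> \<partial>M) + t * (\<integral>x. \<bar>b' x\<bar> \<partial>M)"
      using int by simp
    also have "\<dots> \<le> (1 - t) * (c / 2) + t * (c / 2)"
      using b b' t by (intro add_mono mult_left_mono) auto
    also have "\<dots> = c / 2"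
      by (simp add: field_simps)
    finally have bb: "(\<integral>x. \<bar>(1 - t) * b x + t * b' x\<bar> \<partial>M) \<le> c / 2" .
    have eq: "(\<lambda>x. (1 - t) * f x + t * g x)
        = (\<lambda>x. ((1 - t) * u x + t * u' x) + ((1 - t) * b x + t * b' x))"
      by (simp add: fg algebra_simps)
    show ?thesis
      unfolding eq C_def mem_Collect_eq
      by (intro exI[of _ "\<lambda>x. (1 - t) * u x + t * u' x"] exI[of _ "\<lambda>x. (1 - t) * b x + t * b' x"]
          conjI refl convex_mixtures.mix[OF u t] square_integrable_combination[OF b(1) b'(1)] bb)
  qed
  have zero: "square_integrable M (\<lambda>_. 0)" by (simp add: square_integrable_def)
  have hullC: "u \<in> C" if "u \<in> convex_mixtures (range v)" for u
    unfolding C_def using that zero c by (intro CollectI exI[of _ u] exI[of _ "\<lambda>_. 0"]) auto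
  have vC: "v k \<in> C" for k
    by (rule hullC) (auto intro: convex_mixtures.base)
  \<comment> \<open>the bound for the squared norm that follows from an \<open>L\<^sup>1\<close>-norm of at least \<open>c / 2\<close>\<close>
  define d where "d = c / (4 * (\<mu> + 1)) * (c / 4)"
  have d: "0 < d" using c \<mu>0 by (auto simp: d_def intro!: mult_pos_pos divide_pos_pos)
  have lower: "d \<le> (\<integral>x. (h x)\<^sup>2 \<partial>M)" if "h \<in> C" for h
  proof -
    obtain u b where u: "u \<in> convex_mixtures (range v)"
      and b: "square_integrable M b" "(\<integral>x. \<bar>b x\<bar> \<partial>M) \<le> c / 2" and h: "h = (\<lambda>x. u x + b x)"
      using \<open>h \<in> C\<close> unfolding C_def by blast
    have int: "integrable M u" "integrable M b" "integrable M h"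
      using hull2[OF u] b(1) C2[OF that] square_integrable_integral_abs(1) zero_less_one by blast+
    have "c \<le> (\<integral>x. \<bar>u x\<bar> \<partial>M)" using far u by blast
    also have "\<dots> \<le> (\<integral>x. \<bar>h x\<bar> + \<bar>b x\<bar> \<partial>M)"
      using int by (intro integral_mono) (auto simp: h)
    also have "\<dots> = (\<integral>x. \<bar>h x\<bar> \<partial>M) + (\<integral>x. \<bar>b x\<bar> \<partial>M)"
      using int by simp
    finally have hc: "c / 2 \<le> (\<integral>x. \<bar>h x\<bar> \<partial>M)"
      using b by simp
    define e where "e = c / (4 * (\<mu> + 1))"
    have e: "0 < e" using c \<mu>0 by (auto simp: e_def intro!: divide_pos_pos)
    have "e * \<mu> \<le> e * (\<mu> + 1)" using e by simp
    also have "\<dots> = c / 4"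
    proof -
      have "c / (4 * k) * k = c / 4" if "0 < k" for k :: real using that by simp
      from this[of "\<mu> + 1"] show ?thesis
        using \<mu>0 unfolding e_def by (simp only: add_nonneg_pos zero_less_one)
    qed
    finally have "e * \<mu> \<le> c / 4" .
    then have "c / 4 \<le> (\<integral>x. (h x)\<^sup>2 \<partial>M) / e"
      using square_integrable_integral_abs(2)[OF C2[OF that] e] hc unfolding \<mu>_def by argo
    moreover have "d = e * (c / 4)"
      unfolding d_def e_def by (rule refl)
    ultimately show ?thesis
      using e by (simp add: pos_le_divide_eq mult.commute)
  qed
  obtain F g where FC: "\<And>j. F j \<in> C"
    and Fmin: "\<And>j v. v \<in> C \<Longrightarrow> (\<integral>x. (F j x)\<^sup>2 \<partial>M) \<le> (\<integral>x. (v x)\<^sup>2 \<partial>M) + 1 / Suc j"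
    and g2: "square_integrable M g" and lim: "(\<lambda>j. \<integral>x. (F j x - g x)\<^sup>2 \<partial>M) \<longlonglongrightarrow> 0"
  proof (rule convex_L2_minimising_sequence[of "\<lambda>_. C" "\<integral>x. (v 0 x)\<^sup>2 \<partial>M"])
    show "\<exists>f\<in>C. (\<integral>x. (f x)\<^sup>2 \<partial>M) \<le> (\<integral>x. (v 0 x)\<^sup>2 \<partial>M)"
      using vC by auto
  qed (use convex C2 in auto)
  \<comment> \<open>a point of minimal norm has inner product at least its squared norm with all of \<open>C\<close>\<close>
  have var: "d \<le> (\<integral>x. g x * h x \<partial>M)" if h: "h \<in> C" for h
  proof (rule ccontr)
    define H where "H = (\<integral>x. (h x)\<^sup>2 \<partial>M)"
    have H0: "0 \<le> H" by (simp add: H_def)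
    define gap where "gap = d - (\<integral>x. g x * h x \<partial>M)"
    assume "\<not> d \<le> (\<integral>x. g x * h x \<partial>M)"
    then have gap: "0 < gap" by (simp add: gap_def)
    have h2: "square_integrable M h" using C2[OF h] .
    have F2: "square_integrable M (F j)" for j using C2[OF FC] .
    define t where "t = min 1 (gap / (4 * (2 * H + 2)))"
    have t: "0 < t" "t \<le> 1" "t * (2 * H + 2) \<le> gap / 4"
    proof -
      have "t * (2 * H + 2) \<le> gap / (4 * (2 * H + 2)) * (2 * H + 2)"
        using H0 by (intro mult_right_mono) (auto simp: t_def)
      also have "\<dots> = gap / 4"
      proof -
        have "gap / (4 * k) * k = gap / 4" if "0 < k" for k :: real using that by simp
        from this[of "2 * H + 2"] H0 show ?thesis by (simp only: add_nonneg_pos mult_nonneg_nonneg zero_le_numeral zero_less_numeral)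
      qed
      finally show "t * (2 * H + 2) \<le> gap / 4" .
    qed (use gap H0 in \<open>auto simp: t_def\<close>)
    \<comment> \<open>\<open>F j\<close> is nearly optimal, so a step of length \<open>t\<close> towards \<open>h\<close> hardly decreases the norm\<close>
    have first: "d - t * (2 * H + 2) - 1 / Suc j / (2 * t) \<le> (\<integral>x. F j x * h x \<partial>M)" for j
    proof -
      define A I where "A = (\<integral>x. (F j x)\<^sup>2 \<partial>M)" and "I = (\<integral>x. F j x * h x \<partial>M)"
      define e where "e = 1 / real (Suc j)"
      have e1: "e \<le> 1" by (simp add: e_def)
      have AH: "A \<le> H + e"
        using Fmin[OF h] by (simp add: A_def H_def e_def)
      have dA: "d \<le> A" unfolding A_def by (rule lower[OF FC])
      have "A \<le> (\<integral>x. ((1 - t) * F j x + t * h x)\<^sup>2 \<partial>M) + e"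
        unfolding A_def e_def using t by (intro Fmin convex FC h) auto
      also have "\<dots> = (1 - t)\<^sup>2 * A + 2 * (1 - t) * t * I + t\<^sup>2 * H + e"
        unfolding integral_square_combination[OF F2 h2] by (simp add: A_def I_def H_def)
      also have "\<dots> = A + t * (2 * (I - A) + t * (A - 2 * I + H)) + e"
        by (simp add: power2_eq_square algebra_simps)
      finally have "- e / t \<le> 2 * (I - A) + t * (A - 2 * I + H)"
        using t by (simp add: field_simps)
      moreover have "A - 2 * I + H \<le> 2 * (A + H)"
      proof -
        have "0 \<le> (\<integral>x. (1 * F j x + 1 * h x)\<^sup>2 \<partial>M)" by simp
        also have "\<dots> = A + 2 * I + H"
          unfolding integral_square_combination[OF F2 h2] by (simp add: A_def I_def H_def)
        finally show ?thesis by simp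
      qed
      then have "t * (A - 2 * I + H) \<le> t * (2 * (2 * H + 1))"
        using t AH e1 by (intro mult_left_mono) auto
      ultimately have "- e / t \<le> 2 * (I - A) + t * (2 * (2 * H + 1))"
        by simp
      then have "A - t * (2 * H + 1) - e / t / 2 \<le> I"
        by argo
      moreover have "t * (2 * H + 1) \<le> t * (2 * H + 2)"
        using t by simp
      moreover have "e / t / 2 = 1 / Suc j / (2 * t)"
        by (simp add: e_def)
      ultimately show ?thesis
        using dA unfolding I_def by linarith
    qed
    have "(\<lambda>j. \<integral>x. F j x * h x \<partial>M) \<longlonglongrightarrow> (\<integral>x. g x * h x \<partial>M)"
    proof (rule LIMSEQ_I)
      fix r :: real assume r: "0 < r"
      define e where "e = r / (2 * (H + 1))"
      have e: "0 < e" using r H0 by (auto simp: e_def intro!: divide_pos_pos)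
      have "e * H \<le> e * (H + 1)" using e by simp
      also have "\<dots> = r / 2"
      proof -
        have "r / (2 * k) * k = r / 2" if "0 < k" for k :: real using that by simp
        from this[of "H + 1"] show ?thesis
          using H0 unfolding e_def by (simp only: add_nonneg_pos zero_less_one)
      qed
      finally have eH: "e * H \<le> r / 2" .
      obtain n where n: "\<And>j. n \<le> j \<Longrightarrow> (\<integral>x. (F j x - g x)\<^sup>2 \<partial>M) < e * (r / 2)"
        using order_tendstoD(2)[OF lim, of "e * (r / 2)"] e r by (auto simp: eventually_sequentially)
      have "norm ((\<integral>x. F j x * h x \<partial>M) - (\<integral>x. g x * h x \<partial>M)) < r" if "n \<le> j" for j
      proof -
        have "(\<integral>x. F j x * h x \<partial>M) - (\<integral>x. g x * h x \<partial>M) = (\<integral>x. (F j x - g x) * h x \<partial>M)"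
          using square_integrable_mult[OF F2 h2] square_integrable_mult[OF g2 h2]
          by (simp add: left_diff_distrib)
        also have "\<bar>\<dots>\<bar> \<le> (\<integral>x. (F j x - g x)\<^sup>2 \<partial>M) / e + e * H"
          unfolding H_def by (rule abs_integral_mult_le[OF square_integrable_diff[OF F2 g2] h2 e])
        also have "\<dots> < r / 2 + r / 2"
          using n[OF that] e eH by (intro add_less_le_mono) (auto simp: field_simps)
        finally show ?thesis by simp
      qed
      then show "\<exists>n. \<forall>j\<ge>n. norm ((\<integral>x. F j x * h x \<partial>M) - (\<integral>x. g x * h x \<partial>M)) < r" by blast
    qed
    moreover have "(\<lambda>j. d - t * (2 * H + 2) - 1 / real (Suc j) / (2 * t)) \<longlonglongrightarrow> d - t * (2 * H + 2) - 0 / (2 * t)"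
      by (intro tendsto_intros LIMSEQ_Suc[OF lim_1_over_n]) (use t in auto)
    ultimately have "d - t * (2 * H + 2) - 0 / (2 * t) \<le> (\<integral>x. g x * h x \<partial>M)"
      using first by (intro LIMSEQ_le) auto
    then show False
      using t(3) gap by (simp add: gap_def)
  qed
  have [measurable]: "g \<in> borel_measurable M"
    using g2 by (rule square_integrable_measurable)
  \<comment> \<open>where \<open>\<bar>g\<bar>\<close> exceeds \<open>B\<close>, spending the \<open>L\<^sup>1\<close>-budget \<open>c / 2\<close> against the sign of \<open>g\<close> would
      cancel the whole inner product with \<open>v 0\<close>\<close>
  define B where "B = 2 * (\<integral>x. g x * v 0 x \<partial>M) / c"
  have B: "AE x in M. \<bar>g x\<bar> \<le> B"
  proof (rule ccontr)
    define A where "A = {x \<in> space M. B < \<bar>g x\<bar>}"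
    have A[measurable]: "A \<in> sets M" by (simp add: A_def)
    define a where "a = measure M A"
    assume not: "\<not> (AE x in M. \<bar>g x\<bar> \<le> B)"
    have "emeasure M A \<noteq> 0"
      using not by (subst (asm) AE_iff_measurable[OF A]) (auto simp: A_def not_le)
    then have a: "0 < a"
      using measure_nonneg[of M A] by (auto simp: a_def emeasure_eq_measure less_le)
    define b where "b x = - (c / 2 / a) * (sgn (g x) * indicator A x)" for x
    have [measurable]: "b \<in> borel_measurable M" unfolding b_def by measurable
    have b_abs: "\<bar>b x\<bar> \<le> (c / 2 / a) * indicator A x" for x
      using a c by (auto simp: b_def abs_mult indicator_def sgn_if)
    have b2: "square_integrable M b"
      by (rule square_integrable_bounded[where B="c / 2 / a"])
         (use b_abs a c in \<open>auto intro!: AE_I2 order_trans[OF b_abs] simp: indicator_def\<close>)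
    have iA: "integrable M (\<lambda>x. k * indicator A x)" for k :: real
      by (intro integrable_mult_right integrable_real_indicator) (auto simp: less_top[symmetric])
    have "(\<integral>x. \<bar>b x\<bar> \<partial>M) \<le> (\<integral>x. (c / 2 / a) * indicator A x \<partial>M)"
      by (intro integral_mono iA integrable_abs square_integrable_integral_abs(1)[OF b2 zero_less_one] b_abs)
    also have "\<dots> = c / 2"
      using a by (simp add: a_def)
    finally have "(\<lambda>x. v 0 x + b x) \<in> C"
      unfolding C_def using b2
      by (intro CollectI exI[of _ "v 0"] exI[of _ b]) (auto intro: convex_mixtures.base)
    from var[OF this] have "d \<le> (\<integral>x. g x * (v 0 x + b x) \<partial>M)" .
    also have "\<dots> = (\<integral>x. g x * v 0 x \<partial>M) + (\<integral>x. g x * b x \<partial>M)"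
      using square_integrable_mult[OF g2 v] square_integrable_mult[OF g2 b2] by (simp add: distrib_left)
    also have "(\<integral>x. g x * b x \<partial>M) \<le> (\<integral>x. - (c / 2 / a) * B * indicator A x \<partial>M)"
    proof (rule integral_mono)
      show "g x * b x \<le> - (c / 2 / a) * B * indicator A x" if "x \<in> space M" for x
      proof (cases "x \<in> A")
        case True
        have "g x * b x = - (c / 2 / a) * \<bar>g x\<bar>"
          using True by (simp add: b_def abs_sgn mult_ac)
        also have "\<dots> \<le> - (c / 2 / a) * B"
          using True a c by (intro mult_left_mono_neg) (auto simp: A_def)
        finally show ?thesis using True by simp
      qed (simp add: b_def)
    qed (intro square_integrable_mult[OF g2 b2] iA)+
    also have "\<dots> = - (c / 2) * B"
      using a by (simp add: a_def)
    also have "(\<integral>x. g x * v 0 x \<partial>M) = c / 2 * B"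
      using c by (simp add: B_def)
    finally show False
      using d by simp
  qed
  have B0: "0 \<le> B"
    using var[OF vC[of 0]] d c by (simp add: B_def)
  define f where "f x = (if \<bar>g x\<bar> \<le> B then g x else 0)" for x
  have [measurable]: "f \<in> borel_measurable M" unfolding f_def by measurable
  show thesis
  proof (rule that[of f B d])
    show "\<bar>f x\<bar> \<le> B" for x using B0 by (simp add: f_def)
    show "d \<le> (\<integral>x. f x * v k x \<partial>M)" for k
    proof -
      have [measurable]: "v k \<in> borel_measurable M" using v by (rule square_integrable_measurable)
      have "(\<integral>x. f x * v k x \<partial>M) = (\<integral>x. g x * v k x \<partial>M)"
        using B by (intro integral_cong_AE) (auto simp: f_def)
      then show ?thesis using var[OF vC] by simp
    qed
  qed (use d in auto)
qed

text \<open>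
  Reduction to square-integrable functions by a change of the base measure: under the density
  \<open>W = 1 + (\<Sum>k. \<bar>v k\<bar> / a k)\<close> with suitable constants \<open>a k\<close>, the measure remains finite, each quotient
  \<open>v k / W\<close> is bounded almost everywhere, and the \<open>L\<^sup>1\<close>-norms of mixtures do not change.
\<close>

lemma (in finite_measure) L1_separation:
  fixes v :: "nat \<Rightarrow> 'a \<Rightarrow> real"
  assumes v: "\<And>k. integrable M (v k)" and c: "0 < c"
    and far: "\<And>u. u \<in> convex_mixtures (range v) \<Longrightarrow> c \<le> (\<integral>x. \<bar>u x\<bar> \<partial>M)"
  obtains f B d where "f \<in> borel_measurable M" "\<And>x. \<bar>f x\<bar> \<le> B" "0 < d" "\<And>k. d \<le> (\<integral>x. f x * v k x \<partial>M)"
proof -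
  have [measurable]: "v k \<in> borel_measurable M" for k using v by auto
  \<comment> \<open>makes the \<open>k\<close>-th summand of the density integrate to at most \<open>(1 / 2) ^ k\<close>\<close>
  define a where "a k = 2 ^ k * (1 + (\<integral>x. \<bar>v k x\<bar> \<partial>M))" for k
  have a: "0 < a k" for k by (simp add: a_def add_pos_nonneg)
  define S where "S x = (\<Sum>k. ennreal (\<bar>v k x\<bar> / a k))" for x
  have [measurable]: "S \<in> borel_measurable M" unfolding S_def by measurable
  have S: "(\<integral>\<^sup>+x. S x \<partial>M) \<le> 2"
  proof -
    have "(\<integral>\<^sup>+x. S x \<partial>M) = (\<Sum>k. \<integral>\<^sup>+x. ennreal (\<bar>v k x\<bar> / a k) \<partial>M)"
      unfolding S_def by (rule nn_integral_suminf) measurable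
    also have "\<dots> \<le> (\<Sum>k. ennreal ((1/2) ^ k))"
    proof (rule suminf_le)
      show "(\<integral>\<^sup>+x. ennreal (\<bar>v k x\<bar> / a k) \<partial>M) \<le> ennreal ((1/2) ^ k)" for k
      proof -
        have "(\<integral>\<^sup>+x. ennreal (\<bar>v k x\<bar> / a k) \<partial>M) = ennreal (\<integral>x. \<bar>v k x\<bar> / a k \<partial>M)"
          using v a less_imp_le[OF a] by (intro nn_integral_eq_integral) auto
        also have "\<dots> \<le> ennreal ((1/2) ^ k)"
        proof (rule ennreal_leI)
          have "(\<integral>x. \<bar>v k x\<bar> / a k \<partial>M) = (\<integral>x. \<bar>v k x\<bar> \<partial>M) / (1 + (\<integral>x. \<bar>v k x\<bar> \<partial>M)) * (1/2) ^ k"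
            by (simp add: a_def power_one_over)
          also have "\<dots> \<le> 1 * (1/2) ^ k"
            by (intro mult_right_mono) (auto simp: divide_le_eq_1 add_pos_nonneg)
          finally show "(\<integral>x. \<bar>v k x\<bar> / a k \<partial>M) \<le> (1/2) ^ k" by simp
        qed
        finally show ?thesis .
      qed
    qed auto
    also have "\<dots> = ennreal (\<Sum>k. (1/2) ^ k)"
      by (rule suminf_ennreal2) (auto intro: summable_geometric)
    also have "\<dots> = 2"
      by (simp add: suminf_geometric)
    finally show ?thesis .
  qed
  have Sfin: "AE x in M. S x \<noteq> \<infinity>"
    using S by (intro nn_integral_PInf_AE) (auto simp: top_unique)
  define W where "W x = 1 + enn2real (S x)" for x
  have [measurable]: "W \<in> borel_measurable M" unfolding W_def by measurable
  have W: "1 \<le> W x" for x by (simp add: W_def)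
  have W0: "0 < W x" for x using W[of x] by linarith
  interpret W: finite_measure "density M W"
  proof
    have "emeasure (density M W) (space (density M W)) = (\<integral>\<^sup>+x. ennreal (W x) \<partial>M)"
      by (simp add: emeasure_density cong: nn_integral_cong)
    also have "\<dots> \<le> (\<integral>\<^sup>+x. 1 + S x \<partial>M)"
      unfolding W_def by (intro nn_integral_mono) (simp add: ennreal_plus ennreal_enn2real_if)
    also have "\<dots> = emeasure M (space M) + (\<integral>\<^sup>+x. S x \<partial>M)"
      by (subst nn_integral_add) auto
    also have "\<dots> < \<infinity>"
      using S by (auto simp: less_top[symmetric] top_unique)
    finally show "emeasure (density M W) (space (density M W)) \<noteq> \<infinity>" by simp
  qed
  define u where "u k x = v k x / W x" for k x
  have [measurable]: "u k \<in> borel_measurable M" for k unfolding u_def by measurable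
  have u2: "square_integrable (density M W) (u k)" for k
  proof (rule W.square_integrable_bounded[where B="a k"])
    have "AE x in M. \<bar>u k x\<bar> \<le> a k"
      using Sfin
    proof eventually_elim
      case (elim x)
      have "ennreal (\<bar>v k x\<bar> / a k) \<le> S x"
        unfolding S_def using sum_le_suminf[of "\<lambda>k. ennreal (\<bar>v k x\<bar> / a k)" "{k}"] by simp
      then have "\<bar>v k x\<bar> / a k \<le> enn2real (S x)"
        using elim enn2real_mono[of "ennreal (\<bar>v k x\<bar> / a k)" "S x"] a[of k]
        by (simp add: less_top[symmetric])
      then have "\<bar>v k x\<bar> / a k \<le> W x" by (simp add: W_def)
      then show ?case
        using a[of k] W0[of x] by (simp add: u_def field_simps)
    qed
    then show "AE x in density M W. \<bar>u k x\<bar> \<le> a k"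
      by (subst AE_density) (auto elim: eventually_mono)
  qed simp
  have hull: "(\<lambda>x. W x * h x) \<in> convex_mixtures (range v)" if "h \<in> convex_mixtures (range u)" for h
    using that
  proof induct
    case (base h)
    then obtain k where "h = u k" by auto
    moreover have "(\<lambda>x. W x * u k x) = v k"
      using W0 by (auto simp: u_def less_imp_neq[symmetric])
    ultimately show ?case by (auto intro: convex_mixtures.base)
  next
    case (mix f g t)
    from convex_mixtures.mix[OF mix(2,4,5,6)] show ?case
      by (simp add: algebra_simps)
  qed
  have hull_meas: "h \<in> borel_measurable M" if "h \<in> convex_mixtures (range u)" for h
    using that by induct auto
  obtain f B d where f: "f \<in> borel_measurable (density M W)" "\<And>x. \<bar>f x\<bar> \<le> B" "0 < d"
    and sep: "\<And>k. d \<le> (\<integral>x. f x * u k x \<partial>density M W)"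
  proof (rule W.L2_separation[of u c])
    show "c \<le> (\<integral>x. \<bar>h x\<bar> \<partial>density M W)" if h: "h \<in> convex_mixtures (range u)" for h
    proof -
      have [measurable]: "h \<in> borel_measurable M" using hull_meas h .
      have "(\<integral>x. \<bar>h x\<bar> \<partial>density M W) = (\<integral>x. \<bar>W x * h x\<bar> \<partial>M)"
        using less_imp_le[OF W0] by (subst integral_density) (auto simp: abs_mult)
      then show ?thesis using far[OF hull[OF h]] by simp
    qed
  qed (use u2 c in auto)
  show thesis
  proof (rule that[of f B d])
    have fm[measurable]: "f \<in> borel_measurable M" using f(1) by simp
    show "d \<le> (\<integral>x. f x * v k x \<partial>M)" for k
    proof -
      have "(\<integral>x. f x * u k x \<partial>density M W) = (\<integral>x. W x * (f x * u k x) \<partial>M)"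
        using less_imp_le[OF W0] by (subst integral_density) auto
      also have "\<dots> = (\<integral>x. f x * v k x \<partial>M)"
        using W0 by (intro Bochner_Integration.integral_cong) (auto simp: u_def less_imp_neq[symmetric])
      finally show ?thesis using sep[of k] by simp
    qed
  qed (use f in auto)
qed

section \<open>Invariant functions and amenable averages\<close>

text \<open>
  An invariant Borel set is a union of fibres of \<open>m\<close>, but its image under \<open>m\<close> need not be Borel.
  Up to small probability, however, it is the preimage of a compact set: the law of \<open>(x, m x)\<close> is
  inner regular, and a compact part \<open>K\<close> of the graph of \<open>m\<close> over \<open>A\<close> projects onto a compact set
  whose preimage under \<open>m\<close> lies in \<open>A\<close>.
\<close>

lemma invariant_set_measure_le:
  fixes P Q :: "'a::{second_countable_topology, complete_space} measure"
    and m :: "'a \<Rightarrow> 'm::{second_countable_topology, complete_space}"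
  assumes P: "prob_space P" "sets P = sets borel" and Q: "prob_space Q" "sets Q = sets borel"
    and m: "m \<in> borel_measurable borel" "maximal_invariant act m"
    and eq: "distr P borel m = distr Q borel m"
    and A: "A \<in> sets borel" and inv: "\<And>g x. x \<in> A \<Longrightarrow> act g x \<in> A"
  shows "emeasure P A \<le> emeasure Q A"
proof -
  interpret P: prob_space P by fact
  note [measurable_cong] = P(2) Q(2)
  note [measurable] = m(1) A
  have sP: "space P = UNIV" "space Q = UNIV"
    using sets_eq_imp_space_eq[OF P(2)] sets_eq_imp_space_eq[OF Q(2)] by simp_all
  define J where "J = distr P borel (\<lambda>x. (x, m x))"
  have pair[measurable]: "(\<lambda>x. (x, m x)) \<in> P \<rightarrow>\<^sub>M borel"
    by (rule borel_measurable_Pair) measurable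
  interpret J: prob_space J
    unfolding J_def by (rule P.prob_space_distr) measurable
  \<comment> \<open>the graph of \<open>m\<close> over \<open>A\<close>; equality is expressed as the vanishing of a Borel function\<close>
  define \<Gamma> where "\<Gamma> = {z. fst z \<in> A \<and> dist (m (fst z)) (snd z) = 0}"
  have \<Gamma>: "\<Gamma> \<in> sets borel"
  proof -
    have "{z \<in> space (borel \<Otimes>\<^sub>M borel). fst z \<in> A \<and> dist (m (fst z)) (snd z) = 0} \<in> sets (borel \<Otimes>\<^sub>M borel)"
      by measurable
    then show ?thesis
      unfolding borel_prod \<Gamma>_def by simp
  qed
  have saturated: "x \<in> A" if "x' \<in> A" "m x = m x'" for x x'
    using m(2) that inv unfolding maximal_invariant_def by metis
  have "emeasure P A = emeasure J \<Gamma>"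
    unfolding J_def using \<Gamma> by (subst emeasure_distr) (auto simp: \<Gamma>_def sP intro!: arg_cong[where f="emeasure P"])
  also have "\<dots> = (SUP K \<in> {K. K \<subseteq> \<Gamma> \<and> compact K}. emeasure J K)"
    using \<Gamma> J.emeasure_finite by (intro inner_regular) (auto simp: J_def)
  also have "\<dots> \<le> emeasure Q A"
  proof (rule SUP_least, safe)
    fix K assume K: "K \<subseteq> \<Gamma>" "compact K"
    have [measurable]: "snd ` K \<in> sets borel"
      by (intro borel_closed compact_imp_closed compact_continuous_image continuous_on_snd continuous_on_id K)
    have "emeasure J K = emeasure P ((\<lambda>x. (x, m x)) -` K)"
      unfolding J_def using K(2)
      by (subst emeasure_distr) (auto simp: sP intro: borel_closed compact_imp_closed)
    also have "\<dots> \<le> emeasure P (m -` (snd ` K))"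
    proof (rule emeasure_mono)
      show "(\<lambda>x. (x, m x)) -` K \<subseteq> m -` (snd ` K)"
        using image_eqI[of _ snd] by fastforce
      show "m -` (snd ` K) \<in> sets P"
        using measurable_sets[OF m(1), of "snd ` K"] by (simp add: P(2))
    qed
    also have "\<dots> = emeasure (distr P borel m) (snd ` K)"
      by (subst emeasure_distr) (auto simp: sP)
    also have "\<dots> = emeasure Q (m -` (snd ` K))"
      unfolding eq by (subst emeasure_distr) (auto simp: sP)
    also have "\<dots> \<le> emeasure Q A"
    proof (rule emeasure_mono)
      show "m -` snd ` K \<subseteq> A"
      proof
        fix x assume "x \<in> m -` snd ` K"
        then obtain z where z: "z \<in> K" "m x = snd z" by auto
        then have "fst z \<in> A" "m (fst z) = snd z" using K(1) by (auto simp: \<Gamma>_def)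
        then show "x \<in> A" using saturated z by metis
      qed
    qed (simp add: Q(2) A)
    finally show "emeasure J K \<le> emeasure Q A" .
  qed
  finally show ?thesis .
qed

lemma integral_invariant_function_eq:
  fixes P Q :: "'a::{second_countable_topology, complete_space} measure"
    and m :: "'a \<Rightarrow> 'm::{second_countable_topology, complete_space}" and f :: "'a \<Rightarrow> real"
  assumes P: "prob_space P" "sets P = sets borel" and Q: "prob_space Q" "sets Q = sets borel"
    and m: "m \<in> borel_measurable borel" "maximal_invariant act m"
    and eq: "distr P borel m = distr Q borel m"
    and f: "f \<in> borel_measurable borel" and inv: "\<And>g x. f (act g x) = f x"
  shows "(\<integral>x. f x \<partial>P) = (\<integral>x. f x \<partial>Q)"
proof -
  note [measurable_cong] = P(2) Q(2)
  note [measurable] = f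
  have sP: "space P = UNIV" "space Q = UNIV"
    using sets_eq_imp_space_eq[OF P(2)] sets_eq_imp_space_eq[OF Q(2)] by simp_all
  have "distr P borel f = distr Q borel f"
  proof (rule measure_eqI)
    fix B assume "B \<in> sets (distr P borel f)"
    then have B: "B \<in> sets borel" by simp
    have fB: "f -` B \<in> sets borel" using measurable_sets[OF f B] by simp
    have "emeasure P (f -` B) = emeasure Q (f -` B)"
      by (intro antisym invariant_set_measure_le[OF P Q m eq fB]
          invariant_set_measure_le[OF Q P m eq[symmetric] fB]) (auto simp: inv)
    then show "emeasure (distr P borel f) B = emeasure (distr Q borel f) B"
      using B by (simp add: emeasure_distr sP)
  qed simp
  then have "(\<integral>y. y \<partial>distr P borel f) = (\<integral>y. y \<partial>distr Q borel f)" by simp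
  then show ?thesis by (simp add: integral_distr)
qed

text \<open>
  A function with values in the unit interval is uniformly within \<open>1 / n\<close> of the average of the
  indicators of its \<open>n\<close> level sets \<open>{x. i / n \<le> \<phi> x}\<close>.
\<close>

lemma setwise_merging_bounded_unit:
  fixes \<mu> \<nu> :: "nat \<Rightarrow> 'a measure" and \<phi> :: "'a \<Rightarrow> real"
  assumes \<mu>: "\<And>k. \<mu> k \<in> prob_on N" and \<nu>: "\<And>k. \<nu> k \<in> prob_on N"
    and lim: "\<And>B. B \<in> sets N \<Longrightarrow> (\<lambda>k. measure (\<mu> k) B - measure (\<nu> k) B) \<longlonglongrightarrow> 0"
    and \<phi>[measurable]: "\<phi> \<in> borel_measurable N" and bound: "\<And>x. 0 \<le> \<phi> x" "\<And>x. \<phi> x \<le> 1"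
  shows "(\<lambda>k. (\<integral>x. \<phi> x \<partial>\<mu> k) - (\<integral>x. \<phi> x \<partial>\<nu> k)) \<longlonglongrightarrow> 0"
proof (rule LIMSEQ_I)
  fix e :: real assume e: "0 < e"
  obtain n :: nat where n: "0 < n" "1 / real n < e / 4"
    using nat_approx_posE[of "e / 4"] e by (metis zero_less_Suc zero_less_divide_iff zero_less_numeral)
  define A where "A i = {x \<in> space N. real i / real n \<le> \<phi> x}" for i :: nat
  have A[measurable]: "A i \<in> sets N" for i unfolding A_def by measurable
  define S where "S x = (\<Sum>i\<in>{1..n}. indicator (A i) x / real n)" for x :: 'a
  have [measurable]: "S \<in> borel_measurable N" unfolding S_def by measurable
  have S: "\<bar>\<phi> x - S x\<bar> \<le> 1 / real n" if "x \<in> space N" for x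
  proof -
    define y where "y = real n * \<phi> x"
    have y: "0 \<le> y" "y \<le> real n" using bound[of x] n by (auto simp: y_def mult_left_le)
    have "(\<Sum>i\<in>{1..n}. indicator (A i) x :: real) = real (card ({1..n} \<inter> {i. x \<in> A i}))"
      by (simp add: indicator_def sum.If_cases)
    also have "{1..n} \<inter> {i. x \<in> A i} = {1..nat \<lfloor>y\<rfloor>}"
    proof -
      have "x \<in> A i \<longleftrightarrow> i \<le> nat \<lfloor>y\<rfloor>" for i
      proof -
        have "x \<in> A i \<longleftrightarrow> real i \<le> y"
          using that n by (simp add: A_def y_def pos_divide_le_eq mult.commute)
        also have "\<dots> \<longleftrightarrow> int i \<le> \<lfloor>y\<rfloor>"
          by (simp add: le_floor_iff)
        also have "\<dots> \<longleftrightarrow> i \<le> nat \<lfloor>y\<rfloor>"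
          using y(1) by linarith
        finally show ?thesis .
      qed
      then have "{1..n} \<inter> {i. x \<in> A i} = {1..n} \<inter> {..nat \<lfloor>y\<rfloor>}"
        by (simp only: atMost_def)
      moreover have "nat \<lfloor>y\<rfloor> \<le> n" using y by linarith
      ultimately show ?thesis by (simp add: min_absorb2)
    qed
    finally have "S x = real (nat \<lfloor>y\<rfloor>) / real n"
      by (simp add: S_def sum_divide_distrib[symmetric])
    moreover have "\<phi> x = y / real n" using n by (simp add: y_def)
    moreover have "\<bar>y - real (nat \<lfloor>y\<rfloor>)\<bar> \<le> 1" using y by linarith
    ultimately show ?thesis
      using n by (simp add: diff_divide_distrib[symmetric] divide_right_mono)
  qed
  have int: "\<bar>(\<integral>x. \<phi> x \<partial>R) - (\<Sum>i\<in>{1..n}. measure R (A i) / real n)\<bar> \<le> 1 / real n"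
    if "R \<in> prob_on N" for R
  proof -
    have setsR: "sets R = sets N" and "prob_space R" using that by (auto simp: space_prob_algebra)
    interpret R: prob_space R by fact
    note [measurable_cong] = setsR
    have sR: "space R = space N" using setsR by (rule sets_eq_imp_space_eq)
    have i\<phi>: "integrable R \<phi>"
      by (rule R.integrable_const_bound[where B=1]) (use bound in auto)
    have A': "A i \<in> sets R" for i using A setsR by blast
    have iS: "integrable R S" unfolding S_def using A' R.emeasure_finite
      by (auto intro!: Bochner_Integration.integrable_sum simp: less_top[symmetric])
    have "(\<Sum>i\<in>{1..n}. measure R (A i) / real n) = (\<integral>x. S x \<partial>R)"
      unfolding S_def using A' R.emeasure_finite
      by (subst Bochner_Integration.integral_sum) (auto simp: less_top[symmetric])
    then have "\<bar>(\<integral>x. \<phi> x \<partial>R) - (\<Sum>i\<in>{1..n}. measure R (A i) / real n)\<bar> = \<bar>\<integral>x. \<phi> x - S x \<partial>R\<bar>"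
      using i\<phi> iS by simp
    also have "\<dots> \<le> (\<integral>x. \<bar>\<phi> x - S x\<bar> \<partial>R)" by (rule integral_abs_bound)
    also have "\<dots> \<le> (\<integral>x. 1 / real n \<partial>R)"
      using i\<phi> iS S by (intro integral_mono) (auto simp: sR)
    finally show ?thesis by (simp add: R.prob_space)
  qed
  have "(\<lambda>k. \<Sum>i\<in>{1..n}. (measure (\<mu> k) (A i) - measure (\<nu> k) (A i)) / real n) \<longlonglongrightarrow> (\<Sum>i\<in>{1..n}. 0 / real n)"
    by (intro tendsto_intros lim A) (use n in auto)
  then have "(\<lambda>k. (\<Sum>i\<in>{1..n}. measure (\<mu> k) (A i) / real n) - (\<Sum>i\<in>{1..n}. measure (\<nu> k) (A i) / real n)) \<longlonglongrightarrow> 0"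
    by (simp add: diff_divide_distrib sum_subtractf)
  from LIMSEQ_D[OF this, of "e / 2"] e obtain k0 where k0:
    "\<And>k. k0 \<le> k \<Longrightarrow> \<bar>(\<Sum>i\<in>{1..n}. measure (\<mu> k) (A i) / real n) - (\<Sum>i\<in>{1..n}. measure (\<nu> k) (A i) / real n)\<bar> < e / 2"
    by auto
  have "norm ((\<integral>x. \<phi> x \<partial>\<mu> k) - (\<integral>x. \<phi> x \<partial>\<nu> k) - 0) < e" if "k0 \<le> k" for k
    using k0[OF that] int[OF \<mu>, of k] int[OF \<nu>, of k] n unfolding real_norm_def by argo
  then show "\<exists>k0. \<forall>k\<ge>k0. norm ((\<integral>x. \<phi> x \<partial>\<mu> k) - (\<integral>x. \<phi> x \<partial>\<nu> k) - 0) < e" by blast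
qed

lemma setwise_merging_bounded:
  fixes \<mu> \<nu> :: "nat \<Rightarrow> 'a measure" and \<phi> :: "'a \<Rightarrow> real"
  assumes \<mu>: "\<And>k. \<mu> k \<in> prob_on N" and \<nu>: "\<And>k. \<nu> k \<in> prob_on N"
    and lim: "\<And>B. B \<in> sets N \<Longrightarrow> (\<lambda>k. measure (\<mu> k) B - measure (\<nu> k) B) \<longlonglongrightarrow> 0"
    and \<phi>: "\<phi> \<in> borel_measurable N" and bound: "\<And>x. \<bar>\<phi> x\<bar> \<le> K"
  shows "(\<lambda>k. (\<integral>x. \<phi> x \<partial>\<mu> k) - (\<integral>x. \<phi> x \<partial>\<nu> k)) \<longlonglongrightarrow> 0"
proof -
  define L where "L = K + 1"
  have K0: "0 \<le> K" using bound[of undefined] by linarith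
  have L: "0 < L" "\<bar>\<phi> x\<bar> \<le> L" for x using bound[of x] K0 by (auto simp: L_def)
  have "(\<integral>x. (\<phi> x + L) / (2 * L) \<partial>R) = (\<integral>x. \<phi> x \<partial>R) / (2 * L) + 1 / 2" if "R \<in> prob_on N" for R
  proof -
    have setsR: "sets R = sets N" and "prob_space R" using that by (auto simp: space_prob_algebra)
    interpret R: prob_space R by fact
    have "integrable R \<phi>"
      using \<phi> measurable_cong_sets[OF setsR refl, of borel]
      by (intro R.integrable_const_bound[where B=K]) (use bound in auto)
    then show ?thesis using L(1) by (simp add: add_divide_distrib R.prob_space)
  qed
  moreover have "(\<lambda>k. (\<integral>x. (\<phi> x + L) / (2 * L) \<partial>\<mu> k) - (\<integral>x. (\<phi> x + L) / (2 * L) \<partial>\<nu> k)) \<longlonglongrightarrow> 0"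
  proof (rule setwise_merging_bounded_unit[OF \<mu> \<nu> lim])
    show "0 \<le> (\<phi> x + L) / (2 * L)" "(\<phi> x + L) / (2 * L) \<le> 1" for x
      using L(1) L(2)[of x] by (auto simp: field_simps)
  qed (use \<phi> in auto)
  ultimately have "(\<lambda>k. ((\<integral>x. \<phi> x \<partial>\<mu> k) - (\<integral>x. \<phi> x \<partial>\<nu> k)) / (2 * L)) \<longlonglongrightarrow> 0"
    using \<mu> \<nu> by (simp add: diff_divide_distrib)
  from tendsto_mult_right[OF this, of "2 * L"] show ?thesis
    using L(1) by simp
qed

lemma amenable_integral_translate:
  fixes R :: "nat \<Rightarrow> 'g::topological_group_add measure" and \<phi> :: "'g \<Rightarrow> real"
  assumes R: "\<And>k. R k \<in> prob_on borel"
    and lim: "\<And>B g. B \<in> sets borel \<Longrightarrow> (\<lambda>k. \<bar>measure (R k) B - measure (R k) ((\<lambda>b. b + g) ` B)\<bar>) \<longlonglongrightarrow> 0"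
    and \<phi>: "\<phi> \<in> borel_measurable borel" "\<And>g. \<bar>\<phi> g\<bar> \<le> K"
  shows "(\<lambda>k. (\<integral>g. \<phi> (g + h) \<partial>R k) - (\<integral>g. \<phi> g \<partial>R k)) \<longlonglongrightarrow> 0"
proof -
  have setsR: "sets (R k) = sets borel" and prob: "prob_space (R k)" for k
    using R[of k] by (auto simp: space_prob_algebra)
  have sR: "space (R k) = UNIV" for k using sets_eq_imp_space_eq[OF setsR] by simp
  note [measurable_cong] = setsR
  have [measurable]: "(\<lambda>g. g + h) \<in> borel_measurable borel"
    by (intro borel_measurable_continuous_onI continuous_intros)
  have shift: "measure (distr (R k) borel (\<lambda>g. g + h)) B = measure (R k) ((\<lambda>b. b + - h) ` B)"
    if "B \<in> sets borel" for k B
  proof -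
    have "(\<lambda>g. g + h) -` B = (\<lambda>b. b + - h) ` B"
    proof safe
      fix g assume "g + h \<in> B"
      then show "g \<in> (\<lambda>b. b + - h) ` B"
        by (intro image_eqI[of _ _ "g + h"]) (auto simp: add.assoc)
    qed (simp add: add.assoc)
    then show ?thesis
      using that by (simp add: measure_distr sR)
  qed
  have "(\<lambda>k. (\<integral>g. \<phi> g \<partial>distr (R k) borel (\<lambda>g. g + h)) - (\<integral>g. \<phi> g \<partial>R k)) \<longlonglongrightarrow> 0"
  proof (rule setwise_merging_bounded[where N=borel])
    show "distr (R k) borel (\<lambda>g. g + h) \<in> prob_on borel" for k
      by (simp add: space_prob_algebra prob_space.prob_space_distr[OF prob])
    show "(\<lambda>k. measure (distr (R k) borel (\<lambda>g. g + h)) B - measure (R k) B) \<longlonglongrightarrow> 0"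
      if "B \<in> sets borel" for B
      using tendsto_minus[OF lim[OF that, of "- h", unfolded tendsto_rabs_zero_iff]]
      by (simp add: shift[OF that])
  qed (use R \<phi> in auto)
  then show ?thesis
    using \<phi>(1) by (simp add: integral_distr)
qed

section \<open>Averages over orbits\<close>

locale measurable_action =
  fixes act :: "'g::{topological_group_add, second_countable_topology}
      \<Rightarrow> 'a::{second_countable_topology, complete_space} \<Rightarrow> 'a"
  assumes act: "left_action act"
    and act_measurable: "(\<lambda>(g, x). act g x) \<in> borel_measurable (borel \<Otimes>\<^sub>M borel)"
begin

lemma act_add: "act (g + h) x = act g (act h x)" and act_zero: "act 0 x = x"
  using act by (auto simp: left_action_def)

lemma act_measurable_right: "act g \<in> borel_measurable borel"
  using measurable_compose[OF measurable_Pair1'[of g borel borel] act_measurable] by simp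

lemma act_measurable_left: "(\<lambda>g. act g x) \<in> borel_measurable borel"
  using measurable_compose[OF measurable_Pair2'[of x borel borel] act_measurable] by simp

text \<open>
  For a group that acts on itself by left multiplication this is the convolution of \<open>R\<close> and \<open>P\<close>.
\<close>

definition translate :: "'g measure \<Rightarrow> 'a measure \<Rightarrow> 'a measure" where
  "translate R P = distr (R \<Otimes>\<^sub>M P) borel (\<lambda>(g, x). act g x)"

definition orbit_average :: "'g measure \<Rightarrow> ('a \<Rightarrow> real) \<Rightarrow> 'a \<Rightarrow> real" where
  "orbit_average R f x = (\<integral>g. f (act g x) \<partial>R)"

lemma act_measurable_pair:
  assumes "R \<in> prob_on borel" "P \<in> prob_on borel"
  shows "(\<lambda>(g, x). act g x) \<in> borel_measurable (R \<Otimes>\<^sub>M P)"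
proof -
  have "sets (R \<Otimes>\<^sub>M P) = sets (borel \<Otimes>\<^sub>M borel)"
    using assms by (intro sets_pair_measure_cong) (auto simp: space_prob_algebra)
  then show ?thesis
    using act_measurable measurable_cong_sets by blast
qed

lemma translate_prob_on:
  assumes R: "R \<in> prob_on borel" and P: "P \<in> prob_on borel"
  shows "translate R P \<in> prob_on borel"
proof -
  interpret R: prob_space R using R by (simp add: space_prob_algebra)
  interpret P: prob_space P using P by (simp add: space_prob_algebra)
  interpret RP: pair_prob_space R P ..
  show ?thesis
    unfolding translate_def
    using RP.prob_space_distr[OF act_measurable_pair[OF R P]] by (simp add: space_prob_algebra)
qed

lemma emeasure_translate:
  assumes R: "R \<in> prob_on borel" and P: "P \<in> prob_on borel" and B: "B \<in> sets borel"
  shows "emeasure (translate R P) B = (\<integral>\<^sup>+g. emeasure P (act g -` B) \<partial>R)"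
proof -
  interpret R: prob_space R using R by (simp add: space_prob_algebra)
  interpret P: prob_space P using P by (simp add: space_prob_algebra)
  have s: "sets R = sets borel" "sets P = sets borel" using R P by (auto simp: space_prob_algebra)
  have sp: "space (R \<Otimes>\<^sub>M P) = UNIV"
    using sets_eq_imp_space_eq[OF s(1)] sets_eq_imp_space_eq[OF s(2)] by (simp add: space_pair_measure)
  have "emeasure (translate R P) B = emeasure (R \<Otimes>\<^sub>M P) ((\<lambda>(g, x). act g x) -` B)"
    unfolding translate_def using act_measurable_pair[OF R P] B by (simp add: emeasure_distr sp)
  also have "\<dots> = (\<integral>\<^sup>+g. emeasure P (Pair g -` ((\<lambda>(g, x). act g x) -` B)) \<partial>R)"
    using measurable_sets[OF act_measurable_pair[OF R P] B] by (intro P.emeasure_pair_measure_alt) (simp add: sp)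
  finally show ?thesis
    by (simp add: vimage_def)
qed

lemma integral_translate:
  assumes R: "R \<in> prob_on borel" and P: "P \<in> prob_on borel"
    and f: "f \<in> borel_measurable borel" "\<And>x. \<bar>f x\<bar> \<le> B"
  shows "(\<integral>x. f x \<partial>translate R P) = (\<integral>x. orbit_average R f x \<partial>P)"
proof -
  interpret R: prob_space R using R by (simp add: space_prob_algebra)
  interpret P: prob_space P using P by (simp add: space_prob_algebra)
  interpret RP: pair_prob_space R P ..
  have m: "(\<lambda>(g, x). f (act g x)) \<in> borel_measurable (R \<Otimes>\<^sub>M P)"
    using measurable_compose[OF act_measurable_pair[OF R P] f(1)] by (simp add: split_beta)
  have "(\<integral>x. f x \<partial>translate R P) = (\<integral>z. f (case z of (g, x) \<Rightarrow> act g x) \<partial>(R \<Otimes>\<^sub>M P))"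
    unfolding translate_def using act_measurable_pair[OF R P] f(1) by (rule integral_distr)
  also have "\<dots> = (\<integral>(g, x). f (act g x) \<partial>(R \<Otimes>\<^sub>M P))"
    by (intro Bochner_Integration.integral_cong) auto
  also have "\<dots> = (\<integral>x. (\<integral>g. f (act g x) \<partial>R) \<partial>P)"
    by (rule RP.integral_snd[symmetric], rule RP.integrable_const_bound[where B=B])
       (use m f(2) in auto)
  finally show ?thesis
    by (simp add: orbit_average_def)
qed

lemma orbit_average_bounded:
  assumes R: "R \<in> prob_on borel" and f: "f \<in> borel_measurable borel" "\<And>x. \<bar>f x\<bar> \<le> B"
  shows "orbit_average R f \<in> borel_measurable borel" "\<bar>orbit_average R f x\<bar> \<le> B"
proof -
  interpret R: prob_space R using R by (simp add: space_prob_algebra)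
  have sR: "sets R = sets borel" using R by (simp add: space_prob_algebra)
  note [measurable_cong] = sR
  note [measurable] = f(1)
  have "(\<lambda>z. act (snd z) (fst z)) \<in> borel_measurable (borel \<Otimes>\<^sub>M R)"
    using measurable_compose[OF measurable_pair_swap' act_measurable]
    by (simp add: split_beta cong: measurable_cong_sets sets_pair_measure_cong[OF refl sR])
  then have "(\<lambda>(x, g). f (act g x)) \<in> borel_measurable (borel \<Otimes>\<^sub>M R)"
    using measurable_compose[OF _ f(1)] by (simp add: split_beta)
  then show "orbit_average R f \<in> borel_measurable borel"
    unfolding orbit_average_def by (rule R.borel_measurable_lebesgue_integral)
  have "\<bar>orbit_average R f x\<bar> \<le> (\<integral>g. \<bar>f (act g x)\<bar> \<partial>R)"
    unfolding orbit_average_def by (rule integral_abs_bound)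
  also have "\<dots> \<le> (\<integral>g. B \<partial>R)"
  proof (rule integral_mono)
    have "(\<lambda>g. f (act g x)) \<in> borel_measurable R"
      using measurable_compose[OF act_measurable_left f(1)] by simp
    then show "integrable R (\<lambda>g. \<bar>f (act g x)\<bar>)"
      by (intro R.integrable_const_bound[where B=B]) (use f(2) in auto)
  qed (use f(2) in auto)
  finally show "\<bar>orbit_average R f x\<bar> \<le> B" by (simp add: R.prob_space)
qed

text \<open>
  If the integrals of the averages under \<open>P\<close> and \<open>Q\<close> stayed apart by a positive amount, so would
  those of all mixtures of the averages. By amenability each average becomes more
  and more invariant, pointwise, as the index grows, and so do the mixtures of the tails. Suitable
  tail mixtures converge almost everywhere. Their pointwise limit, set to zero at the points where
  there is none, is then exactly invariant, so that its integrals under \<open>P\<close> and \<open>Q\<close> agree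
  by equality of the laws of \<open>m\<close>.
\<close>

lemma orbit_averages_merge:
  fixes R :: "nat \<Rightarrow> 'g measure" and m :: "'a \<Rightarrow> 'm::{second_countable_topology, complete_space}"
  assumes R: "\<And>k. R k \<in> prob_on borel"
    and amenable: "\<And>B g. B \<in> sets borel
        \<Longrightarrow> (\<lambda>k. \<bar>measure (R k) B - measure (R k) ((\<lambda>b. b + g) ` B)\<bar>) \<longlonglongrightarrow> 0"
    and P: "P \<in> prob_on borel" and Q: "Q \<in> prob_on borel" and ac: "absolutely_continuous P Q"
    and m: "m \<in> borel_measurable borel" "maximal_invariant act m"
    and eq: "distr P borel m = distr Q borel m"
    and f: "f \<in> borel_measurable borel" "\<And>x. \<bar>f x\<bar> \<le> B"
    and d: "\<And>k. d \<le> (\<integral>x. orbit_average (R k) f x \<partial>Q) - (\<integral>x. orbit_average (R k) f x \<partial>P)"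
  shows "d \<le> 0"
proof -
  have Pp: "prob_space P" and sP: "sets P = sets borel" using P by (auto simp: space_prob_algebra)
  have Qp: "prob_space Q" and sQ: "sets Q = sets borel" using Q by (auto simp: space_prob_algebra)
  interpret P: prob_space P by fact
  interpret Q: prob_space Q by fact
  note [measurable_cong] = sP sQ
  define F where "F k = orbit_average (R k) f" for k
  have F: "F k \<in> borel_measurable borel" "\<bar>F k x\<bar> \<le> B" for k x
    using orbit_average_bounded[OF R f] by (auto simp: F_def)
  define C where "C j = convex_mixtures (F ` {j..})" for j
  have C: "u \<in> borel_measurable borel \<and> (\<forall>x. \<bar>u x\<bar> \<le> B) \<and> d \<le> (\<integral>x. u x \<partial>Q) - (\<integral>x. u x \<partial>P)"
    if "u \<in> C j" for u j
    using that unfolding C_def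
  proof induct
    case (base u)
    then show ?case using F d by (auto simp: F_def)
  next
    case (mix u v t)
    then have [measurable]: "u \<in> borel_measurable borel" "v \<in> borel_measurable borel" by auto
    have "integrable M u" "integrable M v" if "prob_space M" "sets M = sets borel" for M
    proof -
      interpret prob_space M by fact
      note [measurable_cong] = that(2)
      show "integrable M u" "integrable M v"
        by (rule integrable_const_bound[where B=B]; use mix in auto)+
    qed
    then have int: "integrable P u" "integrable P v" "integrable Q u" "integrable Q v"
      using Pp sP Qp sQ by auto
    have "\<bar>(1 - t) * u x + t * v x\<bar> \<le> B" for x
    proof -
      have "\<bar>(1 - t) * u x + t * v x\<bar> \<le> (1 - t) * \<bar>u x\<bar> + t * \<bar>v x\<bar>"
        using mix(5,6) by (intro abs_triangle_ineq[THEN order_trans]) (auto simp: abs_mult)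
      also have "\<dots> \<le> (1 - t) * B + t * B"
        using mix by (intro add_mono mult_left_mono) auto
      finally show ?thesis by (simp add: algebra_simps)
    qed
    moreover have "(1 - t) * d + t * d \<le> (1 - t) * ((\<integral>x. u x \<partial>Q) - (\<integral>x. u x \<partial>P)) + t * ((\<integral>x. v x \<partial>Q) - (\<integral>x. v x \<partial>P))"
      using mix by (intro add_mono mult_left_mono) auto
    then have "d \<le> (\<integral>x. (1 - t) * u x + t * v x \<partial>Q) - (\<integral>x. (1 - t) * u x + t * v x \<partial>P)"
      using int by (simp add: algebra_simps)
    ultimately show ?case by auto
  qed
  obtain G g where G: "\<And>j. G j \<in> C j" and conv: "AE x in P. (\<lambda>j. G j x) \<longlonglongrightarrow> g x"
  proof (rule P.convex_L2_minimising_sequence[of C "B\<^sup>2"])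
    show "C j \<subseteq> C i" if "i \<le> j" for i j
      unfolding C_def using that by (intro convex_mixtures_mono) auto
    show "square_integrable P u" if "u \<in> C j" for u j
      using C[OF that] by (intro P.square_integrable_bounded[where B=B]) auto
    show "\<exists>u\<in>C j. (\<integral>x. (u x)\<^sup>2 \<partial>P) \<le> B\<^sup>2" for j
    proof
      show Fj: "F j \<in> C j" unfolding C_def by (auto intro: convex_mixtures.base)
      have sq: "(F j x)\<^sup>2 \<le> B\<^sup>2" for x
        using power_mono[OF F(2)[of j x] abs_ge_zero, of 2] by simp
      have "(\<integral>x. (F j x)\<^sup>2 \<partial>P) \<le> (\<integral>x. B\<^sup>2 \<partial>P)"
        using F(1)[of j] sq by (intro integral_mono P.integrable_const_bound[where B="B\<^sup>2"]) auto
      then show "(\<integral>x. (F j x)\<^sup>2 \<partial>P) \<le> B\<^sup>2" by (simp add: P.prob_space)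
    qed
  qed (auto simp: C_def intro: convex_mixtures.mix)
  have Gm[measurable]: "G j \<in> borel_measurable borel" and GB: "\<bar>G j x\<bar> \<le> B" for j x
    using C[OF G[of j]] by auto
  \<comment> \<open>the tail mixtures inherit the asymptotic invariance of the averages\<close>
  have shift: "(\<lambda>j. G j (act h x) - G j x) \<longlonglongrightarrow> 0" for h x
  proof (rule LIMSEQ_I)
    fix e :: real assume e: "0 < e"
    have "(\<lambda>k. (\<integral>g. f (act (g + h) x) \<partial>R k) - (\<integral>g. f (act g x) \<partial>R k)) \<longlonglongrightarrow> 0"
      using measurable_compose[OF act_measurable_left f(1)] f(2)
      by (intro amenable_integral_translate[OF R amenable]) auto
    then have "(\<lambda>k. F k (act h x) - F k x) \<longlonglongrightarrow> 0"
      by (simp add: F_def orbit_average_def act_add)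
    from LIMSEQ_D[OF this, of "e / 2"] e obtain n
      where n: "\<And>k. n \<le> k \<Longrightarrow> \<bar>F k (act h x) - F k x\<bar> \<le> e / 2" by force
    have "\<bar>u (act h x) - u x\<bar> \<le> e / 2" if "n \<le> j" "u \<in> C j" for u j
      using that(2) unfolding C_def
    proof induct
      case (base u)
      then show ?case using n that(1) by auto
    next
      case (mix u v t)
      have "\<bar>(1 - t) * (u (act h x) - u x) + t * (v (act h x) - v x)\<bar>
          \<le> (1 - t) * \<bar>u (act h x) - u x\<bar> + t * \<bar>v (act h x) - v x\<bar>"
        using mix(5,6) by (intro abs_triangle_ineq[THEN order_trans]) (auto simp: abs_mult)
      also have "\<dots> \<le> (1 - t) * (e / 2) + t * (e / 2)"
        using mix by (intro add_mono mult_left_mono) auto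
      also have "\<dots> = e / 2"
        by (simp add: field_simps)
      also have "(1 - t) * (u (act h x) - u x) + t * (v (act h x) - v x)
          = (1 - t) * u (act h x) + t * v (act h x) - ((1 - t) * u x + t * v x)"
        by (simp add: algebra_simps)
      finally show ?case .
    qed
    then have "norm (G j (act h x) - G j x - 0) < e" if "n \<le> j" for j
      using G[of j] that e by fastforce
    then show "\<exists>n. \<forall>j\<ge>n. norm (G j (act h x) - G j x - 0) < e" by blast
  qed
  define fhat where "fhat x = (if convergent (\<lambda>j. G j x) then lim (\<lambda>j. G j x) else 0)" for x
  have [measurable]: "Measurable.pred borel (\<lambda>x. convergent (\<lambda>j. G j x))"
    unfolding Cauchy_convergent_iff[symmetric] by measurable
  have fhat[measurable]: "fhat \<in> borel_measurable borel"
    unfolding fhat_def by measurable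
  have lim_shift: "(\<lambda>j. G j (act h x)) \<longlonglongrightarrow> l \<longleftrightarrow> (\<lambda>j. G j x) \<longlonglongrightarrow> l" for h x l
  proof
    show "(\<lambda>j. G j x) \<longlonglongrightarrow> l" if "(\<lambda>j. G j (act h x)) \<longlonglongrightarrow> l"
      using tendsto_diff[OF that shift[of h x]] by simp
    show "(\<lambda>j. G j (act h x)) \<longlonglongrightarrow> l" if "(\<lambda>j. G j x) \<longlonglongrightarrow> l"
      using tendsto_add[OF that shift[of h x]] by simp
  qed
  have inv: "fhat (act h x) = fhat x" for h x
    by (simp only: fhat_def convergent_def lim_def lim_shift)
  have eq_fhat: "(\<integral>x. fhat x \<partial>P) = (\<integral>x. fhat x \<partial>Q)"
    by (rule integral_invariant_function_eq[where f=fhat and act=act, OF Pp sP Qp sQ m eq fhat inv])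
  have AEP: "AE x in P. (\<lambda>j. G j x) \<longlonglongrightarrow> fhat x"
    using conv
  proof eventually_elim
    case (elim x)
    then show ?case using limI[OF elim] convergentI[OF elim] by (simp add: fhat_def)
  qed
  have AEQ: "AE x in Q. (\<lambda>j. G j x) \<longlonglongrightarrow> fhat x"
    using absolutely_continuous_AE[OF _ ac AEP] sP sQ by simp
  have "(\<lambda>j. \<integral>x. G j x \<partial>P) \<longlonglongrightarrow> (\<integral>x. fhat x \<partial>P)"
    by (rule integral_dominated_convergence[where w="\<lambda>_. B"]) (use AEP GB in auto)
  moreover have "(\<lambda>j. \<integral>x. G j x \<partial>Q) \<longlonglongrightarrow> (\<integral>x. fhat x \<partial>Q)"
    by (rule integral_dominated_convergence[where w="\<lambda>_. B"]) (use AEQ GB in auto)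
  ultimately have "(\<lambda>j. (\<integral>x. G j x \<partial>Q) - (\<integral>x. G j x \<partial>P)) \<longlonglongrightarrow> 0"
    using tendsto_diff[of _ "\<integral>x. fhat x \<partial>Q" sequentially _ "\<integral>x. fhat x \<partial>P"] by (simp add: eq_fhat)
  then show "d \<le> 0"
    by (rule LIMSEQ_le_const) (use C[OF G] in auto)
qed

end

section \<open>Merging of the translates of two measures\<close>

lemma prob_on_mixture:
  assumes R: "R \<in> prob_on N" and R': "R' \<in> prob_on N" and t: "0 \<le> t" "t \<le> 1"
  obtains S where "S \<in> prob_on N"
    and "\<And>f. f \<in> borel_measurable N
      \<Longrightarrow> (\<integral>\<^sup>+x. f x \<partial>S) = ennreal (1 - t) * (\<integral>\<^sup>+x. f x \<partial>R) + ennreal t * (\<integral>\<^sup>+x. f x \<partial>R')"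
proof -
  have prob: "prob_space R" "prob_space R'" and sets: "sets R = sets N" "sets R' = sets N"
    using R R' by (auto simp: space_prob_algebra)
  define \<kappa> where "\<kappa> b = (if b then R' else R)" for b
  define S where "S = measure_pmf (bernoulli_pmf t) \<bind> \<kappa>"
  have \<kappa>: "\<kappa> \<in> measure_pmf (bernoulli_pmf t) \<rightarrow>\<^sub>M subprob_algebra N"
    using prob sets by (auto simp: \<kappa>_def space_subprob_algebra prob_space_imp_subprob_space)
  have int: "(\<integral>\<^sup>+x. f x \<partial>S) = ennreal (1 - t) * (\<integral>\<^sup>+x. f x \<partial>R) + ennreal t * (\<integral>\<^sup>+x. f x \<partial>R')"
    if "f \<in> borel_measurable N" for f
    unfolding S_def using t by (subst nn_integral_bind[OF that \<kappa>]) (simp add: \<kappa>_def mult.commute add.commute)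
  have setsS: "sets S = sets N"
    unfolding S_def by (rule sets_bind[OF sets_kernel[OF \<kappa>]]) auto
  have sp: "space R = space N" "space R' = space N" "space S = space N"
    using sets setsS by (auto dest: sets_eq_imp_space_eq)
  have "emeasure S (space S) = (\<integral>\<^sup>+x. 1 \<partial>S)" by simp
  also have "\<dots> = ennreal (1 - t) * (\<integral>\<^sup>+x. 1 \<partial>R) + ennreal t * (\<integral>\<^sup>+x. 1 \<partial>R')"
    by (rule int) simp
  also have "\<dots> = 1"
    using prob t by (simp add: prob_space.emeasure_space_1 flip: ennreal_plus)
  finally have "prob_space S" by (rule prob_spaceI)
  then show thesis
    using that[of S] setsS int by (simp add: space_prob_algebra)
qed

lemma pair_measure_density_right:
  assumes "sigma_finite_measure R" "sigma_finite_measure P" "sigma_finite_measure (density P f)"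
    and "f \<in> borel_measurable P"
  shows "R \<Otimes>\<^sub>M density P f = density (R \<Otimes>\<^sub>M P) (\<lambda>z. f (snd z))"
proof -
  have "density R (\<lambda>_. 1) \<Otimes>\<^sub>M density P f = density (R \<Otimes>\<^sub>M P) (\<lambda>(x, y). 1 * f y)"
    using assms by (intro pair_measure_density) (auto simp: density_1)
  then show ?thesis by (simp add: density_1 split_beta')
qed

lemma distr_pair_snd:
  assumes "prob_space R" "sigma_finite_measure P"
  shows "distr (R \<Otimes>\<^sub>M P) P snd = P"
proof (rule measure_eqI)
  interpret R: prob_space R by fact
  interpret P: sigma_finite_measure P by fact
  fix B assume "B \<in> sets (distr (R \<Otimes>\<^sub>M P) P snd)"
  then have B: "B \<in> sets P" by simp
  then have "snd -` B \<inter> space (R \<Otimes>\<^sub>M P) = space R \<times> B"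
    using sets.sets_into_space[OF B] by (auto simp: space_pair_measure)
  then show "emeasure (distr (R \<Otimes>\<^sub>M P) P snd) B = emeasure P B"
    using B by (simp add: emeasure_distr P.emeasure_pair_measure_Times R.emeasure_space_1)
qed simp

context measurable_action
begin

lemma translate_mixture:
  assumes R: "R \<in> prob_on borel" and R': "R' \<in> prob_on borel" and t: "0 \<le> t" "t \<le> 1"
  obtains S where "S \<in> prob_on borel"
    and "\<And>P B. P \<in> prob_on borel \<Longrightarrow> B \<in> sets borel
      \<Longrightarrow> measure (translate S P) B = (1 - t) * measure (translate R P) B + t * measure (translate R' P) B"
proof -
  obtain S where S: "S \<in> prob_on borel"
    and int: "\<And>f. f \<in> borel_measurable borel
      \<Longrightarrow> (\<integral>\<^sup>+x. f x \<partial>S) = ennreal (1 - t) * (\<integral>\<^sup>+x. f x \<partial>R) + ennreal t * (\<integral>\<^sup>+x. f x \<partial>R')"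
    using prob_on_mixture[OF R R' t] by blast
  have "measure (translate S P) B = (1 - t) * measure (translate R P) B + t * measure (translate R' P) B"
    if P: "P \<in> prob_on borel" and B: "B \<in> sets borel" for P B
  proof -
    interpret P: prob_space P using P by (simp add: space_prob_algebra)
    have sP: "sets P = sets borel" using P by (simp add: space_prob_algebra)
    have em: "emeasure (translate R P) B = ennreal (measure (translate R P) B)"
      if "R \<in> prob_on borel" for R
      using translate_prob_on[OF that P]
      by (simp add: space_prob_algebra prob_space_def finite_measure.emeasure_eq_measure)
    have "(\<lambda>(g, x). act g x) -` B \<in> sets (borel \<Otimes>\<^sub>M P)"
      unfolding sets_pair_measure_cong[OF refl sP]
      using measurable_sets[OF act_measurable B] by (simp add: space_pair_measure)
    from P.measurable_emeasure_Pair[OF this]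
    have "(\<lambda>g. emeasure P (act g -` B)) \<in> borel_measurable borel"
      by (simp add: vimage_def)
    from int[OF this] have "emeasure (translate S P) B
        = ennreal (1 - t) * emeasure (translate R P) B + ennreal t * emeasure (translate R' P) B"
      by (simp add: emeasure_translate[OF _ P B] R R' S)
    then have "ennreal (measure (translate S P) B)
        = ennreal ((1 - t) * measure (translate R P) B + t * measure (translate R' P) B)"
      using t by (simp add: em R R' S ennreal_mult ennreal_plus)
    then show ?thesis
      using t by (subst (asm) ennreal_inj) auto
  qed
  then show thesis
    using that S by blast
qed

lemma absolutely_continuous_translate:
  assumes R: "R \<in> prob_on borel" and P: "P \<in> prob_on borel" and Q: "Q \<in> prob_on borel"
    and quasi: "\<And>g. absolutely_continuous P (distr Q borel (act g))"
  shows "absolutely_continuous P (translate R Q)"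
  unfolding absolutely_continuous_def
proof
  fix A assume A: "A \<in> null_sets P"
  have sQ: "sets Q = sets borel" "space Q = UNIV" and sP: "sets P = sets borel"
    using P Q sets_eq_imp_space_eq[of Q borel] by (auto simp: space_prob_algebra)
  have AB: "A \<in> sets borel" using A sP by auto
  have actQ: "act g \<in> Q \<rightarrow>\<^sub>M borel" for g
    using act_measurable_right measurable_cong_sets[OF sQ(1) refl] by blast
  have "emeasure Q (act g -` A) = 0" for g
  proof -
    have "A \<in> null_sets (distr Q borel (act g))"
      using quasi A by (auto simp: absolutely_continuous_def)
    then show ?thesis
      using AB by (simp add: null_sets_def emeasure_distr[OF actQ] sQ)
  qed
  then have "emeasure (translate R Q) A = 0"
    by (simp add: emeasure_translate[OF R Q AB])
  then show "A \<in> null_sets (translate R Q)"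
    using AB by (auto simp: null_sets_def translate_def)
qed

text \<open>
  Amenability only yields setwise information. It is turned into a bound for the total variation by
  convexity, as in Mazur's theorem. If no mixing measure made the two mixtures close, the
  differences of their densities would form a convex set away from zero in \<open>L\<^sup>1\<close>. A bounded function
  \<open>f\<close> would separate it from zero, so that the integrals of the orbit averages of \<open>f\<close> under
  \<open>P\<close> and \<open>Q\<close> would stay apart.
\<close>

lemma translates_merge_in_total_variation:
  fixes m :: "'a \<Rightarrow> 'm::{second_countable_topology, complete_space}"
  assumes amenable: "amenable TYPE('g)"
    and P: "P \<in> prob_on borel" and Q: "Q \<in> prob_on borel" and ac: "absolutely_continuous P Q"
    and quasi: "\<And>g. absolutely_continuous P (distr P borel (act g))"
    and m: "m \<in> borel_measurable borel" "maximal_invariant act m"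
    and eq: "distr P borel m = distr Q borel m" and c: "0 < c"
  obtains S where "S \<in> prob_on borel"
    and "\<And>B. B \<in> sets borel \<Longrightarrow> measure (translate S Q) B - measure (translate S P) B \<le> c"
proof (rule ccontr)
  note rule = that
  assume "\<not> thesis"
  then have far: "\<exists>B\<in>sets borel. c < measure (translate S Q) B - measure (translate S P) B"
    if "S \<in> prob_on borel" for S
    using that rule by (meson not_le)
  obtain R :: "nat \<Rightarrow> 'g measure" where R: "\<And>k. R k \<in> prob_on borel"
    and am: "\<And>B g. B \<in> sets borel
        \<Longrightarrow> (\<lambda>k. \<bar>measure (R k) B - measure (R k) ((\<lambda>b. b + g) ` B)\<bar>) \<longlonglongrightarrow> 0"
    using amenable unfolding amenable_def by blast
  have Pp: "prob_space P" and sP: "sets P = sets borel" using P by (auto simp: space_prob_algebra)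
  have sQ: "sets Q = sets borel" using Q by (auto simp: space_prob_algebra)
  interpret P: prob_space P by fact
  have quasiQ: "absolutely_continuous P (distr Q borel (act g))" for g
  proof -
    have "absolutely_continuous (distr P borel (act g)) (distr Q borel (act g))"
      using act_measurable_right[of g] measurable_cong_sets[OF sP refl] sP sQ
      by (intro absolutely_continuous_distr[OF ac]) auto
    then show ?thesis
      using quasi[of g] by (auto simp: absolutely_continuous_def)
  qed
  have density: "\<exists>a::'a \<Rightarrow> real. a \<in> borel_measurable P \<and> (\<forall>x. 0 \<le> a x) \<and> translate S M = density P (\<lambda>x. ennreal (a x))"
    if S: "S \<in> prob_on borel" and M: "M \<in> prob_on borel"
      and qM: "\<And>g. absolutely_continuous P (distr M borel (act g))" for S M
  proof -
    have "prob_space (translate S M)" "sets (translate S M) = sets P"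
      using translate_prob_on[OF S M] sP by (auto simp: space_prob_algebra)
    moreover have "absolutely_continuous P (translate S M)"
      by (rule absolutely_continuous_translate[OF S P M qM])
    ultimately obtain h :: "'a \<Rightarrow> real"
      where "h \<in> borel_measurable P" "\<And>x. 0 \<le> h x" "translate S M = density P h"
      using absolutely_continuous_real_density[OF Pp] by blast
    then show ?thesis by blast
  qed
  have "\<forall>k. \<exists>a::'a \<Rightarrow> real. a \<in> borel_measurable P \<and> (\<forall>x. 0 \<le> a x) \<and> translate (R k) Q = density P (\<lambda>x. ennreal (a x))"
    using density[OF R Q quasiQ] by blast
  from choice[OF this] obtain a :: "nat \<Rightarrow> 'a \<Rightarrow> real"
    where a[measurable]: "\<And>k. a k \<in> borel_measurable P" and a0: "\<And>k x. 0 \<le> a k x"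
      and Qa: "\<And>k. translate (R k) Q = density P (a k)" by blast
  have "\<forall>k. \<exists>b::'a \<Rightarrow> real. b \<in> borel_measurable P \<and> (\<forall>x. 0 \<le> b x) \<and> translate (R k) P = density P (\<lambda>x. ennreal (b x))"
    using density[OF R P quasi] by blast
  from choice[OF this] obtain b :: "nat \<Rightarrow> 'a \<Rightarrow> real"
    where b[measurable]: "\<And>k. b k \<in> borel_measurable P" and b0: "\<And>k x. 0 \<le> b k x"
      and Pb: "\<And>k. translate (R k) P = density P (b k)" by blast
  have int_density: "integrable P h" if h[measurable]: "h \<in> borel_measurable P" and h0: "\<And>x. 0 \<le> h x"
    and "density P h \<in> prob_on borel" for h :: "'a \<Rightarrow> real"
  proof (rule integrableI_nonneg)
    have "(\<integral>\<^sup>+x. ennreal (h x) \<partial>P) = emeasure (density P h) (space (density P h))"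
      by (simp add: emeasure_density cong: nn_integral_cong)
    also have "\<dots> = 1"
      using that(3) by (simp add: space_prob_algebra prob_space.emeasure_space_1 del: space_density)
    finally show "(\<integral>\<^sup>+x. ennreal (h x) \<partial>P) < \<infinity>" by simp
  qed (use h0 in auto)
  have ia: "integrable P (a k)" and ib: "integrable P (b k)" for k
    using int_density[OF a a0, of k] int_density[OF b b0, of k]
      translate_prob_on[OF R Q] translate_prob_on[OF R P] by (simp_all add: Qa Pb)
  define v where "v k x = a k x - b k x" for k x
  have v: "integrable P (v k)" for k
    unfolding v_def using ia ib by auto
  have v_int: "(\<integral>x. f x \<partial>translate (R k) Q) - (\<integral>x. f x \<partial>translate (R k) P) = (\<integral>x. f x * v k x \<partial>P)"
    if f: "f \<in> borel_measurable borel" and fB: "\<And>x. \<bar>f x\<bar> \<le> B" for f B k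
  proof -
    have [measurable]: "f \<in> borel_measurable P"
      using f measurable_cong_sets[OF sP refl] by blast
    have int: "integrable P (\<lambda>x. h x * f x)" if "integrable P h" for h :: "'a \<Rightarrow> real"
    proof (rule Bochner_Integration.integrable_bound)
      show "integrable P (\<lambda>x. B * h x)" using that by simp
      have "\<bar>h x * f x\<bar> \<le> \<bar>B * h x\<bar>" for x
        using fB[of x] by (simp add: abs_mult mult.commute[of "\<bar>h x\<bar>"] mult_right_mono)
      then show "AE x in P. norm (h x * f x) \<le> norm (B * h x)" by simp
    qed (use that in measurable)
    show ?thesis
      unfolding Qa Pb using a0 b0 int[OF ia] int[OF ib]
      by (simp add: integral_density v_def algebra_simps)
  qed
  have hull: "\<exists>S\<in>prob_on borel. integrable P u \<and> (\<forall>B\<in>sets borel.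
      measure (translate S Q) B - measure (translate S P) B = (\<integral>x. indicator B x * u x \<partial>P))"
    if "u \<in> convex_mixtures (range v)" for u
    using that
  proof induct
    case (base u)
    then obtain k where u: "u = v k" by auto
    have "measure (translate (R k) Q) B - measure (translate (R k) P) B = (\<integral>x. indicator B x * v k x \<partial>P)"
      if "B \<in> sets borel" for B
      using v_int[of "indicator B" 1 k] that by (simp add: translate_def)
    then show ?case using R[of k] v u by blast
  next
    case (mix f g t)
    from mix(2) obtain S where S: "S \<in> prob_on borel" "integrable P f"
        "\<And>B. B \<in> sets borel \<Longrightarrow> measure (translate S Q) B - measure (translate S P) B = (\<integral>x. indicator B x * f x \<partial>P)"
      by blast
    from mix(4) obtain S' where S': "S' \<in> prob_on borel" "integrable P g"
        "\<And>B. B \<in> sets borel \<Longrightarrow> measure (translate S' Q) B - measure (translate S' P) B = (\<integral>x. indicator B x * g x \<partial>P)"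
      by blast
    obtain T where T: "T \<in> prob_on borel"
      and mT: "\<And>P B. P \<in> prob_on borel \<Longrightarrow> B \<in> sets borel
        \<Longrightarrow> measure (translate T P) B = (1 - t) * measure (translate S P) B + t * measure (translate S' P) B"
      using translate_mixture[OF S(1) S'(1) mix(5,6)] by blast
    have "measure (translate T Q) B - measure (translate T P) B
        = (\<integral>x. indicator B x * ((1 - t) * f x + t * g x) \<partial>P)" if B: "B \<in> sets borel" for B
    proof -
      have BP: "B \<in> sets P" using B sP by simp
      have int: "integrable P (\<lambda>x. indicator B x * h x)" if "integrable P h" for h :: "'a \<Rightarrow> real"
        using integrable_mult_indicator[OF BP that] by simp
      have "measure (translate T Q) B - measure (translate T P) B
          = (1 - t) * (measure (translate S Q) B - measure (translate S P) B)
            + t * (measure (translate S' Q) B - measure (translate S' P) B)"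
        by (simp add: mT P Q B algebra_simps)
      also have "\<dots> = (1 - t) * (\<integral>x. indicator B x * f x \<partial>P) + t * (\<integral>x. indicator B x * g x \<partial>P)"
        using S(3) S'(3) B by simp
      also have "\<dots> = (\<integral>x. (1 - t) * (indicator B x * f x) + t * (indicator B x * g x) \<partial>P)"
        using int[OF S(2)] int[OF S'(2)] by simp
      also have "\<dots> = (\<integral>x. indicator B x * ((1 - t) * f x + t * g x) \<partial>P)"
        by (intro Bochner_Integration.integral_cong) (auto simp: algebra_simps)
      finally show ?thesis .
    qed
    then show ?case
      using T S(2) S'(2) by auto
  qed
  have "c \<le> (\<integral>x. \<bar>u x\<bar> \<partial>P)" if u_hull: "u \<in> convex_mixtures (range v)" for u
  proof -
    obtain S where S: "S \<in> prob_on borel" and u: "integrable P u"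
      and Su: "\<And>B. B \<in> sets borel \<Longrightarrow> measure (translate S Q) B - measure (translate S P) B = (\<integral>x. indicator B x * u x \<partial>P)"
      using hull[OF u_hull] by blast
    obtain B where B: "B \<in> sets borel" "c < measure (translate S Q) B - measure (translate S P) B"
      using far[OF S] by blast
    have "B \<in> sets P" using B sP by simp
    then have "(\<integral>x. indicator B x * u x \<partial>P) \<le> (\<integral>x. \<bar>u x\<bar> \<partial>P)"
      using u integrable_mult_indicator[OF \<open>B \<in> sets P\<close> u]
      by (intro integral_mono) (auto simp: indicator_def)
    then show ?thesis using B Su by simp
  qed
  from P.L1_separation[of v c, OF v c this]
  obtain f B d where f: "f \<in> borel_measurable P" "\<And>x. \<bar>f x\<bar> \<le> B" and d: "0 < d"
    and sep: "\<And>k. d \<le> (\<integral>x. f x * v k x \<partial>P)" by blast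
  have fb: "f \<in> borel_measurable borel"
    using f(1) measurable_cong_sets[OF sP refl] by blast
  have "d \<le> (\<integral>x. orbit_average (R k) f x \<partial>Q) - (\<integral>x. orbit_average (R k) f x \<partial>P)" for k
    using sep[of k] v_int[OF fb f(2), of k] integral_translate[OF R P fb f(2), of k]
      integral_translate[OF R Q fb f(2), of k] by simp
  from orbit_averages_merge[OF R am P Q ac m eq fb f(2) this] d show False
    by simp
qed

text \<open>
  From total variation to divergence. Where the density \<open>s\<close> of the mixtures is at most two,
  \<open>ln s\<close> is controlled by \<open>s - 1\<close>, hence by the total variation distance. Where \<open>s > 2\<close>, an event of
  small probability, the localised data processing inequality bounds the expectation of \<open>ln s\<close> by
  that of \<open>ln r\<close> over the same event, which is small since \<open>ln r\<close> is integrable.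
\<close>

lemma translates_merge_in_KL:
  fixes m :: "'a \<Rightarrow> 'm::{second_countable_topology, complete_space}" and r :: "'a \<Rightarrow> real"
  assumes amenable: "amenable TYPE('g)"
    and P: "P \<in> prob_on borel" and Q: "density P r \<in> prob_on borel"
    and r: "r \<in> borel_measurable borel" and r0: "\<And>x. 0 \<le> r x"
    and int: "integrable (density P r) (\<lambda>x. ln (r x))"
    and quasi: "\<And>g. absolutely_continuous P (distr P borel (act g))"
    and m: "m \<in> borel_measurable borel" "maximal_invariant act m"
    and eq: "distr P borel m = distr (density P r) borel m" and \<eta>: "0 < \<eta>"
  obtains S s where "S \<in> prob_on borel" "s \<in> borel_measurable borel" "\<And>x. 0 \<le> s x"
    and "translate S (density P r) = density (translate S P) s"
    and "integrable (translate S (density P r)) (\<lambda>x. ln (s x))"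
    and "(\<integral>x. ln (s x) \<partial>translate S (density P r)) \<le> \<eta>"
proof -
  let ?Q = "density P r"
  have Pp: "prob_space P" and sP: "sets P = sets borel" using P by (auto simp: space_prob_algebra)
  have Qp: "prob_space ?Q" and sQ: "sets ?Q = sets borel" using Q by (auto simp: space_prob_algebra)
  interpret P: prob_space P by fact
  interpret Q: prob_space ?Q by fact
  have [measurable_cong]: "sets P = sets borel" by (rule sP)
  note [measurable] = r
  have ac: "absolutely_continuous P ?Q"
    by (rule absolutely_continuousI_density) simp
  \<comment> \<open>the part of \<open>ln r\<close> that a small event cannot control\<close>
  define tail where "tail n = (\<integral>x. max 0 (\<bar>ln (r x)\<bar> - real n) \<partial>?Q)" for n
  have "tail \<longlonglongrightarrow> (\<integral>x. 0 \<partial>?Q)"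
    unfolding tail_def
  proof (rule integral_dominated_convergence[where w="\<lambda>x. \<bar>ln (r x)\<bar>"])
    show "AE x in ?Q. (\<lambda>n. max 0 (\<bar>ln (r x)\<bar> - real n)) \<longlonglongrightarrow> 0"
    proof (rule AE_I2)
      fix x
      obtain n0 where n0: "\<bar>ln (r x)\<bar> \<le> real n0" using real_arch_simple by blast
      show "(\<lambda>n. max 0 (\<bar>ln (r x)\<bar> - real n)) \<longlonglongrightarrow> 0"
        by (rule tendsto_eventually) (use n0 in \<open>auto simp: eventually_sequentially intro!: exI[of _ n0]\<close>)
    qed
  qed (use int in auto)
  then have "tail \<longlonglongrightarrow> 0" by simp
  from order_tendstoD(2)[OF this, of "\<eta> / 2"] \<eta> obtain n where n: "tail n < \<eta> / 2"
    by (auto simp: eventually_sequentially)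
  \<comment> \<open>the budget: the event \<open>s \<le> 2\<close> costs \<open>2 * c\<close>, and the bounded part of \<open>ln r\<close> costs
      \<open>n\<close> times the probability of \<open>s > 2\<close>\<close>
  define c where "c = \<eta> / (4 * (real n + 1))"
  have c: "0 < c" "2 * c + real n * (2 * c) \<le> \<eta> / 2"
  proof -
    show "0 < c" using \<eta> by (simp add: c_def)
    have "2 * c + real n * (2 * c) = 2 * (c * (real n + 1))"
      by (simp add: algebra_simps)
    also have "c * (real n + 1) = \<eta> / 4"
    proof -
      have "\<eta> / (4 * k) * k = \<eta> / 4" if "0 < k" for k :: real using that by simp
      then show ?thesis unfolding c_def by (simp only: of_nat_0_le_iff add_nonneg_pos zero_less_one)
    qed
    finally show "2 * c + real n * (2 * c) \<le> \<eta> / 2" by simp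
  qed
  obtain S where S: "S \<in> prob_on borel"
    and tv: "\<And>B. B \<in> sets borel \<Longrightarrow> measure (translate S ?Q) B - measure (translate S P) B \<le> c"
    using translates_merge_in_total_variation[OF amenable P Q ac quasi m eq c(1)] by blast
  interpret S: prob_space S using S by (simp add: space_prob_algebra)
  have sS: "sets S = sets borel" using S by (simp add: space_prob_algebra)
  interpret SP: pair_prob_space S P ..
  interpret SQ: pair_prob_space S ?Q ..
  have distr_snd: "distr (S \<Otimes>\<^sub>M ?Q) ?Q snd = ?Q"
    by (rule distr_pair_snd[OF S.prob_space_axioms Q.sigma_finite_measure_axioms])
  define T where "T = (\<lambda>(g, x). act g x)"
  have Tm[measurable]: "T \<in> borel_measurable (S \<Otimes>\<^sub>M P)"
    unfolding T_def by (rule act_measurable_pair[OF S P])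
  have prod: "S \<Otimes>\<^sub>M ?Q = density (S \<Otimes>\<^sub>M P) (\<lambda>z. ennreal (r (snd z)))"
    by (rule pair_measure_density_right)
       (auto intro: S.sigma_finite_measure_axioms P.sigma_finite_measure_axioms Q.sigma_finite_measure_axioms)
  have tQ: "translate S ?Q = distr (density (S \<Otimes>\<^sub>M P) (\<lambda>z. ennreal (r (snd z)))) borel T"
    and tP: "translate S P = distr (S \<Otimes>\<^sub>M P) borel T"
    unfolding translate_def prod T_def by auto
  have probs: "prob_space (translate S ?Q)" "prob_space (translate S P)"
    and sets_t: "sets (translate S ?Q) = sets borel" "sets (translate S P) = sets borel"
    using translate_prob_on[OF S P] translate_prob_on[OF S Q] by (auto simp: space_prob_algebra)
  have "absolutely_continuous (translate S P) (translate S ?Q)"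
    unfolding tQ tP by (intro absolutely_continuous_distr absolutely_continuousI_density) auto
  then obtain s :: "'a \<Rightarrow> real"
    where s': "s \<in> borel_measurable (translate S P)" and s0: "\<And>x. 0 \<le> s x"
      and dens: "translate S ?Q = density (translate S P) s"
    using absolutely_continuous_real_density[OF probs(2,1)] sets_t by metis
  have s[measurable]: "s \<in> borel_measurable borel"
    using s' measurable_cong_sets[OF sets_t(2) refl] by blast
  have probQ: "prob_space (density (S \<Otimes>\<^sub>M P) (\<lambda>z. ennreal (r (snd z))))"
    using SQ.prob_space_axioms unfolding prod .
  have int': "integrable (density (S \<Otimes>\<^sub>M P) (\<lambda>z. ennreal (r (snd z)))) (\<lambda>z. ln (r (snd z)))"
    unfolding prod[symmetric]
  proof -
    have "integrable (distr (S \<Otimes>\<^sub>M ?Q) ?Q snd) (\<lambda>x. ln (r x))"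
      using int by (simp add: distr_snd)
    then show "integrable (S \<Otimes>\<^sub>M ?Q) (\<lambda>z. ln (r (snd z)))"
      by (subst (asm) integrable_distr_eq) auto
  qed
  have rm: "(\<lambda>z. r (snd z)) \<in> borel_measurable (S \<Otimes>\<^sub>M P)" and r0': "0 \<le> r (snd z)" for z :: "'g \<times> 'a"
    using r0 by measurable
  note push = log_density_pushforward[OF SP.prob_space_axioms probQ rm r0' Tm s s0 dens[unfolded tQ tP] int']
  define A where "A = {x. 2 < s x}"
  have A[measurable]: "A \<in> sets borel" unfolding A_def by measurable
  have AT: "{z \<in> space (S \<Otimes>\<^sub>M ?Q). T z \<in> A} \<in> sets (S \<Otimes>\<^sub>M ?Q)"
    using measurable_sets[OF Tm A] by (simp add: prod vimage_def Int_def conj_commute)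
  let ?Qt = "translate S ?Q" and ?Pt = "translate S P"
  interpret Pt: prob_space ?Pt by (rule probs)
  interpret Qt: prob_space ?Qt by (rule probs)
  have [measurable_cong]: "sets ?Pt = sets borel" "sets ?Qt = sets borel" by (rule sets_t)+
  have int_s: "integrable ?Pt s"
  proof (rule integrableI_nonneg)
    have "(\<integral>\<^sup>+x. ennreal (s x) \<partial>?Pt) = emeasure ?Qt (space ?Qt)"
      unfolding dens by (simp add: emeasure_density cong: nn_integral_cong)
    then show "(\<integral>\<^sup>+x. ennreal (s x) \<partial>?Pt) < \<infinity>"
      by (simp add: Qt.emeasure_space_1)
  qed (use s0 in auto)
  have QtPt: "(\<integral>x. h x \<partial>?Qt) = (\<integral>x. s x * h x \<partial>?Pt)"
    if "h \<in> borel_measurable borel" for h :: "'a \<Rightarrow> real"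
    unfolding dens using s0 that by (subst integral_density) auto
  have iplus: "integrable ?Pt (\<lambda>x. max 0 (s x - 1))"
    using int_s by auto
  \<comment> \<open>the event \<open>s > 1\<close> attains the largest difference of the probabilities\<close>
  have plus: "(\<integral>x. max 0 (s x - 1) \<partial>?Pt) \<le> c"
  proof -
    define B where "B = {x. 1 < s x}"
    have B[measurable]: "B \<in> sets borel" unfolding B_def by measurable
    have iB: "integrable ?Pt (\<lambda>x. s x * indicator B x)" "integrable ?Pt (\<lambda>x. indicator B x :: real)"
      using integrable_mult_indicator[of B ?Pt s] int_s Pt.emeasure_finite
      by (auto simp: mult.commute sets_t less_top[symmetric])
    have "(\<integral>x. max 0 (s x - 1) \<partial>?Pt) = (\<integral>x. s x * indicator B x - indicator B x \<partial>?Pt)"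
      by (intro Bochner_Integration.integral_cong) (auto simp: B_def indicator_def)
    also have "\<dots> = (\<integral>x. s x * indicator B x \<partial>?Pt) - (\<integral>x. indicator B x \<partial>?Pt)"
      using iB by simp
    also have "\<dots> = (\<integral>x. indicator B x \<partial>?Qt) - (\<integral>x. indicator B x \<partial>?Pt)"
      by (subst QtPt) auto
    also have "\<dots> = measure ?Qt B - measure ?Pt B"
      using sets_eq_imp_space_eq[OF sets_t(1)] sets_eq_imp_space_eq[OF sets_t(2)] by simp
    finally show ?thesis
      using tv[OF B] by simp
  qed
  have QtA: "(\<integral>x. indicator A x \<partial>?Qt) \<le> 2 * c"
  proof -
    have "(\<integral>x. indicator A x \<partial>?Qt) = (\<integral>x. s x * indicator A x \<partial>?Pt)"
      by (subst QtPt) auto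
    also have "\<dots> \<le> (\<integral>x. 2 * max 0 (s x - 1) \<partial>?Pt)"
      using integrable_mult_indicator[of A ?Pt s] int_s iplus
      by (intro integral_mono) (auto simp: mult.commute sets_t A_def indicator_def)
    finally show ?thesis using plus by simp
  qed
  have ints: "integrable ?Qt (\<lambda>x. ln (s x))"
    unfolding tQ using push(1) by (subst integrable_distr_eq) auto
  have intA: "integrable ?Qt (\<lambda>x. ln (s x) * indicator D x)" if "D \<in> sets borel" for D
    using integrable_mult_indicator[of D ?Qt, OF _ ints] that by (simp add: mult.commute sets_t)
  have low: "(\<integral>x. ln (s x) * indicator (- A) x \<partial>?Qt) \<le> 2 * c"
  proof -
    have "integrable ?Pt (\<lambda>x. s x * (ln (s x) * indicator (- A) x))"
    proof -
      have "integrable (density ?Pt s) (\<lambda>x. ln (s x) * indicator (- A) x)"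
        using intA[of "- A"] by (simp add: dens)
      then show ?thesis
        by (subst (asm) integrable_density) (use s0 in auto)
    qed
    then have "(\<integral>x. s x * (ln (s x) * indicator (- A) x) \<partial>?Pt) \<le> (\<integral>x. 2 * max 0 (s x - 1) \<partial>?Pt)"
    proof (rule integral_mono)
      show "s x * (ln (s x) * indicator (- A) x) \<le> 2 * max 0 (s x - 1)" for x
      proof (cases "x \<in> A")
        case False
        then have s2: "s x \<le> 2" by (simp add: A_def)
        consider "s x = 0" | "0 < s x" using s0[of x] by linarith
        then show ?thesis
        proof cases
          case 2
          have "s x * ln (s x) \<le> s x * max 0 (s x - 1)"
            using ln_le_minus_one[OF 2] 2 by (intro mult_left_mono) auto
          also have "\<dots> \<le> 2 * max 0 (s x - 1)"
            using s2 by (intro mult_right_mono) auto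
          finally show ?thesis using False by simp
        qed simp
      qed simp
    qed (use iplus in simp)
    then show ?thesis using plus by (subst QtPt) auto
  qed
  have high: "(\<integral>x. ln (s x) * indicator A x \<partial>?Qt) \<le> tail n + real n * (2 * c)"
  proof -
    let ?QQ = "S \<Otimes>\<^sub>M ?Q"
    have TQ[measurable]: "T \<in> borel_measurable ?QQ"
      unfolding T_def by (rule act_measurable_pair[OF S Q])
    have i1: "integrable ?QQ (\<lambda>z. ln (r (snd z)))" using int' unfolding prod .
    have i2: "integrable ?QQ (\<lambda>z. indicator A (T z) :: real)"
      by (rule SQ.integrable_const_bound[where B=1]) auto
    have i3: "integrable ?QQ (\<lambda>z. max 0 (\<bar>ln (r (snd z))\<bar> - real n))"
      using i1 by (intro integrable_max) auto
    have i4: "integrable ?QQ (\<lambda>z. ln (r (snd z)) * indicator A (T z))"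
      by (rule Bochner_Integration.integrable_bound[OF i1]) (auto simp: indicator_def)
    have "(\<integral>x. ln (s x) * indicator A x \<partial>?Qt) = (\<integral>z. ln (s (T z)) * indicator A (T z) \<partial>?QQ)"
      unfolding tQ prod by (subst integral_distr) auto
    also have "\<dots> \<le> (\<integral>z. ln (r (snd z)) * indicator A (T z) \<partial>?QQ)"
      unfolding prod by (rule push(2)) (rule A)
    also have "\<dots> \<le> (\<integral>z. max 0 (\<bar>ln (r (snd z))\<bar> - real n) + real n * indicator A (T z) \<partial>?QQ)"
      using i2 i3 by (intro integral_mono[OF i4]) (auto simp: indicator_def)
    also have "\<dots> = (\<integral>z. max 0 (\<bar>ln (r (snd z))\<bar> - real n) \<partial>?QQ) + real n * (\<integral>z. indicator A (T z) \<partial>?QQ)"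
      using i2 i3 by simp
    also have "(\<integral>z. max 0 (\<bar>ln (r (snd z))\<bar> - real n) \<partial>?QQ) = tail n"
    proof -
      have "tail n = (\<integral>x. max 0 (\<bar>ln (r x)\<bar> - real n) \<partial>distr ?QQ ?Q snd)"
        by (simp add: tail_def distr_snd)
      then show ?thesis by (simp add: integral_distr)
    qed
    also have "(\<integral>z. (indicator A (T z) :: real) \<partial>?QQ) = (\<integral>x. indicator A x \<partial>?Qt)"
      unfolding tQ prod by (subst integral_distr) auto
    also have "tail n + real n * (\<integral>x. indicator A x \<partial>?Qt) \<le> tail n + real n * (2 * c)"
      using QtA by (intro add_left_mono mult_left_mono) auto
    finally show ?thesis .
  qed
  have "(\<integral>x. ln (s x) \<partial>?Qt) = (\<integral>x. ln (s x) * indicator (- A) x + ln (s x) * indicator A x \<partial>?Qt)"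
    by (intro Bochner_Integration.integral_cong) (auto simp: indicator_def)
  also have "\<dots> = (\<integral>x. ln (s x) * indicator (- A) x \<partial>?Qt) + (\<integral>x. ln (s x) * indicator A x \<partial>?Qt)"
    using intA[of A] intA[of "- A"] by simp
  also have "\<dots> \<le> \<eta>"
    using low high n c(2) by simp
  finally have "(\<integral>x. ln (s x) \<partial>?Qt) \<le> \<eta>" .
  with that[OF S s s0 dens ints] show thesis .
qed

end

section \<open>Amenable mixtures of an invariant model\<close>

lemma integrable_if_powr_moment:
  fixes f :: "'a \<Rightarrow> real"
  assumes "prob_space M" and f[measurable]: "f \<in> borel_measurable M" and \<epsilon>: "0 < \<epsilon>"
    and fin: "(\<integral>\<^sup>+x. ennreal (\<bar>f x\<bar> powr (1 + \<epsilon>)) \<partial>M) < \<infinity>"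
  shows "integrable M f"
proof -
  interpret prob_space M by fact
  have int: "integrable M (\<lambda>x. \<bar>f x\<bar> powr (1 + \<epsilon>))"
    using fin by (intro integrableI_nonneg) auto
  show ?thesis
  proof (rule Bochner_Integration.integrable_bound)
    show "integrable M (\<lambda>x. 1 + \<bar>f x\<bar> powr (1 + \<epsilon>))"
      using int by simp
    have "a \<le> 1 + a powr (1 + \<epsilon>)" if "0 \<le> a" for a :: real
    proof (cases "a \<le> 1")
      case False
      then have "a powr 1 \<le> a powr (1 + \<epsilon>)" using \<epsilon> by (intro powr_mono) auto
      then show ?thesis using False by simp
    qed (simp add: add_increasing2)
    from this[OF abs_ge_zero] show "AE x in M. norm (f x) \<le> norm (1 + \<bar>f x\<bar> powr (1 + \<epsilon>))"
      by simp
  qed simp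
qed

lemma absolutely_continuous_density:
  fixes a b :: "'a \<Rightarrow> real"
  assumes [measurable]: "a \<in> borel_measurable M" "b \<in> borel_measurable M"
    and supp: "\<And>x. 0 < a x \<Longrightarrow> 0 < b x"
  shows "absolutely_continuous (density M b) (density M a)"
  unfolding absolutely_continuous_def
proof
  fix N assume N: "N \<in> null_sets (density M b)"
  then have [measurable]: "N \<in> sets M" by auto
  have "AE x in M. x \<in> N \<longrightarrow> ennreal (b x) = 0"
    using N by (subst (asm) null_sets_density_iff) auto
  then have "AE x in M. x \<in> N \<longrightarrow> ennreal (a x) = 0"
    by (rule eventually_mono) (use supp in \<open>auto simp: ennreal_eq_0_iff simp flip: not_less\<close>)
  then show "N \<in> null_sets (density M a)"
    by (subst null_sets_density_iff) auto
qed

lemma density_quotient: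
  fixes a b :: "'a \<Rightarrow> real"
  assumes [measurable]: "a \<in> borel_measurable M" "b \<in> borel_measurable M"
    and nn: "\<And>x. 0 \<le> a x" "\<And>x. 0 \<le> b x"
    and ac: "absolutely_continuous (density M b) (density M a)"
  shows "density M a = density (density M b) (\<lambda>x. a x / b x)"
proof -
  have "AE x in density M b. b x \<noteq> 0"
    using nn by (simp add: AE_density)
  then have "AE x in density M a. b x \<noteq> 0"
    by (rule absolutely_continuous_AE[OF _ ac, rotated]) simp
  then have "AE x in M. b x = 0 \<longrightarrow> a x = 0"
    by (subst (asm) AE_density) (use nn in \<open>auto elim!: eventually_mono simp: less_le\<close>)
  then show ?thesis
    using nn by (intro density_density_divide[symmetric]) auto
qed

context measurable_action
begin

lemma invariant_family_eq_distr:
  assumes inv: "invariant_family act P" and P: "\<And>g. P g \<in> prob_on borel"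
  shows "P g = distr (P 0) borel (act g)"
proof (rule measure_eqI)
  have sets: "sets (P g) = sets borel" and prob: "prob_space (P g)" for g
    using P by (auto simp: space_prob_algebra)
  show "sets (P g) = sets (distr (P 0) borel (act g))" by (simp add: sets)
  fix B assume "B \<in> sets (P g)"
  then have B: "B \<in> sets borel" by (simp add: sets)
  have sp: "space (P 0) = UNIV" using sets_eq_imp_space_eq[OF sets] by simp
  have [measurable]: "act g \<in> P 0 \<rightarrow>\<^sub>M borel"
    using act_measurable_right measurable_cong_sets[OF sets refl] by blast
  have preB: "act g -` B \<in> sets borel"
    using measurable_sets[OF act_measurable_right B] by simp
  have "y \<in> act g ` (act g -` B)" if "y \<in> B" for y
    using that act_add[of g "- g" y] by (intro image_eqI[of _ _ "act (- g) y"]) (auto simp: act_zero)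
  then have "act g ` (act g -` B) = B" by auto
  then have "measure (P (g + 0)) B = measure (P 0) (act g -` B)"
    using inv preB unfolding invariant_family_def by metis
  then show "emeasure (P g) B = emeasure (distr (P 0) borel (act g)) B"
    using prob B by (simp add: emeasure_distr sp finite_measure.emeasure_eq_measure prob_space_def)
qed

lemma translate_density_invariant:
  fixes h :: "'a \<Rightarrow> ennreal"
  assumes S: "S \<in> prob_on borel" and P: "P \<in> prob_on borel" and hP: "density P h \<in> prob_on borel"
    and h: "h \<in> borel_measurable borel" and inv: "\<And>g x. h (act g x) = h x"
  shows "translate S (density P h) = density (translate S P) h"
proof -
  have "prob_space S" "prob_space P" "prob_space (density P h)" and sP: "sets P = sets borel"
    using S P hP by (auto simp: space_prob_algebra)
  then have sf: "sigma_finite_measure S" "sigma_finite_measure P" "sigma_finite_measure (density P h)"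
    by (auto intro: prob_space_imp_sigma_finite)
  have hPm: "h \<in> borel_measurable P" using h measurable_cong_sets[OF sP refl] by blast
  define T where "T = (\<lambda>(g, x). act g x)"
  have T: "T \<in> borel_measurable (S \<Otimes>\<^sub>M P)"
    unfolding T_def by (rule act_measurable_pair[OF S P])
  have "S \<Otimes>\<^sub>M density P h = density (S \<Otimes>\<^sub>M P) (\<lambda>z. h (snd z))"
    by (rule pair_measure_density_right[OF sf hPm])
  also have "(\<lambda>z. h (snd z)) = (\<lambda>z. h (T z))"
    by (auto simp: T_def inv)
  finally show ?thesis
    unfolding translate_def T_def[symmetric] by (simp add: density_distr[OF h T])
qed

lemma distr_translate:
  fixes m :: "'a \<Rightarrow> 'm::topological_space"
  assumes S: "S \<in> prob_on borel" and P: "P \<in> prob_on borel"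
    and m: "m \<in> borel_measurable borel" and inv: "\<And>g x. m (act g x) = m x"
  shows "distr (translate S P) borel m = distr P borel m"
proof -
  have "prob_space S" "prob_space P" and sP: "sets P = sets borel"
    using S P by (auto simp: space_prob_algebra)
  have mP: "m \<in> borel_measurable P" using m measurable_cong_sets[OF sP refl] by blast
  have "distr (translate S P) borel m = distr (S \<Otimes>\<^sub>M P) borel (\<lambda>z. m (snd z))"
    unfolding translate_def
    by (subst distr_distr[OF m act_measurable_pair[OF S P]])
       (auto simp: inv intro!: distr_cong)
  also have "\<dots> = distr (distr (S \<Otimes>\<^sub>M P) P snd) borel m"
    by (subst distr_distr[OF mP]) (auto simp: comp_def)
  also have "\<dots> = distr P borel m"
    using \<open>prob_space S\<close> \<open>prob_space P\<close>
    by (simp add: distr_pair_snd prob_space_imp_sigma_finite)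
  finally show ?thesis .
qed

text \<open>
  The excess of the divergence of the mixtures over that of the laws of \<open>m\<close> is itself a divergence.
  Reweighting \<open>P\<close> by the density \<open>z\<close> of the two laws of \<open>m\<close> gives a measure \<open>P'\<close> under which \<open>m\<close> has the
  same law as under \<open>Q\<close>. The weight is invariant, so that mixing commutes with the reweighting, and
  the log-density of the mixtures of \<open>Q\<close> and \<open>P\<close> is \<open>ln (z (m x))\<close> plus that of the mixtures of
  \<open>Q\<close> and \<open>P'\<close>. The first term has the divergence of the laws of \<open>m\<close> as its expectation, and the
  second has arbitrarily small expectation.
\<close>

lemma amenable_mixture_KL_le:
  fixes m :: "'a \<Rightarrow> 'm::{second_countable_topology, complete_space}"
    and \<rho> :: "'a \<Rightarrow> real" and z :: "'m \<Rightarrow> real"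
  assumes amenable: "amenable TYPE('g)"
    and P: "P \<in> prob_on borel" and Q: "Q \<in> prob_on borel" and ac: "absolutely_continuous Q P"
    and quasi: "\<And>g. absolutely_continuous P (distr P borel (act g))"
    and m: "m \<in> borel_measurable borel" "maximal_invariant act m"
    and \<rho>: "\<rho> \<in> borel_measurable borel" "\<And>x. 0 \<le> \<rho> x" "Q = density P \<rho>"
      "integrable Q (\<lambda>x. ln (\<rho> x))"
    and z: "z \<in> borel_measurable borel" "\<And>y. 0 \<le> z y" "distr Q borel m = density (distr P borel m) z"
      "integrable Q (\<lambda>x. ln (z (m x)))"
    and \<eta>: "0 < \<eta>"
  obtains S where "S \<in> prob_on borel"
    and "KL (translate S Q) (translate S P) \<le> KL (distr Q borel m) (distr P borel m) + ereal \<eta>"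
proof -
  have Pp: "prob_space P" and sP[measurable_cong]: "sets P = sets borel" using P by (auto simp: space_prob_algebra)
  have Qp: "prob_space Q" and sQ[measurable_cong]: "sets Q = sets borel" using Q by (auto simp: space_prob_algebra)
  note [measurable] = m(1) \<rho>(1) z(1)
  have mact: "m (act g x) = m x" for g x
    using m(2) unfolding maximal_invariant_def by blast
  define \<zeta> where "\<zeta> x = z (m x)" for x
  have \<zeta>[measurable]: "\<zeta> \<in> borel_measurable borel" unfolding \<zeta>_def by measurable
  have \<zeta>0: "0 \<le> \<zeta> x" for x by (simp add: \<zeta>_def z)
  define P' where "P' = density P \<zeta>"
  have distrP': "distr P' borel m = distr Q borel m"
    unfolding P'_def \<zeta>_def z(3) by (subst density_distr) auto
  have P': "P' \<in> prob_on borel"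
  proof -
    have "prob_space (distr P' borel m)"
      unfolding distrP' by (rule prob_space.prob_space_distr[OF Qp]) measurable
    then have "prob_space P'"
      by (rule prob_space_distrD[rotated]) (simp add: P'_def)
    then show ?thesis by (simp add: space_prob_algebra P'_def sP)
  qed
  have pos_m: "AE y in distr Q borel m. 0 < z y"
    unfolding z(3) using z by (auto simp: AE_density less_le)
  have pos_Q: "AE x in Q. 0 < \<zeta> x"
    using pos_m unfolding \<zeta>_def by (subst (asm) AE_distr_iff) auto
  have pos_P: "AE x in P. 0 < \<zeta> x"
    by (rule absolutely_continuous_AE[OF _ ac pos_Q]) (simp add: sP sQ)
  have pos_\<rho>: "AE x in Q. 0 < \<rho> x"
    unfolding \<rho>(3) using \<rho>(2) by (auto simp: AE_density less_le)
  define r where "r x = \<rho> x / \<zeta> x" for x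
  have r[measurable]: "r \<in> borel_measurable borel" unfolding r_def by measurable
  have r0: "0 \<le> r x" for x by (simp add: r_def \<rho> \<zeta>0)
  have Qr: "Q = density P' r"
  proof -
    have "absolutely_continuous (density P \<zeta>) (density P \<rho>)"
      unfolding absolutely_continuous_def
    proof
      fix N assume N: "N \<in> null_sets (density P \<zeta>)"
      then have [measurable]: "N \<in> sets P" by auto
      have "AE x in P. x \<in> N \<longrightarrow> ennreal (\<zeta> x) = 0"
        using N by (subst (asm) null_sets_density_iff) auto
      with pos_P have "AE x in P. x \<notin> N"
        by eventually_elim auto
      then show "N \<in> null_sets (density P \<rho>)"
        by (subst null_sets_density_iff) (auto elim: eventually_mono)
    qed
    from density_quotient[OF _ _ \<rho>(2) \<zeta>0 this] show ?thesis
      by (simp add: \<rho>(3) P'_def r_def)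
  qed
  have acP: "absolutely_continuous P' P"
    unfolding absolutely_continuous_def
  proof
    fix N assume N: "N \<in> null_sets P'"
    then have NP[measurable]: "N \<in> sets P" by (auto simp: P'_def)
    have "AE x in P. x \<in> N \<longrightarrow> ennreal (\<zeta> x) = 0"
      using N unfolding P'_def by (subst (asm) null_sets_density_iff) auto
    with pos_P have "AE x in P. x \<notin> N"
      by eventually_elim auto
    then show "N \<in> null_sets P"
      using NP by (simp add: AE_iff_null_sets)
  qed
  have acP': "absolutely_continuous P P'"
    unfolding P'_def by (rule absolutely_continuousI_density) simp
  have quasi': "absolutely_continuous P' (distr P' borel (act g))" for g
  proof -
    have [measurable]: "act g \<in> P \<rightarrow>\<^sub>M borel"
      using act_measurable_right measurable_cong_sets[OF sP refl] by blast
    have "absolutely_continuous (distr P borel (act g)) (distr P' borel (act g))"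
      by (rule absolutely_continuous_distr[OF acP']) (auto simp: P'_def)
    then show ?thesis
      using quasi[of g] acP by (auto simp: absolutely_continuous_def)
  qed
  have int_r: "integrable Q (\<lambda>x. ln (r x))"
  proof (rule integrable_cong_AE_imp)
    show "integrable Q (\<lambda>x. ln (\<rho> x) - ln (\<zeta> x))"
      using \<rho>(4) z(4) by (auto simp: \<zeta>_def)
    show "AE x in Q. ln (\<rho> x) - ln (\<zeta> x) = ln (r x)"
      using pos_\<rho> pos_Q by eventually_elim (simp add: r_def ln_div)
  qed simp
  obtain S s where S: "S \<in> prob_on borel" and s[measurable]: "s \<in> borel_measurable borel"
    and s0: "\<And>x. 0 \<le> s x" and dens: "translate S Q = density (translate S P') s"
    and int_s: "integrable (translate S Q) (\<lambda>x. ln (s x))"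
    and le: "(\<integral>x. ln (s x) \<partial>translate S Q) \<le> \<eta>"
    using translates_merge_in_KL[OF amenable P' Q[unfolded Qr] r r0 int_r[unfolded Qr] quasi' m
        distrP'[unfolded Qr] \<eta>] unfolding Qr[symmetric] by blast
  let ?Qt = "translate S Q" and ?Pt = "translate S P"
  have Qt: "prob_space ?Qt" "sets ?Qt = sets borel" and Pt: "prob_space ?Pt" "sets ?Pt = sets borel"
    using translate_prob_on[OF S Q] translate_prob_on[OF S P] by (auto simp: space_prob_algebra)
  note [measurable_cong] = Qt(2) Pt(2)
  have "translate S P' = density ?Pt \<zeta>"
    unfolding P'_def using P'[unfolded P'_def]
    by (intro translate_density_invariant[OF S P]) (auto simp: \<zeta>_def mact)
  then have dens2: "?Qt = density ?Pt (\<lambda>x. ennreal (\<zeta> x * s x))"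
    unfolding dens using \<zeta>0 s0 by (simp add: density_density_eq ennreal_mult)
  have distr_Qt: "distr ?Qt borel m = distr Q borel m"
    by (rule distr_translate[OF S Q m(1) mact])
  have posz: "AE x in ?Qt. 0 < \<zeta> x"
    using pos_m unfolding distr_Qt[symmetric] \<zeta>_def by (subst (asm) AE_distr_iff) auto
  have poss: "AE x in ?Qt. 0 < s x"
  proof -
    have [measurable_cong]: "sets (translate S P') = sets borel" by (simp add: translate_def)
    show ?thesis
      unfolding dens using s0 by (subst AE_density) (auto simp: less_le)
  qed
  have ln_eq: "AE x in ?Qt. ln (\<zeta> x) + ln (s x) = ln (\<zeta> x * s x)"
    using posz poss by eventually_elim (simp add: ln_mult)
  have int_z: "integrable (distr Q borel m) (\<lambda>y. ln (z y))"
    using z(4) by (subst integrable_distr_eq) auto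
  then have int_\<zeta>: "integrable ?Qt (\<lambda>x. ln (\<zeta> x))"
    unfolding distr_Qt[symmetric] \<zeta>_def by (subst (asm) integrable_distr_eq) auto
  have "integrable ?Qt (\<lambda>x. ln (\<zeta> x * s x))"
    by (rule integrable_cong_AE_imp[OF Bochner_Integration.integrable_add[OF int_\<zeta> int_s] _ ln_eq]) simp
  then have "KL ?Qt ?Pt = ereal (\<integral>x. ln (\<zeta> x * s x) \<partial>?Qt)"
    using KL_density_eq[OF Pt(1), of "\<lambda>x. \<zeta> x * s x"] \<zeta>0 s0 by (simp flip: dens2)
  also have "(\<integral>x. ln (\<zeta> x * s x) \<partial>?Qt) = (\<integral>x. ln (\<zeta> x) + ln (s x) \<partial>?Qt)"
    by (rule integral_cong_AE) (use ln_eq in auto)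
  also have "\<dots> = (\<integral>x. ln (\<zeta> x) \<partial>?Qt) + (\<integral>x. ln (s x) \<partial>?Qt)"
    using int_\<zeta> int_s by simp
  also have "(\<integral>x. ln (\<zeta> x) \<partial>?Qt) = (\<integral>y. ln (z y) \<partial>distr Q borel m)"
    unfolding distr_Qt[symmetric] \<zeta>_def by (subst integral_distr) auto
  finally have "KL ?Qt ?Pt \<le> ereal ((\<integral>y. ln (z y) \<partial>distr Q borel m) + \<eta>)"
    using le by simp
  also have "\<dots> = KL (distr Q borel m) (distr P borel m) + ereal \<eta>"
  proof -
    have "prob_space (distr P borel m)"
      by (rule prob_space.prob_space_distr[OF Pp]) measurable
    from KL_density_eq[OF this, of z] int_z z(2) show ?thesis
      by (simp flip: z(3))
  qed
  finally show thesis
    using that S by blast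
qed

text \<open>
  By Fubini's theorem, integration over \<open>d\<close> first gives the member of the invariant family at \<open>g\<close>,
  and this is the image under \<open>g\<close> of the member at the unit element.
\<close>

lemma bind_product_eq_translate:
  assumes R: "R \<in> prob_on borel" and \<pi>: "\<pi> \<in> prob_on D"
    and K: "(\<lambda>(g, d). K g d) \<in> borel \<Otimes>\<^sub>M D \<rightarrow>\<^sub>M prob_algebra borel"
    and inv: "invariant_family act (\<lambda>g. \<pi> \<bind> K g)" and prob: "\<And>g. \<pi> \<bind> K g \<in> prob_on borel"
  shows "(R \<Otimes>\<^sub>M \<pi>) \<bind> (\<lambda>(g, d). K g d) = translate R (\<pi> \<bind> K 0)"
proof -
  interpret R: prob_space R using R by (simp add: space_prob_algebra)
  interpret \<pi>: prob_space \<pi> using \<pi> by (simp add: space_prob_algebra)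
  interpret pair: pair_prob_space R \<pi> ..
  have sR: "sets R = sets borel" and s\<pi>: "sets \<pi> = sets D"
    using R \<pi> by (auto simp: space_prob_algebra)
  have spR: "space R = UNIV" using sets_eq_imp_space_eq[OF sR] by simp
  have sets: "sets (R \<Otimes>\<^sub>M \<pi>) = sets (borel \<Otimes>\<^sub>M D)"
    using sR s\<pi> by (rule sets_pair_measure_cong)
  have KRP: "(\<lambda>(g, d). K g d) \<in> R \<Otimes>\<^sub>M \<pi> \<rightarrow>\<^sub>M subprob_algebra borel"
    using measurable_prob_algebraD[OF K] measurable_cong_sets[OF sets refl] by blast
  have Kg: "K g \<in> \<pi> \<rightarrow>\<^sub>M subprob_algebra borel" for g
    using measurable_compose[OF measurable_Pair1'[of g R \<pi>] KRP] by (simp add: spR)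
  have s_bind: "sets ((R \<Otimes>\<^sub>M \<pi>) \<bind> (\<lambda>(g, d). K g d)) = sets borel"
    by (rule sets_bind[OF sets_kernel[OF KRP] pair.not_empty])
  show ?thesis
  proof (rule measure_eqI)
    show "sets ((R \<Otimes>\<^sub>M \<pi>) \<bind> (\<lambda>(g, d). K g d)) = sets (translate R (\<pi> \<bind> K 0))"
      by (simp add: s_bind translate_def)
    fix B assume "B \<in> sets ((R \<Otimes>\<^sub>M \<pi>) \<bind> (\<lambda>(g, d). K g d))"
    then have B: "B \<in> sets borel"
      by (simp only: s_bind)
    have "emeasure ((R \<Otimes>\<^sub>M \<pi>) \<bind> (\<lambda>(g, d). K g d)) B
        = (\<integral>\<^sup>+z. emeasure (case z of (g, d) \<Rightarrow> K g d) B \<partial>(R \<Otimes>\<^sub>M \<pi>))"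
      by (rule emeasure_bind[OF pair.not_empty KRP B])
    also have "\<dots> = (\<integral>\<^sup>+g. \<integral>\<^sup>+d. emeasure (K g d) B \<partial>\<pi> \<partial>R)"
      using \<pi>.nn_integral_fst[OF measurable_compose[OF KRP measurable_emeasure_subprob_algebra[OF B]]]
      by simp
    also have "\<dots> = (\<integral>\<^sup>+g. emeasure (\<pi> \<bind> K g) B \<partial>R)"
      by (simp add: emeasure_bind[OF \<pi>.not_empty Kg B])
    also have "\<dots> = (\<integral>\<^sup>+g. emeasure (\<pi> \<bind> K 0) (act g -` B) \<partial>R)"
    proof (rule nn_integral_cong)
      fix g
      have s0: "sets (\<pi> \<bind> K 0) = sets borel" using prob[of 0] by (simp add: space_prob_algebra)
      have "act g \<in> (\<pi> \<bind> K 0) \<rightarrow>\<^sub>M borel"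
        using act_measurable_right measurable_cong_sets[OF s0 refl] by blast
      then have "emeasure (distr (\<pi> \<bind> K 0) borel (act g)) B = emeasure (\<pi> \<bind> K 0) (act g -` B)"
        using B sets_eq_imp_space_eq[OF s0] by (simp add: emeasure_distr)
      then show "emeasure (\<pi> \<bind> K g) B = emeasure (\<pi> \<bind> K 0) (act g -` B)"
        using invariant_family_eq_distr[where P="\<lambda>g. \<pi> \<bind> K g" and g=g, OF inv prob] by simp
    qed
    also have "\<dots> = emeasure (translate R (\<pi> \<bind> K 0)) B"
      by (rule emeasure_translate[OF R prob B, symmetric])
    finally show "emeasure ((R \<Otimes>\<^sub>M \<pi>) \<bind> (\<lambda>(g, d). K g d)) B = emeasure (translate R (\<pi> \<bind> K 0)) B" .
  qed
qed

end

lemma distr_bind_invariant_kernel: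
  assumes \<pi>: "\<pi> \<in> prob_on (N \<Otimes>\<^sub>M D)" and n: "n \<in> space N"
    and K: "(\<lambda>(g, d). K g d) \<in> N \<Otimes>\<^sub>M D \<rightarrow>\<^sub>M prob_algebra borel"
    and m: "m \<in> borel_measurable borel"
    and inv: "\<And>g d. d \<in> space D \<Longrightarrow> distr (K g d) borel m = distr (K n d) borel m"
  shows "distr (\<pi> \<bind> (\<lambda>(g, d). K g d)) borel m = distr \<pi> D snd \<bind> (\<lambda>d. distr (K n d) borel m)"
proof -
  interpret \<pi>: prob_space \<pi> using \<pi> by (simp add: space_prob_algebra)
  have s\<pi>: "sets \<pi> = sets (N \<Otimes>\<^sub>M D)" using \<pi> by (simp add: space_prob_algebra)
  have K\<pi>: "(\<lambda>(g, d). K g d) \<in> \<pi> \<rightarrow>\<^sub>M subprob_algebra borel"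
    using measurable_prob_algebraD[OF K] measurable_cong_sets[OF s\<pi> refl] by blast
  have snd: "snd \<in> \<pi> \<rightarrow>\<^sub>M D"
    unfolding measurable_cong_sets[OF s\<pi> refl] by (rule measurable_snd)
  have Kn: "K n \<in> D \<rightarrow>\<^sub>M subprob_algebra borel"
    using measurable_compose[OF measurable_Pair1'[OF n] measurable_prob_algebraD[OF K]] by simp
  have Km: "(\<lambda>d. distr (K n d) borel m) \<in> D \<rightarrow>\<^sub>M subprob_algebra borel"
    by (rule measurable_compose[OF Kn measurable_distr[OF m]])
  have "distr (\<pi> \<bind> (\<lambda>(g, d). K g d)) borel m = \<pi> \<bind> (\<lambda>z. distr (case z of (g, d) \<Rightarrow> K g d) borel m)"
    by (rule distr_bind[OF K\<pi> \<pi>.not_empty m])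
  also have "\<dots> = \<pi> \<bind> (\<lambda>z. distr (K n (snd z)) borel m)"
  proof (rule bind_cong_All, rule ballI)
    fix z assume z: "z \<in> space \<pi>"
    have "space \<pi> = space N \<times> space D"
      using sets_eq_imp_space_eq[OF s\<pi>] unfolding space_pair_measure .
    then have "snd z \<in> space D"
      using z by (simp only: mem_Times_iff)
    then have "distr (K (fst z) (snd z)) borel m = distr (K n (snd z)) borel m"
      by (rule inv)
    then show "distr (case z of (g, d) \<Rightarrow> K g d) borel m = distr (K n (snd z)) borel m"
      by (simp only: case_prod_beta)
  qed
  also have "\<dots> = distr \<pi> D snd \<bind> (\<lambda>d. distr (K n d) borel m)"
    by (rule bind_distr[OF snd Km \<pi>.not_empty, symmetric])
  finally show ?thesis .
qed

section \<open>The infimum over mixtures on the group\<close>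

theorem proposition7:
  fixes act\<^sub>X :: "'g::{topological_group_add, polish_space} \<Rightarrow> 'x::polish_space \<Rightarrow> 'x"
    and act\<^sub>\<Theta> :: "'g \<Rightarrow> 't \<Rightarrow> 't"
    and act :: "'g \<Rightarrow> ('n::finite \<Rightarrow> 'x) \<Rightarrow> ('n \<Rightarrow> 'x)"
    and P :: "'t \<Rightarrow> ('n \<Rightarrow> 'x) measure"
    and \<delta> :: "'t \<Rightarrow> 'd" and \<theta> :: "'d \<Rightarrow> 't"
    and \<Delta>\<^sub>0 \<Delta>\<^sub>1 :: "'d measure"
    and P_gd Q_gd :: "'g \<Rightarrow> 'd \<Rightarrow> ('n \<Rightarrow> 'x) measure"
    and m :: "('n \<Rightarrow> 'x) \<Rightarrow> 'm::polish_space"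
    and P_M Q_M :: "'d \<Rightarrow> 'm measure"
    and \<Pi>s\<^sub>0 \<Pi>s\<^sub>1 :: "'d measure"
    and Ps Qs :: "'g \<Rightarrow> ('n \<Rightarrow> 'x) measure"
    and \<mu> :: "('n \<Rightarrow> 'x) measure" and chi :: "'g \<Rightarrow> real"
    and p q :: "'g \<Rightarrow> ('n \<Rightarrow> 'x) \<Rightarrow> real"
    and \<nu> :: "'m measure" and p_M q_M :: "'m \<Rightarrow> real"
    and \<epsilon> :: real
  assumes "left_action act\<^sub>X"
    and act: "act = componentwise act\<^sub>X"
    and "left_action act\<^sub>\<Theta>" and "free_action act\<^sub>\<Theta>"
    and "\<And>t. P t \<in> prob_on borel"
    and "\<And>t g B. B \<in> sets borel \<Longrightarrow> measure (P t) B = measure (P (act\<^sub>\<Theta> g t)) (act g ` B)"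
    and "maximal_invariant act\<^sub>\<Theta> \<delta>"
    and "\<And>d. d \<in> range \<delta> \<Longrightarrow> \<delta> (\<theta> d) = d"
    and "space \<Delta>\<^sub>0 \<subseteq> range \<delta>" and "space \<Delta>\<^sub>1 \<subseteq> range \<delta>"
    and P_gd: "P_gd = (\<lambda>g d. P (act\<^sub>\<Theta> g (\<theta> d)))"
    and Q_gd: "Q_gd = (\<lambda>g d. P (act\<^sub>\<Theta> g (\<theta> d)))"
    and "(\<lambda>(g, d). P_gd g d) \<in> borel \<Otimes>\<^sub>M \<Delta>\<^sub>0 \<rightarrow>\<^sub>M prob_algebra borel"
    and "(\<lambda>(g, d). Q_gd g d) \<in> borel \<Otimes>\<^sub>M \<Delta>\<^sub>1 \<rightarrow>\<^sub>M prob_algebra borel"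
  assumes "m \<in> borel_measurable borel" and "maximal_invariant act m"
    and P_M: "P_M = (\<lambda>d. distr (P_gd 0 d) borel m)"
    and Q_M: "Q_M = (\<lambda>d. distr (Q_gd 0 d) borel m)"
  assumes "is_arg_min (\<lambda>(\<Pi>\<^sub>0, \<Pi>\<^sub>1). KL (\<Pi>\<^sub>1 \<bind> Q_M) (\<Pi>\<^sub>0 \<bind> P_M))
           (\<lambda>(\<Pi>\<^sub>0, \<Pi>\<^sub>1). \<Pi>\<^sub>0 \<in> prob_on \<Delta>\<^sub>0 \<and> \<Pi>\<^sub>1 \<in> prob_on \<Delta>\<^sub>1) (\<Pi>s\<^sub>0, \<Pi>s\<^sub>1)"
    and Ps: "Ps = (\<lambda>g. \<Pi>s\<^sub>0 \<bind> (\<lambda>d. P_gd g d))"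
    and Qs: "Qs = (\<lambda>g. \<Pi>s\<^sub>1 \<bind> (\<lambda>d. Q_gd g d))"
  assumes "amenable TYPE('g)"
  assumes \<comment> \<open>both spaces are Polish by their type classes\<close>
        "locally_compact_space (euclidean :: 'g topology)"
    and "locally_compact_space (euclidean :: ('n \<Rightarrow> 'x) topology)"
  assumes "free_action act" and "continuous_action act" and "proper_action act"
  assumes "invariant_family act Ps" and "invariant_family act Qs"
    and "sets \<mu> = sets borel" and "relatively_left_invariant act chi \<mu>"
    and "\<And>g. p g \<in> borel_measurable borel" and "\<And>g x. 0 \<le> p g x"
    and "\<And>g. q g \<in> borel_measurable borel" and "\<And>g x. 0 \<le> q g x"
    and "\<And>g. Ps g = density \<mu> (\<lambda>x. ennreal (p g x))"
    and "\<And>g. Qs g = density \<mu> (\<lambda>x. ennreal (q g x))"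
    and "\<exists>S. \<forall>g. {x. 0 < p g x} = S \<and> {x. 0 < q g x} = S"
  assumes \<comment> \<open>densities of the statistic are relative to an arbitrary dominating measure \<open>\<nu>\<close>\<close>
        "0 < \<epsilon>"
    and "sets \<nu> = sets borel"
    and "p_M \<in> borel_measurable borel" and "\<And>y. 0 \<le> p_M y"
    and "q_M \<in> borel_measurable borel" and "\<And>y. 0 \<le> q_M y"
    and "\<And>g. distr (Ps g) borel m = density \<nu> (\<lambda>y. ennreal (p_M y))"
    and "\<And>g. distr (Qs g) borel m = density \<nu> (\<lambda>y. ennreal (q_M y))"
    and "(\<integral>\<^sup>+ x. ennreal (\<bar>ln (q 0 x / p 0 x)\<bar> powr (1 + \<epsilon>)) \<partial>Qs 0) < \<infinity>"
    and "(\<integral>\<^sup>+ x. ennreal (\<bar>ln (q_M (m x) / p_M (m x))\<bar> powr (1 + \<epsilon>)) \<partial>Qs 0) < \<infinity>"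
  shows "(INF (\<Pi>\<^sub>0, \<Pi>\<^sub>1) \<in> prob_on (borel \<Otimes>\<^sub>M \<Delta>\<^sub>0) \<times> prob_on (borel \<Otimes>\<^sub>M \<Delta>\<^sub>1).
            KL (\<Pi>\<^sub>1 \<bind> (\<lambda>(g, d). Q_gd g d)) (\<Pi>\<^sub>0 \<bind> (\<lambda>(g, d). P_gd g d)))
       = (INF (\<Pi>\<^sub>0, \<Pi>\<^sub>1) \<in> prob_on \<Delta>\<^sub>0 \<times> prob_on \<Delta>\<^sub>1.
            KL (\<Pi>\<^sub>1 \<bind> Q_M) (\<Pi>\<^sub>0 \<bind> P_M))"
proof -
  note invariant_model = assms(6) and kernel_P = assms(13) and kernel_Q = assms(14)
    and m = assms(15,16) and minimizer = assms(19) and inv_Ps = assms(28) and inv_Qs = assms(29)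
    and sets_\<mu> = assms(30) and dens_Ps = assms(36) and dens_Qs = assms(37) and support = assms(38)
  have la: "left_action act"
    using assms(1) by (simp add: left_action_def act componentwise_def)
  have "(\<lambda>(g, x). act g x) \<in> borel_measurable (borel \<Otimes>\<^sub>M borel)"
    unfolding borel_prod using assms(26) by (intro borel_measurable_continuous_onI) (simp add: continuous_action_def)
  with la interpret measurable_action act by unfold_locales
  define K where "K = (\<lambda>g d. P (act\<^sub>\<Theta> g (\<theta> d)))"
  have PK: "P_gd = K" and QK: "Q_gd = K" unfolding P_gd Q_gd K_def by auto
  have K_prob: "K g d \<in> prob_on borel" for g d
    unfolding K_def by (rule assms(5))
  have K_inv: "invariant_family act (\<lambda>g. K g d)" for d
    unfolding invariant_family_def
  proof (intro allI ballI)
    fix g h :: 'g and B :: "('n \<Rightarrow> 'x) set"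
    assume "B \<in> sets borel"
    have "act\<^sub>\<Theta> (h + g) (\<theta> d) = act\<^sub>\<Theta> h (act\<^sub>\<Theta> g (\<theta> d))"
      using assms(3) unfolding left_action_def by blast
    then show "measure (K (h + g) d) (act h ` B) = measure (K g d) B"
      using invariant_model[OF \<open>B \<in> sets borel\<close>, of "act\<^sub>\<Theta> g (\<theta> d)" h] by (simp add: K_def)
  qed
  have K_m: "distr (K g d) borel m = distr (K 0 d) borel m" for g d
    by (rule distr_invariant_statistic[where P="\<lambda>g. K g d", OF la K_inv K_prob m])
  have kernels: "(\<lambda>(g, d). K g d) \<in> borel \<Otimes>\<^sub>M \<Delta>\<^sub>0 \<rightarrow>\<^sub>M prob_algebra borel"
    "(\<lambda>(g, d). K g d) \<in> borel \<Otimes>\<^sub>M \<Delta>\<^sub>1 \<rightarrow>\<^sub>M prob_algebra borel"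
    using kernel_P kernel_Q by (auto simp: PK QK)
  have P_M': "P_M = (\<lambda>d. distr (K 0 d) borel m)" and Q_M': "Q_M = (\<lambda>d. distr (K 0 d) borel m)"
    unfolding P_M Q_M PK QK by auto
  have bind_prob: "\<pi> \<bind> k \<in> prob_on borel"
    if "\<pi> \<in> prob_on D" "k \<in> D \<rightarrow>\<^sub>M prob_algebra borel" for \<pi> :: "'e measure" and D and k :: "'e \<Rightarrow> ('n \<Rightarrow> 'x) measure"
    using prob_space_bind'[OF that] sets_bind'[OF that] by (simp add: space_prob_algebra)
  let ?L = "INF (\<Pi>\<^sub>0, \<Pi>\<^sub>1) \<in> prob_on (borel \<Otimes>\<^sub>M \<Delta>\<^sub>0) \<times> prob_on (borel \<Otimes>\<^sub>M \<Delta>\<^sub>1).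
            KL (\<Pi>\<^sub>1 \<bind> (\<lambda>(g, d). Q_gd g d)) (\<Pi>\<^sub>0 \<bind> (\<lambda>(g, d). P_gd g d))"
  let ?R = "INF (\<Pi>\<^sub>0, \<Pi>\<^sub>1) \<in> prob_on \<Delta>\<^sub>0 \<times> prob_on \<Delta>\<^sub>1. KL (\<Pi>\<^sub>1 \<bind> Q_M) (\<Pi>\<^sub>0 \<bind> P_M)"
  \<comment> \<open>data processing for \<open>m\<close>; the mixing measures become their marginals\<close>
  have "?R \<le> ?L"
  proof (rule INF_greatest, safe)
    fix \<Pi>\<^sub>0 \<Pi>\<^sub>1 :: "('g \<times> 'd) measure"
    assume \<pi>: "\<Pi>\<^sub>0 \<in> prob_on (borel \<Otimes>\<^sub>M \<Delta>\<^sub>0)" "\<Pi>\<^sub>1 \<in> prob_on (borel \<Otimes>\<^sub>M \<Delta>\<^sub>1)"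
    let ?P = "\<Pi>\<^sub>0 \<bind> (\<lambda>(g, d). K g d)" and ?Q = "\<Pi>\<^sub>1 \<bind> (\<lambda>(g, d). K g d)"
    have PQ: "?P \<in> prob_on borel" "?Q \<in> prob_on borel"
      using bind_prob[OF \<pi>(1) kernels(1)] bind_prob[OF \<pi>(2) kernels(2)] .
    have marginal: "distr \<pi> D snd \<in> prob_on D" if "\<pi> \<in> prob_on (borel \<Otimes>\<^sub>M D)"
      for \<pi> :: "('g \<times> 'd) measure" and D
    proof -
      have "prob_space \<pi>" and s: "sets \<pi> = sets (borel \<Otimes>\<^sub>M D)" using that by (auto simp: space_prob_algebra)
      moreover have "snd \<in> \<pi> \<rightarrow>\<^sub>M D" unfolding measurable_cong_sets[OF s refl] by (rule measurable_snd)
      ultimately show ?thesis by (simp add: space_prob_algebra prob_space.prob_space_distr)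
    qed
    have "?R \<le> KL (distr \<Pi>\<^sub>1 \<Delta>\<^sub>1 snd \<bind> Q_M) (distr \<Pi>\<^sub>0 \<Delta>\<^sub>0 snd \<bind> P_M)"
      using marginal[OF \<pi>(1)] marginal[OF \<pi>(2)]
      by (intro INF_lower2[of "(distr \<Pi>\<^sub>0 \<Delta>\<^sub>0 snd, distr \<Pi>\<^sub>1 \<Delta>\<^sub>1 snd)"]) auto
    also have "\<dots> = KL (distr ?Q borel m) (distr ?P borel m)"
      unfolding P_M' Q_M'
      using distr_bind_invariant_kernel[OF \<pi>(1) _ kernels(1) m(1) K_m]
        distr_bind_invariant_kernel[OF \<pi>(2) _ kernels(2) m(1) K_m] by simp
    also have "\<dots> \<le> KL ?Q ?P"
    proof (rule KL_pushforward_le)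
      have "sets ?P = sets borel" using PQ by (simp add: space_prob_algebra)
      then show "m \<in> borel_measurable ?P"
        using m(1) measurable_cong_sets[OF _ refl] by blast
    qed (use PQ in \<open>auto simp: space_prob_algebra\<close>)
    finally show "?R \<le> KL (\<Pi>\<^sub>1 \<bind> (\<lambda>(g, d). Q_gd g d)) (\<Pi>\<^sub>0 \<bind> (\<lambda>(g, d). P_gd g d))"
      by (simp only: PK QK)
  qed
  \<comment> \<open>product mixing measures \<open>S \<Otimes>\<^sub>M \<Pi>s\<^sub>0\<close> and \<open>S \<Otimes>\<^sub>M \<Pi>s\<^sub>1\<close>, with \<open>S\<close> spread out over the group\<close>
  moreover have "?L \<le> ?R"
  proof -
    have \<Pi>s: "\<Pi>s\<^sub>0 \<in> prob_on \<Delta>\<^sub>0" "\<Pi>s\<^sub>1 \<in> prob_on \<Delta>\<^sub>1"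
      and min: "\<And>\<Pi>\<^sub>0 \<Pi>\<^sub>1. \<Pi>\<^sub>0 \<in> prob_on \<Delta>\<^sub>0 \<Longrightarrow> \<Pi>\<^sub>1 \<in> prob_on \<Delta>\<^sub>1
        \<Longrightarrow> KL (\<Pi>s\<^sub>1 \<bind> Q_M) (\<Pi>s\<^sub>0 \<bind> P_M) \<le> KL (\<Pi>\<^sub>1 \<bind> Q_M) (\<Pi>\<^sub>0 \<bind> P_M)"
      using minimizer unfolding is_arg_min_linorder by auto
    have Kg: "K g \<in> \<Delta>\<^sub>0 \<rightarrow>\<^sub>M prob_algebra borel" "K g \<in> \<Delta>\<^sub>1 \<rightarrow>\<^sub>M prob_algebra borel" for g
      using measurable_compose[OF measurable_Pair1'[of g borel \<Delta>\<^sub>0] kernels(1)]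
        measurable_compose[OF measurable_Pair1'[of g borel \<Delta>\<^sub>1] kernels(2)] by simp_all
    have Ps': "Ps = (\<lambda>g. \<Pi>s\<^sub>0 \<bind> K g)" and Qs': "Qs = (\<lambda>g. \<Pi>s\<^sub>1 \<bind> K g)"
      unfolding Ps Qs PK QK by auto
    have Ps_prob: "Ps g \<in> prob_on borel" and Qs_prob: "Qs g \<in> prob_on borel" for g
      unfolding Ps' Qs' by (rule bind_prob[OF \<Pi>s(1) Kg(1)], rule bind_prob[OF \<Pi>s(2) Kg(2)])
    have sPs: "sets (Ps g) = sets borel" and sQs: "sets (Qs g) = sets borel" for g
      using Ps_prob[of g] Qs_prob[of g] by (auto simp: space_prob_algebra)
    have mPs: "m \<in> borel_measurable (Ps 0)" and mQs: "m \<in> borel_measurable (Qs 0)"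
      using m(1) measurable_cong_sets[OF sPs refl] measurable_cong_sets[OF sQs refl] by blast+
    have p[measurable]: "p g \<in> borel_measurable \<mu>" and q[measurable]: "q g \<in> borel_measurable \<mu>" for g
      using assms(32,34) measurable_cong_sets[OF sets_\<mu> refl] by blast+
    note [measurable] = assms(32,34)
    have supp: "0 < p g x \<longleftrightarrow> 0 < q h x" "0 < p g x \<longleftrightarrow> 0 < p h x" for g h x
      using support by blast+
    have ac: "absolutely_continuous (Qs 0) (Ps 0)" "absolutely_continuous (Ps 0) (Qs 0)"
      unfolding dens_Ps dens_Qs by (auto intro!: absolutely_continuous_density simp: supp(1)[of 0 _ 0])
    have quasi: "absolutely_continuous (Ps 0) (distr (Ps 0) borel (act g))" for g
    proof -
      have "absolutely_continuous (Ps 0) (Ps g)"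
        unfolding dens_Ps by (auto intro!: absolutely_continuous_density simp: supp(2)[of g _ 0])
      then show ?thesis
        by (simp add: invariant_family_eq_distr[OF inv_Ps Ps_prob, of g])
    qed
    have \<rho>: "Qs 0 = density (Ps 0) (\<lambda>x. q 0 x / p 0 x)"
      using density_quotient[of "q 0" \<mu> "p 0"] ac(2) assms(33,35) by (simp add: dens_Ps dens_Qs)
    have M_densities: "p_M \<in> borel_measurable \<nu>" "q_M \<in> borel_measurable \<nu>"
      using assms(41,43) measurable_cong_sets[OF assms(40) refl] by blast+
    have z: "distr (Qs 0) borel m = density (distr (Ps 0) borel m) (\<lambda>y. q_M y / p_M y)"
    proof -
      have "absolutely_continuous (density \<nu> p_M) (density \<nu> q_M)"
        using absolutely_continuous_distr[OF ac(2) _ mPs] sPs sQs assms(45)[of 0] assms(46)[of 0] by simp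
      from density_quotient[OF M_densities(2,1) assms(44,42) this] show ?thesis
        by (simp add: assms(45) assms(46))
    qed
    have ln_\<rho>: "integrable (Qs 0) (\<lambda>x. ln (q 0 x / p 0 x))"
    proof (rule integrable_if_powr_moment[OF _ _ assms(39,47)])
      show "(\<lambda>x. ln (q 0 x / p 0 x)) \<in> borel_measurable (Qs 0)"
        unfolding measurable_cong_sets[OF sQs refl] by measurable
    qed (use Qs_prob in \<open>auto simp: space_prob_algebra\<close>)
    have ln_z: "integrable (Qs 0) (\<lambda>x. ln (q_M (m x) / p_M (m x)))"
    proof (rule integrable_if_powr_moment[OF _ _ assms(39,48)])
      note [measurable] = m(1) assms(41,43)
      show "(\<lambda>x. ln (q_M (m x) / p_M (m x))) \<in> borel_measurable (Qs 0)"
        unfolding measurable_cong_sets[OF sQs refl] by measurable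
    qed (use Qs_prob in \<open>auto simp: space_prob_algebra\<close>)
    have star: "KL (distr (Qs 0) borel m) (distr (Ps 0) borel m) = KL (\<Pi>s\<^sub>1 \<bind> Q_M) (\<Pi>s\<^sub>0 \<bind> P_M)"
    proof -
      have "space \<Pi>s\<^sub>0 \<noteq> {}" "space \<Pi>s\<^sub>1 \<noteq> {}"
        using \<Pi>s by (auto simp: space_prob_algebra dest: prob_space.not_empty)
      moreover have "K 0 \<in> \<Pi>s\<^sub>0 \<rightarrow>\<^sub>M subprob_algebra borel" "K 0 \<in> \<Pi>s\<^sub>1 \<rightarrow>\<^sub>M subprob_algebra borel"
        using Kg[of 0] \<Pi>s by (auto simp: space_prob_algebra intro!: measurable_prob_algebraD cong: measurable_cong_sets)
      ultimately show ?thesis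
        unfolding Ps' Qs' P_M' Q_M' using m(1) by (simp add: distr_bind)
    qed
    have upper: "?L \<le> KL (\<Pi>s\<^sub>1 \<bind> Q_M) (\<Pi>s\<^sub>0 \<bind> P_M) + ereal \<eta>" if \<eta>: "0 < \<eta>" for \<eta>
    proof -
      obtain S where S: "S \<in> prob_on borel"
        and le: "KL (translate S (Qs 0)) (translate S (Ps 0))
          \<le> KL (distr (Qs 0) borel m) (distr (Ps 0) borel m) + ereal \<eta>"
      proof (rule amenable_mixture_KL_le[OF assms(22) Ps_prob[of 0] Qs_prob[of 0] ac(1) quasi m _ _ \<rho> ln_\<rho> _ _ z ln_z \<eta>])
      qed (use assms(32-35) assms(41-44) in auto)
      have tr: "(S \<Otimes>\<^sub>M \<Pi>s\<^sub>0) \<bind> (\<lambda>(g, d). K g d) = translate S (Ps 0)"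
        "(S \<Otimes>\<^sub>M \<Pi>s\<^sub>1) \<bind> (\<lambda>(g, d). K g d) = translate S (Qs 0)"
        unfolding Ps' Qs'
        using bind_product_eq_translate[OF S \<Pi>s(1) kernels(1)] bind_product_eq_translate[OF S \<Pi>s(2) kernels(2)]
          inv_Ps inv_Qs Ps_prob Qs_prob unfolding Ps' Qs' by blast+
      have prod: "S \<Otimes>\<^sub>M \<pi> \<in> prob_on (borel \<Otimes>\<^sub>M D)" if "\<pi> \<in> prob_on D" for \<pi> D :: "'d measure"
      proof -
        interpret S: prob_space S using S by (simp add: space_prob_algebra)
        interpret \<pi>: prob_space \<pi> using that by (simp add: space_prob_algebra)
        interpret SP: pair_prob_space S \<pi> ..
        show ?thesis
          using S that SP.prob_space_axioms by (simp add: space_prob_algebra cong: sets_pair_measure_cong)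
      qed
      have "?L \<le> KL (translate S (Qs 0)) (translate S (Ps 0))"
        using prod[OF \<Pi>s(1)] prod[OF \<Pi>s(2)]
        by (intro INF_lower2[of "(S \<Otimes>\<^sub>M \<Pi>s\<^sub>0, S \<Otimes>\<^sub>M \<Pi>s\<^sub>1)"]) (auto simp: PK QK tr)
      with le show ?thesis
        unfolding star by (rule order_trans[rotated])
    qed
    have "?L \<le> KL (\<Pi>s\<^sub>1 \<bind> Q_M) (\<Pi>s\<^sub>0 \<bind> P_M)"
      by (rule ereal_le_epsilon2) (use upper in auto)
    also have "\<dots> \<le> ?R"
      using min by (intro INF_greatest) auto
    finally show ?thesis .
  qed
  ultimately show ?thesis
    by (rule antisym[rotated])
qed

end
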